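(* Let $T_1,T_2$ be commuting contractions on a finite-dimensional Hilbert space $\mathcal H$, and let $\mathcal H=\bigoplus_{i=1}^4\mathcal H_i$, $T_j=\bigoplus_{i=1}^4T_j^{(i)}$ be a decomposition into subspaces reducing both $T_1,T_2$ with $T_1^{(1)},T_1^{(2)},T_2^{(1)},T_2^{(3)}$ unitary and $T_1^{(3)},T_1^{(4)},T_2^{(2)},T_2^{(4)}$ completely non-unitary. Then for every $p\in\mathbb C[z,w]$, $\|p(T_1,T_2)\|\le\max_{i\in\{1,2,3,4\}}\|p(T_1^{(i)},T_2^{(i)})\|$ (maximum over nonzero $\mathcal H_i$), where (1) $\|p(T_1^{(1)},T_2^{(1)})\|\le\max_{(\lambda,\mu)\in\Omega_{(T_1^{(1)},T_2^{(1)})}}|p(\lambda,\mu)|$; (2) $\|p(T_1^{(2)},T_2^{(2)})\|\le\max_{\lambda\in\sigma(T_1^{(2)})}\|p(\lambda I,B_{T_2^{(2)},\lambda})\|$; (3) $\|p(T_1^{(3)},T_2^{(3)})\|\le\max_{\mu\in\sigma(T_2^{(3)})}\|p(B_{T_1^{(3)},\mu},\mu I)\|$; (4) $\|p(T_1^{(4)},T_2^{(4)})\|\le\inf_{U,W}\min\{\|p(B_{T_1^{(4)}}\otimes I_{\mathbb C^{e_1}},\varphi_{U^*}(B_{T_1^{(4)}}))\|,\ \|p(\varphi_{W^*}(B_{T_2^{(4)}}),B_{T_2^{(4)}}\otimes I_{\mathbb C^{e_2}})\|\}$, the infimum over $U\in\mathcal U_{(T_1^{(4)},T_2^{(4)})}$,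 $W\in\mathcal U_{(T_2^{(4)},T_1^{(4)})}$, where $e_j=\dim\mathcal D_{T_j^{(4)}}$.
   Context: $S$ is the unilateral shift on $H^2(\mathbb D)$. Universal model: for a completely non-unitary contraction $T$ on a finite-dimensional space (no eigenvalues of modulus 1) with minimal polynomial $m_T(z)=\prod_i(z-\lambda_i)^{n_i}$, $b_T(z)=\prod_i\big(\frac{z-\lambda_i}{1-\bar\lambda_iz}\big)^{n_i}$, $\mathcal N_T=H^2\ominus b_TH^2$, $B_T=P_{\mathcal N_T}S|_{\mathcal N_T}$. $\Omega_{(A,C)}=\{(\lambda,\mu)\in\sigma(A)\times\sigma(C):\ker(A-\lambda I)\cap\ker(C-\mu I)\ne\{0\}\}$. $B_{T_2^{(2)},\lambda}$ is the universal model of the restriction of $T_2^{(2)}$ to the eigenspace $\ker(T_1^{(2)}-\lambda I)$ (which reduces $T_2^{(2)}$); $B_{T_1^{(3)},\mu}$ is the universal model of the restriction of $T_1^{(3)}$ to $\ker(T_2^{(3)}-\mu I)$. $\Delta_T=(I-TT^* )^{1/2}$, $\mathcal D_T=\overline{\Delta_T\mathcal H}$. For commuting contractions $T,T'$, $\mathcal U_{(T,T')}$ is the set of unitaries on $\mathcal D_T\oplus\mathcal D_{T'}$ extending $(\Delta_Th,\Delta_{T'}T^*h)\mapsto(\Delta_TT'^*h,\Delta_{T'}h)$; for $U=\begin{bmatrix}A&B\\C&D\end{bmatrix}$ ($A\in B(\mathcal D_T)$, $B:\mathcal D_{T'}\to\mathcal D_T$, $C:\mathcal D_T\to\mathcal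 D_{T'}$, $D\in B(\mathcal D_{T'})$), $\varphi_{U^*}(z)=A^*+zC^*(I-zD^* )^{-1}B^*$, $\varphi_{U^*}(S)$ is the multiplication operator on $H^2\otimes\mathcal D_T$, and $\varphi_{U^*}(B_T)=P_{\mathcal N_T\otimes\mathcal D_T}\varphi_{U^*}(S)|_{\mathcal N_T\otimes\mathcal D_T}$. *)

theory Defs
  imports "HOL-Analysis.Analysis" "HOL-Computational_Algebra.Computational_Algebra" "HOL-Library.Function_Algebras"
begin

type_synonym 'n cvec = "complex ^ 'n"
type_synonym 'n cmat = "complex ^ 'n ^ 'n"

text \<open>Complex inner product on complex^n (linear in the first argument).
  Note that the library norm on complex^n is the Euclidean norm, so
  norm x = sqrt (Re (cinner x x)).\<close>
definition cinner :: "'n::finite cvec \<Rightarrow> 'n cvec \<Rightarrow> complex" where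
  "cinner x y = (\<Sum>i\<in>UNIV. x $ i * cnj (y $ i))"

definition cadj :: "'n::finite cmat \<Rightarrow> 'n cmat" where
  "cadj A = (\<chi> i j. cnj (A $ j $ i))"

definition csubspace :: "'n::finite cvec set \<Rightarrow> bool" where
  "csubspace M \<longleftrightarrow> 0 \<in> M \<and> (\<forall>x\<in>M. \<forall>y\<in>M. x + y \<in> M) \<and> (\<forall>c. \<forall>x\<in>M. c *s x \<in> M)"

definition reduces :: "'n::finite cvec set \<Rightarrow> 'n cmat \<Rightarrow> bool" where
  "reduces M T \<longleftrightarrow> csubspace M \<and> (\<forall>x\<in>M. T *v x \<in> M) \<and> (\<forall>x\<in>M. cadj T *v x \<in> M)"

definition opnorm_on :: "'n::finite cvec set \<Rightarrow> ('n cvec \<Rightarrow> 'n cvec) \<Rightarrow> real" where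
  "opnorm_on M A = Sup {norm (A x) | x. x \<in> M \<and> norm x \<le> 1}"

definition contraction :: "'n::finite cmat \<Rightarrow> bool" where
  "contraction T \<longleftrightarrow> opnorm_on UNIV (\<lambda>x. T *v x) \<le> 1"

definition unitary_on :: "'n::finite cvec set \<Rightarrow> 'n cmat \<Rightarrow> bool" where
  "unitary_on M T \<longleftrightarrow> (\<forall>x\<in>M. cadj T *v (T *v x) = x \<and> T *v (cadj T *v x) = x)"

definition cnu_on :: "'n::finite cvec set \<Rightarrow> 'n cmat \<Rightarrow> bool" where
  "cnu_on M T \<longleftrightarrow> (\<forall>N. N \<subseteq> M \<and> reduces N T \<and> unitary_on N T \<longrightarrow> N = {0})"

text \<open>Point spectrum (= spectrum, finite dimension) of T restricted to M.\<close>
definition spec_on :: "'n::finite cvec set \<Rightarrow> 'n cmat \<Rightarrow> complex set" where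
  "spec_on M T = {l. \<exists>x\<in>M. x \<noteq> 0 \<and> T *v x = l *s x}"

definition Omega_on :: "'n::finite cvec set \<Rightarrow> 'n cmat \<Rightarrow> 'n cmat \<Rightarrow> (complex \<times> complex) set" where
  "Omega_on M A C = {(l, m). l \<in> spec_on M A \<and> m \<in> spec_on M C \<and>
      (\<exists>x\<in>M. x \<noteq> 0 \<and> A *v x = l *s x \<and> C *v x = m *s x)}"

definition eigenspace_on :: "'n::finite cvec set \<Rightarrow> 'n cmat \<Rightarrow> complex \<Rightarrow> 'n cvec set" where
  "eigenspace_on M T l = {x \<in> M. T *v x = l *s x}"

text \<open>A polynomial p in C[z,w] is given by its coefficient function
  (i,j) \<mapsto> coefficient of z^i w^j, with finite support.
  p(A,B) = sum of c_ij A^i B^j; sc is the scalar multiplication of the space.\<close>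
definition poly2 :: "(nat \<times> nat \<Rightarrow> complex) \<Rightarrow> bool" where
  "poly2 p \<longleftrightarrow> finite {ij. p ij \<noteq> 0}"

definition peval2_scalar :: "(nat \<times> nat \<Rightarrow> complex) \<Rightarrow> complex \<Rightarrow> complex \<Rightarrow> complex" where
  "peval2_scalar p z w = (\<Sum>ij\<in>{ij. p ij \<noteq> 0}. p ij * z ^ fst ij * w ^ snd ij)"

definition peval2 :: "(nat \<times> nat \<Rightarrow> complex) \<Rightarrow> (complex \<Rightarrow> 'a \<Rightarrow> 'a) \<Rightarrow>
    ('a \<Rightarrow> 'a) \<Rightarrow> ('a \<Rightarrow> 'a) \<Rightarrow> 'a \<Rightarrow> 'a::comm_monoid_add" where
  "peval2 p sc A B x = (\<Sum>ij\<in>{ij. p ij \<noteq> 0}. sc (p ij) ((A ^^ fst ij) ((B ^^ snd ij) x)))"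

definition pmat :: "(nat \<times> nat \<Rightarrow> complex) \<Rightarrow> 'n::finite cmat \<Rightarrow> 'n cmat \<Rightarrow> 'n cvec \<Rightarrow> 'n cvec" where
  "pmat p T1 T2 = peval2 p (\<lambda>c v. c *s v) (\<lambda>x. T1 *v x) (\<lambda>x. T2 *v x)"

definition polyop :: "complex poly \<Rightarrow> 'n::finite cmat \<Rightarrow> 'n cvec \<Rightarrow> 'n cvec" where
  "polyop q T x = (\<Sum>i\<le>degree q. coeff q i *s (((\<lambda>y. T *v y) ^^ i) x))"

definition annihilates_on :: "'n::finite cvec set \<Rightarrow> 'n cmat \<Rightarrow> complex poly \<Rightarrow> bool" where
  "annihilates_on M T q \<longleftrightarrow> (\<forall>x\<in>M. polyop q T x = 0)"

definition minpoly_on :: "'n::finite cvec set \<Rightarrow> 'n cmat \<Rightarrow> complex poly" where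
  "minpoly_on M T = (THE m. lead_coeff m = 1 \<and> annihilates_on M T m \<and>
      (\<forall>q. q \<noteq> 0 \<and> annihilates_on M T q \<longrightarrow> degree m \<le> degree q))"

text \<open>b_T(z) = prod_i ((z - l_i)/(1 - cnj l_i z))^(n_i), as a power series (Taylor
  coefficients at 0), where m_T(z) = prod_i (z - l_i)^(n_i).\<close>
definition blaschke_fps :: "'n::finite cvec set \<Rightarrow> 'n cmat \<Rightarrow> complex fps" where
  "blaschke_fps M T = (let m = minpoly_on M T in
     (\<Prod>l\<in>{z. poly m z = 0}.
        (fps_of_poly [:- l, 1:] * inverse (fps_of_poly [:1, - cnj l:])) ^ order l m))"

section \<open>Hardy space H^2 (as square-summable Taylor coefficient sequences)\<close>

definition H2 :: "(nat \<Rightarrow> complex) set" where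
  "H2 = {f. summable (\<lambda>k. (cmod (f k))\<^sup>2)}"

definition l2inner :: "(nat \<Rightarrow> complex) \<Rightarrow> (nat \<Rightarrow> complex) \<Rightarrow> complex" where
  "l2inner f g = (\<Sum>k. f k * cnj (g k))"

definition l2norm :: "(nat \<Rightarrow> complex) \<Rightarrow> real" where
  "l2norm f = sqrt (\<Sum>k. (cmod (f k))\<^sup>2)"

definition l2proj :: "(nat \<Rightarrow> complex) set \<Rightarrow> (nat \<Rightarrow> complex) \<Rightarrow> (nat \<Rightarrow> complex)" where
  "l2proj K f = (THE g. g \<in> K \<and> (\<forall>h\<in>K. l2inner (\<lambda>k. f k - g k) h = 0))"

definition shift :: "(nat \<Rightarrow> 'a::zero) \<Rightarrow> nat \<Rightarrow> 'a" where
  "shift f k = (case k of 0 \<Rightarrow> 0 | Suc j \<Rightarrow> f j)"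

definition bH2 :: "'n::finite cvec set \<Rightarrow> 'n cmat \<Rightarrow> (nat \<Rightarrow> complex) set" where
  "bH2 M T = {fps_nth (blaschke_fps M T * Abs_fps f) | f. f \<in> H2}"

definition model_space :: "'n::finite cvec set \<Rightarrow> 'n cmat \<Rightarrow> (nat \<Rightarrow> complex) set" where
  "model_space M T = {g \<in> H2. \<forall>h\<in>bH2 M T. l2inner g h = 0}"

definition model_op :: "'n::finite cvec set \<Rightarrow> 'n cmat \<Rightarrow> (nat \<Rightarrow> complex) \<Rightarrow> (nat \<Rightarrow> complex)" where
  "model_op M T f = l2proj (model_space M T) (shift f)"

definition l2opnorm_on :: "(nat \<Rightarrow> complex) set \<Rightarrow> ((nat \<Rightarrow> complex) \<Rightarrow> (nat \<Rightarrow> complex)) \<Rightarrow> real" where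
  "l2opnorm_on K A = Sup {l2norm (A f) | f. f \<in> K \<and> l2norm f \<le> 1}"

definition pseq :: "(nat \<times> nat \<Rightarrow> complex) \<Rightarrow> ((nat \<Rightarrow> complex) \<Rightarrow> (nat \<Rightarrow> complex)) \<Rightarrow>
    ((nat \<Rightarrow> complex) \<Rightarrow> (nat \<Rightarrow> complex)) \<Rightarrow> (nat \<Rightarrow> complex) \<Rightarrow> (nat \<Rightarrow> complex)" where
  "pseq p A B = peval2 p (\<lambda>c f k. c * f k) A B"

definition H2V :: "'n::finite cvec set \<Rightarrow> (nat \<Rightarrow> 'n cvec) set" where
  "H2V D = {f. (\<forall>k. f k \<in> D) \<and> summable (\<lambda>k. (norm (f k))\<^sup>2)}"

definition vinner :: "(nat \<Rightarrow> 'n::finite cvec) \<Rightarrow> (nat \<Rightarrow> 'n cvec) \<Rightarrow> complex" where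
  "vinner f g = (\<Sum>k. cinner (f k) (g k))"

definition vnorm :: "(nat \<Rightarrow> 'n::finite cvec) \<Rightarrow> real" where
  "vnorm f = sqrt (\<Sum>k. (norm (f k))\<^sup>2)"

definition vproj :: "(nat \<Rightarrow> 'n::finite cvec) set \<Rightarrow> (nat \<Rightarrow> 'n cvec) \<Rightarrow> (nat \<Rightarrow> 'n cvec)" where
  "vproj K f = (THE g. g \<in> K \<and> (\<forall>h\<in>K. vinner (\<lambda>k. f k - g k) h = 0))"

definition vopnorm_on :: "(nat \<Rightarrow> 'n::finite cvec) set \<Rightarrow> ((nat \<Rightarrow> 'n cvec) \<Rightarrow> (nat \<Rightarrow> 'n cvec)) \<Rightarrow> real" where
  "vopnorm_on K A = Sup {vnorm (A f) | f. f \<in> K \<and> vnorm f \<le> 1}"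

text \<open>N_T tensor D, realised inside H^2(D) = H^2 tensor D: the D-valued H^2 functions
  all of whose scalar components lie in N_T.\<close>
definition model_tensor :: "'n::finite cvec set \<Rightarrow> 'n cmat \<Rightarrow> 'n cvec set \<Rightarrow> (nat \<Rightarrow> 'n cvec) set" where
  "model_tensor M T D = {f \<in> H2V D. \<forall>v. (\<lambda>k. cinner (f k) v) \<in> model_space M T}"

text \<open>B_T tensor I_D = compression of S tensor I to N_T tensor D.\<close>
definition model_op_tensor :: "'n::finite cvec set \<Rightarrow> 'n cmat \<Rightarrow> 'n cvec set \<Rightarrow> (nat \<Rightarrow> 'n cvec) \<Rightarrow> (nat \<Rightarrow> 'n cvec)" where
  "model_op_tensor M T D f = vproj (model_tensor M T D) (shift f)"

definition pvseq :: "(nat \<times> nat \<Rightarrow> complex) \<Rightarrow> ((nat \<Rightarrow> 'n::finite cvec) \<Rightarrow> (nat \<Rightarrow> 'n cvec)) \<Rightarrow>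
    ((nat \<Rightarrow> 'n cvec) \<Rightarrow> (nat \<Rightarrow> 'n cvec)) \<Rightarrow> (nat \<Rightarrow> 'n cvec) \<Rightarrow> (nat \<Rightarrow> 'n cvec)" where
  "pvseq p A B = peval2 p (\<lambda>c f k. c *s f k) A B"

text \<open>Delta_T = (I - T T*)^(1/2) for T restricted to the reducing subspace M:
  the positive square root on M (set to 0 off M).\<close>
definition defect :: "'n::finite cvec set \<Rightarrow> 'n cmat \<Rightarrow> 'n cvec \<Rightarrow> 'n cvec" where
  "defect M T = (THE R. (\<forall>x. x \<notin> M \<longrightarrow> R x = 0) \<and> (\<forall>x\<in>M. R x \<in> M) \<and>
      (\<forall>x\<in>M. R (R x) = x - T *v (cadj T *v x)) \<and>
      (\<forall>x\<in>M. \<forall>y\<in>M. cinner (R x) y = cinner x (R y)) \<and>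
      (\<forall>x\<in>M. 0 \<le> Re (cinner (R x) x)))"

text \<open>D_T = closure of the range of Delta_T (closed, finite dimension).\<close>
definition defect_space :: "'n::finite cvec set \<Rightarrow> 'n cmat \<Rightarrow> 'n cvec set" where
  "defect_space M T = defect M T ` M"

definition pinner :: "'n::finite cvec \<times> 'n cvec \<Rightarrow> 'n cvec \<times> 'n cvec \<Rightarrow> complex" where
  "pinner a b = cinner (fst a) (fst b) + cinner (snd a) (snd b)"

definition unitary_pair :: "('n::finite cvec \<times> 'n cvec) set \<Rightarrow> ('n cvec \<times> 'n cvec \<Rightarrow> 'n cvec \<times> 'n cvec) \<Rightarrow> bool" where
  "unitary_pair Sp U \<longleftrightarrow> (\<forall>a\<in>Sp. U a \<in> Sp) \<and> U ` Sp = Sp \<and>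
     (\<forall>a\<in>Sp. \<forall>b\<in>Sp. U (fst a + fst b, snd a + snd b) = (fst (U a) + fst (U b), snd (U a) + snd (U b))) \<and>
     (\<forall>c. \<forall>a\<in>Sp. U (c *s fst a, c *s snd a) = (c *s fst (U a), c *s snd (U a))) \<and>
     (\<forall>a\<in>Sp. \<forall>b\<in>Sp. pinner (U a) (U b) = pinner a b)"

definition unitaries_U :: "'n::finite cvec set \<Rightarrow> 'n cmat \<Rightarrow> 'n cmat \<Rightarrow>
    ('n cvec \<times> 'n cvec \<Rightarrow> 'n cvec \<times> 'n cvec) set" where
  "unitaries_U M T T' = {U. unitary_pair (defect_space M T \<times> defect_space M T') U \<and>
     (\<forall>h\<in>M. U (defect M T h, defect M T' (cadj T *v h)) = (defect M T (cadj T' *v h), defect M T' h))}"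

definition adj_pair :: "('n::finite cvec \<times> 'n cvec) set \<Rightarrow> ('n cvec \<times> 'n cvec \<Rightarrow> 'n cvec \<times> 'n cvec) \<Rightarrow>
    ('n cvec \<times> 'n cvec \<Rightarrow> 'n cvec \<times> 'n cvec)" where
  "adj_pair Sp U = (THE V. (\<forall>a. a \<notin> Sp \<longrightarrow> V a = (0, 0)) \<and> (\<forall>b\<in>Sp. V b \<in> Sp) \<and>
      (\<forall>a\<in>Sp. \<forall>b\<in>Sp. pinner (U a) b = pinner a (V b)))"

text \<open>Taylor coefficients of phi_(U*)(z) = A* + z C* (I - z D*)^(-1) B*, where
  U = [A B; C D], so U* = [A* C*; B* D*]:  coefficient 0 is A*, coefficient n \<ge> 1
  is C* (D*)^(n-1) B*.\<close>
definition transfer_coeff :: "('n::finite cvec \<times> 'n cvec) set \<Rightarrow> ('n cvec \<times> 'n cvec \<Rightarrow> 'n cvec \<times> 'n cvec) \<Rightarrow>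
    nat \<Rightarrow> 'n cvec \<Rightarrow> 'n cvec" where
  "transfer_coeff Sp U n x = (let V = adj_pair Sp U in
     (if n = 0 then fst (V (x, 0))
      else fst (V (0, ((\<lambda>y. snd (V (0, y))) ^^ (n - 1)) (snd (V (x, 0)))))))"

text \<open>phi_(U*)(S): multiplication operator on H^2 tensor D_T.\<close>
definition phi_S :: "('n::finite cvec \<times> 'n cvec) set \<Rightarrow> ('n cvec \<times> 'n cvec \<Rightarrow> 'n cvec \<times> 'n cvec) \<Rightarrow>
    (nat \<Rightarrow> 'n cvec) \<Rightarrow> (nat \<Rightarrow> 'n cvec)" where
  "phi_S Sp U f k = (\<Sum>j\<le>k. transfer_coeff Sp U j (f (k - j)))"

definition phi_B :: "'n::finite cvec set \<Rightarrow> 'n cmat \<Rightarrow> 'n cmat \<Rightarrow>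
    ('n cvec \<times> 'n cvec \<Rightarrow> 'n cvec \<times> 'n cvec) \<Rightarrow> (nat \<Rightarrow> 'n cvec) \<Rightarrow> (nat \<Rightarrow> 'n cvec)" where
  "phi_B M T T' U f = vproj (model_tensor M T (defect_space M T))
      (phi_S (defect_space M T \<times> defect_space M T') U f)"

end

theory Submission
  imports Defs
begin

text \<open>A completely non-unitary contraction \<open>T\<close> in finite dimension has its spectrum in the open disc, so
  \<open>T\<^sup>*\<^sup>k \<rightarrow> 0\<close> and \<open>V h = (\<Delta>\<^sub>T T\<^sup>*\<^sup>k h)\<^sub>k\<close> is an isometry into \<open>H\<^sup>2 \<otimes> D\<^sub>T\<close>. Since the minimal polynomial
  annihilates \<open>T\<close>, the range of \<open>V\<close> lies in \<open>N\<^sub>T \<otimes> D\<^sub>T\<close>, and \<open>V\<close> intertwines \<open>T\<^sup>*\<close> with the adjoint of \<open>B\<^sub>T \<otimes> I\<close>.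
  For \<open>U\<close> extending \<open>(\<Delta>\<^sub>T h, \<Delta>\<^sub>T\<^sub>' T\<^sup>* h) \<mapsto> (\<Delta>\<^sub>T T'\<^sup>* h, \<Delta>\<^sub>T\<^sub>' h)\<close>, the energy balance of the colligation \<open>U\<^sup>*\<close>
  telescopes and shows that \<open>V\<close> also intertwines \<open>T'\<^sup>*\<close> with the adjoint of the multiplication by
  the transfer function. Hence \<open>p(T, T')\<^sup>*\<close> is the restriction to the range of \<open>V\<close> of the adjoint of
  \<open>p\<close> evaluated at the model pair. On the parts where one operator is unitary, its eigenspaces reduce
  the other one and the one-variable version of the argument applies on each of them.\<close>

subsection \<open>Complex inner product spaces\<close>

text \<open>The notions are built with THE, Sup, INF and Max, so existence has to come first:
  projections onto the model spaces, the root \<open>defect\<close>, the adjoint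
  \<open>adj_pair\<close>, the minimal polynomial, bounds for the sets under Sup, and some unitary
  in \<open>unitaries_U\<close>, without which the infimum would be an unspecified number.
  Completeness of the Hardy space is bypassed. The series b_T is m_T times a series r that is the
  inverse of a polynomial and preserves H^2 once the zeros of m_T lie in the disc. Orthogonality to
  b_T H^2 thereby becomes a linear recurrence with the conjugated coefficients of m_T; the first deg
  m_T coefficients determine an element, and projections exist by finite dimensionality. The same
  recurrence is what places the range of V in the model space. Bounds are proved for adjoints
  because V intertwines T*, not T; they are dualised at the end. C^n, pairs of vectors, and scalar
  and vector-valued H^2 all instantiate \<open>cips\<close>. Its carrier \<open>H\<close> is
  explicit because square-summable sequences form only a part of their type.\<close>

locale cips = vector_space sc for sc :: "complex \<Rightarrow> 'a::ab_group_add \<Rightarrow> 'a" +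
  fixes H :: "'a set" and ip :: "'a \<Rightarrow> 'a \<Rightarrow> complex"
  assumes subspace_H: "subspace H"
    and ip_add: "\<lbrakk>x \<in> H; y \<in> H; z \<in> H\<rbrakk> \<Longrightarrow> ip (x + y) z = ip x z + ip y z"
    and ip_sc: "\<lbrakk>x \<in> H; y \<in> H\<rbrakk> \<Longrightarrow> ip (sc c x) y = c * ip x y"
    and ip_cnj: "\<lbrakk>x \<in> H; y \<in> H\<rbrakk> \<Longrightarrow> cnj (ip x y) = ip y x"
    and ip_nonneg: "x \<in> H \<Longrightarrow> 0 \<le> Re (ip x x)"
    and ip_definite: "\<lbrakk>x \<in> H; ip x x = 0\<rbrakk> \<Longrightarrow> x = 0"
begin

lemmas H_closed = subspace_0[OF subspace_H] subspace_add[OF subspace_H]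
  subspace_diff[OF subspace_H] subspace_scale[OF subspace_H] subspace_sum[OF subspace_H]

lemma ip_add_right: "\<lbrakk>x \<in> H; y \<in> H; z \<in> H\<rbrakk> \<Longrightarrow> ip z (x + y) = ip z x + ip z y"
  by (metis H_closed(2) complex_cnj_add ip_add ip_cnj)

lemma ip_sc_right: "\<lbrakk>x \<in> H; y \<in> H\<rbrakk> \<Longrightarrow> ip x (sc c y) = cnj c * ip x y"
  by (metis H_closed(4) complex_cnj_mult ip_cnj ip_sc)

lemma ip_diff: "\<lbrakk>x \<in> H; y \<in> H; z \<in> H\<rbrakk> \<Longrightarrow> ip (x - y) z = ip x z - ip y z"
  by (metis H_closed(3) add_diff_cancel_right' diff_add_cancel ip_add)

lemma ip_diff_right: "\<lbrakk>x \<in> H; y \<in> H; z \<in> H\<rbrakk> \<Longrightarrow> ip z (x - y) = ip z x - ip z y"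
  by (metis H_closed(3) add_diff_cancel_right' diff_add_cancel ip_add_right)

lemma ip_zero: "x \<in> H \<Longrightarrow> ip 0 x = 0" "x \<in> H \<Longrightarrow> ip x 0 = 0"
  by (metis H_closed(1) add_cancel_right_right ip_add add_0, metis H_closed(1) add_cancel_right_right ip_add_right add_0)

lemma ip_sum:
  assumes "\<And>i. i \<in> I \<Longrightarrow> f i \<in> H" "x \<in> H"
  shows "ip (sum f I) x = (\<Sum>i\<in>I. ip (f i) x)"
  using assms
proof (induction I rule: infinite_finite_induct)
  case (insert i I)
  then have "sum f I \<in> H" by (auto intro: H_closed)
  with insert show ?case by (simp add: ip_add)
qed (auto simp: ip_zero)

lemma ip_sum_right:
  assumes "\<And>i. i \<in> I \<Longrightarrow> f i \<in> H" "x \<in> H"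
  shows "ip x (sum f I) = (\<Sum>i\<in>I. ip x (f i))"
proof -
  have "sum f I \<in> H" using assms by (auto intro: H_closed)
  then have "ip x (sum f I) = cnj (ip (sum f I) x)" using assms by (simp add: ip_cnj)
  also have "\<dots> = (\<Sum>i\<in>I. ip x (f i))" using assms by (simp add: ip_sum ip_cnj)
  finally show ?thesis .
qed

definition nrm :: "'a \<Rightarrow> real" where "nrm x = sqrt (Re (ip x x))"

lemma nrm_nonneg [simp]: "x \<in> H \<Longrightarrow> 0 \<le> nrm x"
  by (simp add: nrm_def ip_nonneg)

lemma ip_self: "x \<in> H \<Longrightarrow> ip x x = complex_of_real ((nrm x)\<^sup>2)"
proof -
  assume x: "x \<in> H"
  then have "cnj (ip x x) = ip x x" by (rule ip_cnj) (rule x)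
  then have "ip x x = complex_of_real (Re (ip x x))" by (simp add: Reals_cnj_iff of_real_Re flip: of_real_Re)
  then show ?thesis using ip_nonneg[OF x] by (simp add: nrm_def)
qed

lemma nrm_sq: "x \<in> H \<Longrightarrow> (nrm x)\<^sup>2 = Re (ip x x)"
  by (simp add: nrm_def ip_nonneg)

lemma nrm_zero [simp]: "nrm 0 = 0"
  by (simp add: nrm_def ip_zero H_closed)

lemma nrm_eq_0: "\<lbrakk>x \<in> H; nrm x = 0\<rbrakk> \<Longrightarrow> x = 0"
  using ip_definite ip_self by force

lemma nrm_sc: "x \<in> H \<Longrightarrow> nrm (sc c x) = cmod c * nrm x"
proof -
  assume x: "x \<in> H"
  have "ip (sc c x) (sc c x) = (c * cnj c) * ip x x"
    using x by (simp add: ip_sc ip_sc_right H_closed)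
  also have "\<dots> = complex_of_real ((cmod c * nrm x)\<^sup>2)"
    using x by (simp only: complex_norm_square[symmetric] ip_self) (simp add: power_mult_distrib)
  finally show ?thesis using x by (simp add: nrm_def real_sqrt_mult ip_nonneg)
qed

lemma pythagoras:
  assumes "x \<in> H" "y \<in> H" "ip x y = 0"
  shows "(nrm (x + y))\<^sup>2 = (nrm x)\<^sup>2 + (nrm y)\<^sup>2"
proof -
  have "ip y x = 0" using assms ip_cnj[of x y] by simp
  then show ?thesis using assms by (simp add: nrm_sq H_closed ip_add ip_add_right)
qed

lemma pythagoras_sum:
  assumes "finite I" "\<And>i. i \<in> I \<Longrightarrow> f i \<in> H"
    and "\<And>i j. \<lbrakk>i \<in> I; j \<in> I; i \<noteq> j\<rbrakk> \<Longrightarrow> ip (f i) (f j) = 0"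
  shows "(nrm (sum f I))\<^sup>2 = (\<Sum>i\<in>I. (nrm (f i))\<^sup>2)"
  using assms
proof (induction I rule: finite_induct)
  case (insert i I)
  have "ip (f i) (sum f I) = 0"
    using insert by (subst ip_sum_right) (auto intro!: sum.neutral)
  then show ?case using insert by (subst sum.insert, simp, simp)
    (subst pythagoras, auto intro: H_closed)
qed simp

lemma cauchy_schwarz:
  assumes x: "x \<in> H" and y: "y \<in> H"
  shows "cmod (ip x y) \<le> nrm x * nrm y"
proof (cases "nrm y = 0")
  case True
  then show ?thesis using nrm_eq_0[OF y] by (simp add: ip_zero x)
next
  case False
  define u where "u = sc (ip x y / ip y y) y"
  have yy: "ip y y \<noteq> 0" using False y ip_self by simp
  have u: "u \<in> H" by (simp add: u_def H_closed y)
  have "ip (x - u) y = 0" using x y u yy by (simp add: ip_diff ip_sc u_def)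
  then have "ip (x - u) u = 0"
    using x y u by (simp add: u_def ip_sc_right H_closed)
  then have "(nrm ((x - u) + u))\<^sup>2 = (nrm (x - u))\<^sup>2 + (nrm u)\<^sup>2"
    using x u by (intro pythagoras) (auto simp: H_closed)
  then have "(nrm u)\<^sup>2 \<le> (nrm x)\<^sup>2" by simp
  then have "nrm u \<le> nrm x" using x by (simp add: power2_le_iff_abs_le u)
  moreover have "nrm u = cmod (ip x y) / nrm y"
    using y False by (simp add: u_def nrm_sc norm_divide ip_self power2_eq_square del: of_real_mult)
  ultimately show ?thesis using False nrm_nonneg[OF y] by (simp add: field_simps)
qed

lemma nrm_triangle: "\<lbrakk>x \<in> H; y \<in> H\<rbrakk> \<Longrightarrow> nrm (x + y) \<le> nrm x + nrm y"
proof -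
  assume x: "x \<in> H" and y: "y \<in> H"
  have "Re (ip y x) = Re (ip x y)" using ip_cnj[OF x y] by (metis complex_cnj(1) complex.sel(1) cnj.simps(1))
  moreover have "Re (ip x y) \<le> nrm x * nrm y"
    using cauchy_schwarz[OF x y] complex_Re_le_cmod[of "ip x y"] by linarith
  ultimately have "(nrm (x + y))\<^sup>2 \<le> (nrm x + nrm y)\<^sup>2"
    using x y by (simp add: nrm_sq H_closed ip_add ip_add_right power2_sum)
  then show ?thesis using x y by (simp add: power2_le_iff_abs_le H_closed)
qed

lemma nrm_sum_le:
  assumes "\<And>i. i \<in> I \<Longrightarrow> f i \<in> H"
  shows "nrm (sum f I) \<le> (\<Sum>i\<in>I. nrm (f i))"
  using assms
proof (induction I rule: infinite_finite_induct)
  case (insert i I)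
  have "nrm (sum f (insert i I)) \<le> nrm (f i) + nrm (sum f I)"
    using insert by (simp add: nrm_triangle H_closed)
  then show ?case using insert by fastforce
qed auto

section \<open>Orthogonal projections without completeness\<close>

text \<open>Existence of projections is a property of the subspace, since the locale assumes no
  completeness. \<open>proj\<close> repeats the description in \<open>l2proj\<close> and
  \<open>vproj\<close>, so \<open>s2_proj\<close> and \<open>v2_proj\<close> merely compare
  definitions.\<close>

definition projectable :: "'a set \<Rightarrow> bool" where
  "projectable K \<longleftrightarrow> subspace K \<and> K \<subseteq> H \<and> (\<forall>f\<in>H. \<exists>g\<in>K. \<forall>h\<in>K. ip (f - g) h = 0)"

definition proj :: "'a set \<Rightarrow> 'a \<Rightarrow> 'a" where
  "proj K f = (THE g. g \<in> K \<and> (\<forall>h\<in>K. ip (f - g) h = 0))"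

lemma proj_props:
  assumes K: "projectable K" and f: "f \<in> H"
  shows proj_mem: "proj K f \<in> K"
    and proj_orth: "h \<in> K \<Longrightarrow> ip (f - proj K f) h = 0"
proof -
  have KH: "K \<subseteq> H" "subspace K" using K by (auto simp: projectable_def)
  have "\<exists>!g. g \<in> K \<and> (\<forall>h\<in>K. ip (f - g) h = 0)"
  proof -
    obtain g where g: "g \<in> K" "\<forall>h\<in>K. ip (f - g) h = 0"
      using K f by (auto simp: projectable_def)
    have "g' = g" if g': "g' \<in> K" "\<forall>h\<in>K. ip (f - g') h = 0" for g'
    proof -
      have d: "g - g' \<in> K" using g g' KH subspace_diff by blast
      have "ip (f - g') (g - g') - ip (f - g) (g - g') = 0" using g g' d by simp
      moreover have "ip (f - g') (g - g') - ip (f - g) (g - g') = ip ((f - g') - (f - g)) (g - g')"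
        by (rule ip_diff[symmetric]) (use f g g' KH d H_closed in auto)
      ultimately have "ip (g - g') (g - g') = 0" by simp
      then show ?thesis using d KH ip_definite[of "g - g'"] by auto
    qed
    with g show ?thesis by blast
  qed
  from theI'[OF this] show "proj K f \<in> K" "h \<in> K \<Longrightarrow> ip (f - proj K f) h = 0"
    unfolding proj_def by blast+
qed

lemma ip_proj:
  assumes K: "projectable K" and f: "f \<in> H" and h: "h \<in> K"
  shows "ip (proj K f) h = ip f h"
proof -
  have "proj K f \<in> H" "h \<in> H" using K h proj_mem[OF K f] by (auto simp: projectable_def)
  then show ?thesis using proj_orth[OF K f h] f by (simp add: ip_diff)
qed

lemma nrm_proj_le:
  assumes K: "projectable K" and f: "f \<in> H"
  shows "nrm (proj K f) \<le> nrm f"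
proof -
  define g where "g = proj K f"
  have g: "g \<in> H" "ip (f - g) g = 0"
    using K proj_mem[OF K f] proj_orth[OF K f] by (auto simp: projectable_def g_def)
  have "(nrm ((f - g) + g))\<^sup>2 = (nrm (f - g))\<^sup>2 + (nrm g)\<^sup>2"
    using f g by (intro pythagoras) (auto simp: H_closed)
  then have "(nrm g)\<^sup>2 \<le> (nrm f)\<^sup>2" by simp
  then show ?thesis using f g by (simp add: power2_le_iff_abs_le g_def)
qed

text \<open>Finite dimensionality is expressed by finitely many functionals that vanish jointly only
  at 0. Removing one functional passes to its kernel \<open>K'\<close> in \<open>K\<close>, which
  the remaining ones separate; \<open>K\<close> is \<open>K'\<close> plus at most one further
  direction.\<close>

lemma projectable_if_separated:
  assumes "finite \<Phi>" "subspace K" "K \<subseteq> H"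
    and "\<And>\<phi> f g. \<phi> \<in> \<Phi> \<Longrightarrow> \<phi> (f + g) = \<phi> f + (\<phi> g :: complex)"
    and "\<And>\<phi> c f. \<phi> \<in> \<Phi> \<Longrightarrow> \<phi> (sc c f) = c * \<phi> f"
    and "\<And>f. \<lbrakk>f \<in> K; \<And>\<phi>. \<phi> \<in> \<Phi> \<Longrightarrow> \<phi> f = 0\<rbrakk> \<Longrightarrow> f = 0"
  shows "projectable K"
  using assms
proof (induction \<Phi> arbitrary: K rule: finite_induct)
  case empty
  then have "K = {0}" using subspace_0 by auto
  then show ?case using empty by (auto simp: projectable_def ip_zero H_closed)
next
  case (insert \<phi> \<Phi> K)
  note K = \<open>subspace K\<close> \<open>K \<subseteq> H\<close>
  have add: "\<phi> (f + g) = \<phi> f + \<phi> g" and scl: "\<phi> (sc c f) = c * \<phi> f" for f g c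
    using insert.prems by auto
  have zero: "\<phi> 0 = 0" using add[of 0 0] by simp
  have dif: "\<phi> (f - g) = \<phi> f - \<phi> g" for f g using add[of "f - g" g] by simp
  define K' where "K' = {f\<in>K. \<phi> f = 0}"
  have "subspace K'" using K unfolding subspace_def K'_def by (auto simp: add scl zero)
  then have K': "projectable K'"
    using insert.prems(1-4) by (intro insert.IH) (auto simp: K'_def intro!: insert.prems(5))
  show ?case
  proof (cases "K' = K")
    case True then show ?thesis using K' by simp
  next
    case False
    then obtain v where v: "v \<in> K" "\<phi> v \<noteq> 0" by (auto simp: K'_def)
    then have vH: "v \<in> H" using K by auto
    \<comment> \<open>The part of \<open>v\<close> orthogonal to \<open>K'\<close>. Since \<phi>
      vanishes on \<open>K'\<close>, it takes the same nonzero value at \<open>u\<close> as at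
      \<open>v\<close>, so \<open>K\<close> is the orthogonal sum of \<open>K'\<close> and the line
      through \<open>u\<close>, and the two projections add up.\<close>
    define u where "u = v - proj K' v"
    have pv: "proj K' v \<in> K'" by (rule proj_mem[OF K' vH])
    then have u: "u \<in> K" unfolding u_def using v K subspace_diff by (auto simp: K'_def)
    have phu: "\<phi> u \<noteq> 0" using pv v by (simp add: u_def dif K'_def)
    have uH: "u \<in> H" using u K by auto
    have uK': "ip u h = 0" if "h \<in> K'" for h
      unfolding u_def by (rule proj_orth[OF K' vH that])
    have uu: "ip u u \<noteq> 0" using phu zero ip_definite[OF uH] by auto
    have "\<exists>g\<in>K. \<forall>h\<in>K. ip (f - g) h = 0" if f: "f \<in> H" for f
    proof -
      define g where "g = proj K' f + sc (ip f u / ip u u) u"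
      have pf: "proj K' f \<in> K'" by (rule proj_mem[OF K' f])
      have pfH: "proj K' f \<in> H" "proj K' f \<in> K" using pf K by (auto simp: K'_def)
      have gK: "g \<in> K" using pfH u K unfolding g_def by (auto intro: subspace_add subspace_scale)
      have up: "ip (proj K' f) u = 0" using uK'[OF pf] ip_cnj[OF uH pfH(1)] by simp
      have gH: "g \<in> H" using gK K by auto
      have fgu: "ip (f - g) u = 0"
        using f uH pfH gH uu up by (simp add: ip_diff) (simp add: g_def ip_add ip_sc H_closed)
      have "ip (f - g) h = 0" if h: "h \<in> K" for h
      proof -
        define c where "c = \<phi> h / \<phi> u"
        define h' where "h' = h - sc c u"
        have h': "h' \<in> K'" using h u K phu
          by (auto simp: h'_def K'_def dif scl c_def intro: subspace_diff subspace_scale)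
        have h'H: "h' \<in> H" using h' K by (auto simp: K'_def)
        have "ip (f - g) h' = ip (f - proj K' f) h' - ip (sc (ip f u / ip u u) u) h'"
          using f pfH uH h'H by (subst ip_diff[symmetric]) (auto simp: g_def H_closed algebra_simps)
        then have "ip (f - g) h' = 0" using proj_orth[OF K' f h'] uK'[OF h'] uH h'H by (simp add: ip_sc)
        moreover have "h = h' + sc c u" by (simp add: h'_def)
        ultimately show ?thesis
          using fgu f gH h'H uH by (simp add: ip_add_right ip_sc_right H_closed)
      qed
      then show ?thesis using gK by blast
    qed
    then show ?thesis using K by (auto simp: projectable_def)
  qed
qed

end

text \<open>For \<open>R\<^sub>i = T\<^sub>i\<^sup>*\<close> this is the adjoint of \<open>p(T\<^sub>1, T\<^sub>2)\<close>.\<close>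

definition padj :: "(nat \<times> nat \<Rightarrow> complex) \<Rightarrow> ('n::finite cvec \<Rightarrow> 'n cvec) \<Rightarrow> ('n cvec \<Rightarrow> 'n cvec) \<Rightarrow> 'n cvec \<Rightarrow> 'n cvec" where
  "padj p R1 R2 h = (\<Sum>ij\<in>{ij. p ij \<noteq> 0}. cnj (p ij) *s ((R2 ^^ snd ij) ((R1 ^^ fst ij) h)))"

lemma funpow_mem: "(\<And>x. x \<in> M \<Longrightarrow> R x \<in> M) \<Longrightarrow> x \<in> M \<Longrightarrow> (R ^^ n) x \<in> M"
  by (induction n) auto

lemma csubspace_iff_subspace: "csubspace M \<longleftrightarrow> vec.subspace M"
  by (simp add: csubspace_def vec.subspace_def)

context cips
begin

lemma nrm_funpow_le:
  assumes "K \<subseteq> H" "\<And>f. f \<in> K \<Longrightarrow> A f \<in> K" "\<And>f. f \<in> K \<Longrightarrow> nrm (A f) \<le> nrm f" "f \<in> K"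
  shows "nrm ((A ^^ n) f) \<le> nrm f"
proof (induction n)
  case (Suc n)
  have "(A ^^ n) f \<in> K" using assms(2,4) by (rule funpow_mem)
  then show ?case using Suc assms(3) by fastforce
qed simp

text \<open>For contractions \<open>A\<close> and \<open>B\<close> the sum of the moduli of the
  coefficients bounds the polynomial on the unit ball. This bounds the set under Sup, which turns
  the operator norm of the model into an actual upper bound.\<close>

lemma peval2_Sup:
  fixes p :: "nat \<times> nat \<Rightarrow> complex"
  assumes K: "subspace K" "K \<subseteq> H"
    and A: "\<And>f. f \<in> K \<Longrightarrow> A f \<in> K" "\<And>f. f \<in> K \<Longrightarrow> nrm (A f) \<le> nrm f"
    and B: "\<And>f. f \<in> K \<Longrightarrow> B f \<in> K" "\<And>f. f \<in> K \<Longrightarrow> nrm (B f) \<le> nrm f"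
  defines "c \<equiv> Sup {nrm (peval2 p sc A B f) | f. f \<in> K \<and> nrm f \<le> 1}"
  shows peval2_mem: "f \<in> K \<Longrightarrow> peval2 p sc A B f \<in> K"
    and peval2_le_Sup: "\<lbrakk>f \<in> K; nrm f \<le> 1\<rbrakk> \<Longrightarrow> nrm (peval2 p sc A B f) \<le> c"
    and peval2_Sup_nonneg: "0 \<le> c"
proof -
  have AB: "(A ^^ i) ((B ^^ j) f) \<in> K" if "f \<in> K" for f i j
    using that A(1) B(1) by (simp add: funpow_mem)
  then have ABH: "(A ^^ i) ((B ^^ j) f) \<in> H" if "f \<in> K" for f i j
    using that K by blast
  show mem: "peval2 p sc A B f \<in> K" if "f \<in> K" for f
    unfolding peval2_def using that by (intro subspace_sum subspace_scale K AB)
  have le: "nrm (peval2 p sc A B f) \<le> (\<Sum>ij\<in>{ij. p ij \<noteq> 0}. cmod (p ij))"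
    if f: "f \<in> K" "nrm f \<le> 1" for f
  proof -
    have "nrm ((A ^^ i) ((B ^^ j) f)) \<le> 1" for i j
    proof -
      have Bf: "(B ^^ j) f \<in> K" using B(1) f by (simp add: funpow_mem)
      have "nrm ((A ^^ i) ((B ^^ j) f)) \<le> nrm ((B ^^ j) f)" by (rule nrm_funpow_le[OF K(2) A Bf])
      also have "\<dots> \<le> nrm f" by (rule nrm_funpow_le[OF K(2) B f(1)])
      finally show ?thesis using f by simp
    qed
    then have "nrm (sc (p ij) ((A ^^ fst ij) ((B ^^ snd ij) f))) \<le> cmod (p ij)" for ij
      using ABH[OF f(1)] by (simp add: nrm_sc mult_left_le)
    then show ?thesis unfolding peval2_def
      by (intro order_trans[OF nrm_sum_le sum_mono]) (auto simp: H_closed ABH f)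
  qed
  have bdd: "bdd_above {nrm (peval2 p sc A B f) | f. f \<in> K \<and> nrm f \<le> 1}"
    unfolding bdd_above_def using le by blast
  show le': "nrm (peval2 p sc A B f) \<le> c" if "f \<in> K" "nrm f \<le> 1" for f
    unfolding c_def by (rule cSup_upper[OF _ bdd]) (use that in auto)
  have 0: "0 \<in> K" using K by (simp add: subspace_0)
  then have "nrm (peval2 p sc A B 0) \<le> c" by (intro le') auto
  moreover have "0 \<le> nrm (peval2 p sc A B 0)" using mem[OF 0] K by auto
  ultimately show "0 \<le> c" by simp
qed

text \<open>The map \<open>V\<close> intertwines \<open>R1, R2\<close> with the adjoints of \<open>A, B\<close>; these adjoints are never formed,
  only their pairings with the range of \<open>V\<close> enter.\<close>

lemma compression_bound:
  fixes V :: "'n::finite cvec \<Rightarrow> 'a"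
  assumes K: "subspace K" "K \<subseteq> H" and M: "csubspace M"
    and A: "\<And>f. f \<in> K \<Longrightarrow> A f \<in> K" "\<And>f. f \<in> K \<Longrightarrow> nrm (A f) \<le> nrm f"
    and B: "\<And>f. f \<in> K \<Longrightarrow> B f \<in> K" "\<And>f. f \<in> K \<Longrightarrow> nrm (B f) \<le> nrm f"
    and V: "\<And>h. h \<in> M \<Longrightarrow> V h \<in> K" "\<And>g h. \<lbrakk>g \<in> M; h \<in> M\<rbrakk> \<Longrightarrow> V (g + h) = V g + V h"
      "\<And>a h. h \<in> M \<Longrightarrow> V (a *s h) = sc a (V h)"
    and R: "\<And>h. h \<in> M \<Longrightarrow> R1 h \<in> M" "\<And>h. h \<in> M \<Longrightarrow> R2 h \<in> M"
    and adjA: "\<And>f h. \<lbrakk>f \<in> K; h \<in> M\<rbrakk> \<Longrightarrow> ip (A f) (V h) = ip f (V (R1 h))"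
    and adjB: "\<And>f h. \<lbrakk>f \<in> K; h \<in> M\<rbrakk> \<Longrightarrow> ip (B f) (V h) = ip f (V (R2 h))"
    and h: "h \<in> M"
  shows "nrm (V (padj p R1 R2 h)) \<le> Sup {nrm (peval2 p sc A B f) | f. f \<in> K \<and> nrm f \<le> 1} * nrm (V h)"
    (is "_ \<le> ?c * _")
proof -
  have M': "vec.subspace M" using M by (simp add: csubspace_iff_subspace)
  have VH: "V h \<in> H" if "h \<in> M" for h using V(1) K that by auto
  have R1: "(R1 ^^ i) h \<in> M" if "h \<in> M" for h i using R that by (simp add: funpow_mem)
  have R2: "(R2 ^^ i) h \<in> M" if "h \<in> M" for h i using R that by (simp add: funpow_mem)
  have Ai: "ip ((A ^^ i) f) (V h) = ip f (V ((R1 ^^ i) h))" if "f \<in> K" "h \<in> M" for f h i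
    using that
  proof (induction i arbitrary: h)
    case (Suc i)
    have "(A ^^ i) f \<in> K" using A(1) Suc.prems by (simp add: funpow_mem)
    then show ?case using Suc by (simp add: adjA R) (simp add: funpow_swap1)
  qed simp
  have Bi: "ip ((B ^^ i) f) (V h) = ip f (V ((R2 ^^ i) h))" if "f \<in> K" "h \<in> M" for f h i
    using that
  proof (induction i arbitrary: h)
    case (Suc i)
    have "(B ^^ i) f \<in> K" using B(1) Suc.prems by (simp add: funpow_mem)
    then show ?case using Suc by (simp add: adjB R) (simp add: funpow_swap1)
  qed simp
  have V0: "V 0 = 0" using V(3)[of 0 0] vec.subspace_0[OF M'] by simp
  have Vsum: "V (sum g I) = (\<Sum>i\<in>I. V (g i))" if "\<And>i. i \<in> I \<Longrightarrow> g i \<in> M" for g and I :: "'i set"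
    using that
  proof (induction I rule: infinite_finite_induct)
    case (insert i I)
    then have "sum g I \<in> M" by (auto intro: vec.subspace_sum[OF M'])
    with insert show ?case by (simp add: V(2))
  qed (auto simp: V0)
  have pM: "padj p R1 R2 h \<in> M"
    unfolding padj_def by (intro vec.subspace_sum vec.subspace_scale M' R1 R2 h)
  \<comment> \<open>Moving the factors across the inner product one at a time reverses their order
    and conjugates the coefficients, which is the form of \<open>padj\<close>.\<close>
  have adj: "ip (peval2 p sc A B f) (V h) = ip f (V (padj p R1 R2 h))" if f: "f \<in> K" for f
  proof -
    have fH: "f \<in> H" using f K by auto
    have Bf: "(B ^^ j) f \<in> K" for j using B(1) f by (simp add: funpow_mem)
    then have ABf: "(A ^^ i) ((B ^^ j) f) \<in> K" for i j using A(1) by (simp add: funpow_mem)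
    then have ABH: "(A ^^ i) ((B ^^ j) f) \<in> H" for i j using K by auto
    have Rh: "(R2 ^^ j) ((R1 ^^ i) h) \<in> M" for i j using R1 R2 h by auto
    have "ip (peval2 p sc A B f) (V h) = (\<Sum>ij\<in>{ij. p ij \<noteq> 0}. p ij * ip ((A ^^ fst ij) ((B ^^ snd ij) f)) (V h))"
      unfolding peval2_def using ABH VH[OF h] by (simp add: ip_sum H_closed ip_sc)
    also have "\<dots> = (\<Sum>ij\<in>{ij. p ij \<noteq> 0}. p ij * ip f (V ((R2 ^^ snd ij) ((R1 ^^ fst ij) h))))"
      using Bf f R1 h by (simp add: Ai Bi)
    also have "\<dots> = (\<Sum>ij\<in>{ij. p ij \<noteq> 0}. ip f (V (cnj (p ij) *s ((R2 ^^ snd ij) ((R1 ^^ fst ij) h)))))"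
      using Rh fH VH by (simp add: V(3) ip_sc_right)
    also have "\<dots> = ip f (V (padj p R1 R2 h))"
    proof -
      have m: "cnj (p ij) *s ((R2 ^^ snd ij) ((R1 ^^ fst ij) h)) \<in> M" for ij
        by (intro vec.subspace_scale M' Rh)
      show ?thesis unfolding padj_def using m by (simp add: Vsum ip_sum_right fH VH)
    qed
    finally show ?thesis .
  qed
  define u where "u = V (padj p R1 R2 h)"
  have u: "u \<in> K" "u \<in> H" using V(1) pM K by (auto simp: u_def)
  show ?thesis
  proof (cases "nrm u = 0")
    case True
    then show ?thesis using peval2_Sup_nonneg[OF K A B, of p] VH[OF h] by (simp add: u_def)
  next
    case False
    \<comment> \<open>The unit vector in the direction of \<open>u\<close> recovers the norm: <v, u>
      = \<open>nrm u\<close>, and by \<open>adj\<close> this equals the pairing of p(A, B) v with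
      \<open>V h\<close>, to which Cauchy-Schwarz applies.\<close>
    define v where "v = sc (complex_of_real (1 / nrm u)) u"
    have v: "v \<in> K" "v \<in> H" "nrm v = 1"
      using u K False by (auto simp: v_def nrm_sc subspace_scale H_closed norm_divide)
    have "ip v u = nrm u"
      using u False by (simp add: v_def ip_sc ip_self power2_eq_square)
    then have "ip (peval2 p sc A B v) (V h) = nrm u" using adj[OF v(1)] by (simp add: u_def)
    then have "nrm u = cmod (ip (peval2 p sc A B v) (V h))" using u by simp
    also have "\<dots> \<le> nrm (peval2 p sc A B v) * nrm (V h)"
      using peval2_mem[OF K A B v(1)] K VH[OF h] by (intro cauchy_schwarz) auto
    also have "\<dots> \<le> ?c * nrm (V h)"
      using peval2_le_Sup[OF K A B v(1)] v(3) VH[OF h] by (intro mult_right_mono) auto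
    finally show ?thesis by (simp add: u_def)
  qed
qed

end

section \<open>The space C^n, adjoint matrices and operator norms\<close>

lemma cinner_self: "cinner x x = complex_of_real ((norm x)\<^sup>2)"
proof -
  have "cinner x x = (\<Sum>i\<in>UNIV. complex_of_real ((norm (x $ i))\<^sup>2))"
    by (simp only: cinner_def complex_norm_square)
  also have "\<dots> = complex_of_real ((norm x)\<^sup>2)"
    by (simp add: norm_vec_def L2_set_def sum_nonneg)
  finally show ?thesis .
qed

interpretation cv: cips "(*s)" UNIV "cinner :: 'n::finite cvec \<Rightarrow> 'n cvec \<Rightarrow> complex"
proof unfold_locales
  show "cinner (x + y) z = cinner x z + cinner y z" for x y z :: "'n cvec"
    by (simp add: cinner_def sum.distrib algebra_simps)
  show "cinner (c *s x) y = c * cinner x y" for c and x y :: "'n cvec"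
    by (simp add: cinner_def sum_distrib_left algebra_simps)
  show "cnj (cinner x y) = cinner y x" for x y :: "'n cvec"
    by (simp add: cinner_def mult.commute)
qed (auto simp: cinner_self)

lemma cv_nrm [simp]: "cv.nrm x = norm x"
  by (simp add: cv.nrm_def cinner_self)

lemmas cinner_simps = cv.ip_add[simplified] cv.ip_sc[simplified] cv.ip_diff[simplified]
  cv.ip_add_right[simplified] cv.ip_sc_right[simplified] cv.ip_diff_right[simplified]
  cv.ip_zero[simplified]

lemmas cinner_cnj = cv.ip_cnj[simplified]

lemma norm_scale_cvec: "norm (c *s x) = cmod c * norm (x :: 'n::finite cvec)"
  using cv.nrm_sc[of x c] by simp

lemma cinner_cadj: "cinner (T *v x) y = cinner x (cadj T *v y)"
proof -
  have "cinner (T *v x) y = (\<Sum>i\<in>UNIV. \<Sum>j\<in>UNIV. T $ i $ j * x $ j * cnj (y $ i))"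
    by (simp add: cinner_def matrix_vector_mult_def sum_distrib_right)
  also have "\<dots> = (\<Sum>j\<in>UNIV. \<Sum>i\<in>UNIV. T $ i $ j * x $ j * cnj (y $ i))"
    by (rule sum.swap)
  also have "\<dots> = cinner x (cadj T *v y)"
    by (simp add: cinner_def matrix_vector_mult_def sum_distrib_left cadj_def algebra_simps)
  finally show ?thesis .
qed

lemma cadj_cadj [simp]: "cadj (cadj T) = T"
  by (simp add: cadj_def vec_eq_iff)

lemma cinner_cadj_left: "cinner (cadj T *v x) y = cinner x (T *v y)"
  using cinner_cadj[of "cadj T"] by simp

lemma cadj_mult: "cadj (A ** B) = cadj B ** cadj A"
  by (simp add: cadj_def matrix_matrix_mult_def vec_eq_iff mult.commute)

lemma matrix_vector_mult_scale: "T *v (c *s x) = c *s (T *v (x :: 'n::finite cvec))"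
  by (simp add: vec.scale)

lemma cinner_eq_0_all: "(\<And>y. cinner x y = 0) \<Longrightarrow> x = 0"
  using cv.ip_definite by blast

lemma cinner_eqI: "(\<And>y. cinner x y = cinner z y) \<Longrightarrow> x = z"
  using cinner_eq_0_all[of "x - z"] by (simp add: cinner_simps)

lemma funpow_cadj: "cinner ((((*v) T) ^^ n) x) y = cinner x ((((*v) (cadj T)) ^^ n) y)"
  proof (induction n arbitrary: y)
  case (Suc n)
  show ?case by (simp add: cinner_cadj Suc) (simp add: funpow_swap1)
qed simp

lemma cinner_pmat:
  "cinner (pmat p T1 T2 x) h = cinner x (padj p ((*v) (cadj T1)) ((*v) (cadj T2)) h)"
  by (simp add: pmat_def peval2_def padj_def cv.ip_sum cv.ip_sum_right cinner_simps funpow_cadj)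

lemma pmat_mem:
  assumes "csubspace M" "\<And>x. x \<in> M \<Longrightarrow> T1 *v x \<in> M" "\<And>x. x \<in> M \<Longrightarrow> T2 *v x \<in> M" "x \<in> M"
  shows "pmat p T1 T2 x \<in> M"
  unfolding pmat_def peval2_def using assms
  by (intro vec.subspace_sum vec.subspace_scale funpow_mem) (auto simp: csubspace_iff_subspace)

lemma matpow_add: "(((*v) (T :: 'n::finite cmat)) ^^ n) (x + y) = (((*v) T) ^^ n) x + (((*v) T) ^^ n) y"
  by (induction n) (simp_all add: matrix_vector_right_distrib)

lemma matpow_scale: "(((*v) (T :: 'n::finite cmat)) ^^ n) (c *s x) = c *s (((*v) T) ^^ n) x"
  by (induction n) (simp_all add: matrix_vector_mult_scale)

lemma matpow_zero: "(((*v) (T :: 'n::finite cmat)) ^^ n) 0 = 0"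
  by (induction n) simp_all

lemmas matpow_linear = matpow_add matpow_scale matpow_zero

lemma pmat_linear:
  "pmat p T1 T2 (x + y) = pmat p T1 T2 x + pmat p T1 T2 y"
  "pmat p T1 T2 (c *s x) = c *s pmat p T1 T2 x"
  by (simp_all add: pmat_def peval2_def matpow_linear sum.distrib vec.scale_right_distrib
      vec.scale_sum_right mult.commute)

lemma pmat_0: "pmat p T1 T2 0 = 0"
  using pmat_linear(2)[of p T1 T2 0 0] by simp

lemma pmat_sum: "pmat p T1 T2 (sum f I) = (\<Sum>i\<in>I. pmat p T1 T2 (f i))"
  by (induction I rule: infinite_finite_induct) (simp_all add: pmat_linear pmat_0)

lemma scaleR_cvec_eq: "(r *\<^sub>R x) = complex_of_real r *s (x :: 'n::finite cvec)"
  by (simp add: vec_eq_iff) (simp add: scaleR_conv_of_real)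

lemma bounded_linear_pmat: "bounded_linear (pmat p T1 T2)"
  by (rule linear_conv_bounded_linear[THEN iffD1], rule linearI)
    (simp_all add: pmat_linear scaleR_cvec_eq)

lemma opnorm_on_le:
  assumes "csubspace M" "\<And>x. x \<in> M \<Longrightarrow> norm (A x) \<le> c * norm x" "0 \<le> c"
  shows "opnorm_on M A \<le> c"
  unfolding opnorm_on_def
proof (rule cSup_least)
  show "{norm (A x) |x. x \<in> M \<and> norm x \<le> 1} \<noteq> {}"
    using assms(1) by (auto simp: csubspace_def intro!: exI[of _ 0])
  fix y assume "y \<in> {norm (A x) |x. x \<in> M \<and> norm x \<le> 1}"
  then obtain x where x: "y = norm (A x)" "x \<in> M" "norm x \<le> 1" by auto
  then have "y \<le> c * norm x" using assms(2) by simp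
  also have "\<dots> \<le> c" using x assms(3) by (simp add: mult_left_le)
  finally show "y \<le> c" .
qed

text \<open>Boundedness of \<open>A\<close> keeps the set under Sup bounded above; the inequality
  for general \<open>x\<close> comes from rescaling to a unit vector of \<open>M\<close>.\<close>

lemma le_opnorm_on:
  assumes M: "csubspace M" and A: "bounded_linear A" and x: "x \<in> M"
  shows "norm (A x) \<le> opnorm_on M A * norm x" and "0 \<le> opnorm_on M A"
proof -
  obtain b where b: "\<And>x. norm (A x) \<le> norm x * b" "0 \<le> b"
    using bounded_linear.nonneg_bounded[OF A] by auto
  have bdd: "bdd_above {norm (A x) |x. x \<in> M \<and> norm x \<le> 1}"
  proof (rule bdd_aboveI)
    fix y assume "y \<in> {norm (A x) |x. x \<in> M \<and> norm x \<le> 1}"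
    then obtain x where x: "y = norm (A x)" "x \<in> M" "norm x \<le> 1" by auto
    then have "y \<le> norm x * b" using b by simp
    also have "\<dots> \<le> b" using x b by (simp add: mult_left_le_one_le)
    finally show "y \<le> b" .
  qed
  have A0: "A 0 = 0" using A by (simp add: linear_simps(3))
  have up: "norm (A y) \<le> opnorm_on M A" if "y \<in> M" "norm y \<le> 1" for y
    unfolding opnorm_on_def by (rule cSup_upper[OF _ bdd]) (use that in auto)
  have 0: "0 \<in> M" using M by (simp add: csubspace_def)
  show "0 \<le> opnorm_on M A" using up[OF 0] by (simp add: A0)
  show "norm (A x) \<le> opnorm_on M A * norm x"
  proof (cases "x = 0")
    case False
    have "complex_of_real (1 / norm x) *s x \<in> M" using M x by (simp add: csubspace_def)
    then have "(1 / norm x) *\<^sub>R x \<in> M" by (simp add: scaleR_cvec_eq)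
    then have "norm (A ((1 / norm x) *\<^sub>R x)) \<le> opnorm_on M A" using False by (intro up) auto
    then show ?thesis using False A by (simp add: linear_simps(5) field_simps)
  qed (simp add: A0)
qed

lemma bounded_linear_matrix: "bounded_linear ((*v) (T :: 'n::finite cmat))"
  by (rule linear_conv_bounded_linear[THEN iffD1], rule linearI)
    (simp_all add: matrix_vector_right_distrib scaleR_cvec_eq matrix_vector_mult_scale)

lemma csubspace_UNIV: "csubspace UNIV"
  by (simp add: csubspace_def)

lemma contraction_norm_le: "contraction T \<Longrightarrow> norm (T *v x) \<le> norm x"
  using le_opnorm_on(1)[OF csubspace_UNIV bounded_linear_matrix[of T], of x]
    mult_right_mono[of "opnorm_on UNIV ((*v) T)" 1 "norm x"]
  by (simp add: contraction_def)

text \<open>The dualisation step. For y = p(T1, T2) x, which stays in \<open>M\<close>, the square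
  of the norm of y is the pairing of x with \<open>padj\<close> applied to y; one factor of the norm
  of y then cancels.\<close>

lemma norm_le_if_adjoint:
  assumes M: "reduces M T1" "reduces M T2" and c: "0 \<le> c"
    and le: "\<And>h. h \<in> M \<Longrightarrow> norm (padj p ((*v) (cadj T1)) ((*v) (cadj T2)) h) \<le> c * norm h"
    and x: "x \<in> M"
  shows "norm (pmat p T1 T2 x) \<le> c * norm x"
proof -
  define y where "y = pmat p T1 T2 x"
  have y: "y \<in> M" unfolding y_def using M x by (intro pmat_mem) (auto simp: reduces_def)
  have "(norm y)\<^sup>2 = cmod (cinner y y)" by (simp add: cinner_self norm_power)
  also have "\<dots> = cmod (cinner x (padj p ((*v) (cadj T1)) ((*v) (cadj T2)) y))"
    by (subst (1) y_def) (simp add: cinner_pmat)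
  also have "\<dots> \<le> norm x * norm (padj p ((*v) (cadj T1)) ((*v) (cadj T2)) y)"
    using cv.cauchy_schwarz[of x] by simp
  also have "\<dots> \<le> norm x * (c * norm y)" by (intro mult_left_mono le y) auto
  finally have "norm y * norm y \<le> (c * norm x) * norm y" by (simp add: power2_eq_square algebra_simps)
  then have "norm y \<le> c * norm x"
    by (cases "norm y = 0") (use c in \<open>auto simp: mult_le_cancel_right\<close>)
  then show ?thesis by (simp add: y_def)
qed

lemma contraction_cadj_norm_le:
  assumes "contraction T" shows "norm (cadj T *v x) \<le> norm x"
proof -
  define y where "y = cadj T *v x"
  have "(norm y)\<^sup>2 = cmod (cinner (T *v y) x)"
    by (simp add: cinner_cadj y_def[symmetric] cinner_self norm_power)
  also have "\<dots> \<le> norm (T *v y) * norm x" using cv.cauchy_schwarz[of "T *v y" x] by simp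
  also have "\<dots> \<le> norm y * norm x" by (intro mult_right_mono contraction_norm_le assms) auto
  finally have "norm y \<le> norm x"
    by (cases "norm y = 0") (auto simp: power2_eq_square)
  then show ?thesis by (simp add: y_def)
qed

subsection \<open>Polynomials in an operator and eigenvectors\<close>

lemma csubspaceD:
  assumes "csubspace M"
  shows "0 \<in> M" "\<And>x y. \<lbrakk>x \<in> M; y \<in> M\<rbrakk> \<Longrightarrow> x + y \<in> M" "\<And>c x. x \<in> M \<Longrightarrow> c *s x \<in> M"
    "\<And>x y. \<lbrakk>x \<in> M; y \<in> M\<rbrakk> \<Longrightarrow> x - y \<in> M" "\<And>f I. (\<And>i. i \<in> I \<Longrightarrow> f i \<in> M) \<Longrightarrow> sum f I \<in> M"
  using assms unfolding csubspace_iff_subspace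
  by (auto intro: vec.subspace_0 vec.subspace_add vec.subspace_scale vec.subspace_diff vec.subspace_sum)

lemma reducesD:
  assumes "reduces M T"
  shows "csubspace M" "\<And>x. x \<in> M \<Longrightarrow> T *v x \<in> M" "\<And>x. x \<in> M \<Longrightarrow> cadj T *v x \<in> M"
  using assms by (auto simp: reduces_def)

lemma polyop_eq_sum:
  fixes T :: "'n::finite cmat"
  assumes "degree q \<le> n"
  shows "polyop q T x = (\<Sum>i\<le>n. coeff q i *s ((((*v) T) ^^ i) x))"
  unfolding polyop_def using assms
  by (intro sum.mono_neutral_left) (auto simp: coeff_eq_0)

lemma polyop_add: "polyop (p + q) T x = polyop p T x + polyop q T x"
proof -
  define n where "n = max (degree p) (degree q)"
  have "degree p \<le> n" "degree q \<le> n" "degree (p + q) \<le> n"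
    by (auto simp: n_def degree_add_le_max)
  then show ?thesis by (simp add: polyop_eq_sum sum.distrib vec.scale_left_distrib)
qed

lemma polyop_smult: "polyop (smult a q) T x = a *s polyop q T x"
  by (subst (1 2) polyop_eq_sum[where n = "degree q"]) (auto simp: vec.scale_sum_right)

lemma polyop_diff: "polyop (p - q) T x = polyop p T x - polyop q T x"
  using polyop_add[of "p - q" q T x] by simp

lemma polyop_0 [simp]: "polyop 0 T x = 0"
  by (simp add: polyop_def)

lemma polyop_pCons:
  fixes T :: "'n::finite cmat"
  shows "polyop (pCons a q) T x = a *s x + T *v polyop q T x"
proof -
  have "polyop (pCons a q) T x = (\<Sum>i\<le>Suc (degree q). coeff (pCons a q) i *s ((((*v) T) ^^ i) x))"
    by (rule polyop_eq_sum) (simp add: degree_pCons_le)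
  also have "\<dots> = a *s x + (\<Sum>i\<le>degree q. coeff q i *s ((((*v) T) ^^ Suc i) x))"
    by (subst sum.atMost_Suc_shift) simp
  also have "(\<Sum>i\<le>degree q. coeff q i *s ((((*v) T) ^^ Suc i) x)) = T *v polyop q T x"
    by (simp add: polyop_def vec.sum matrix_vector_mult_scale)
  finally show ?thesis .
qed

lemma polyop_mult: "polyop (p * q) T x = polyop p T (polyop q T x)"
  by (induction p) (simp_all add: polyop_pCons polyop_add polyop_smult)

lemma polyop_linear:
  "polyop q T (x + y) = polyop q T x + polyop q T y"
  "polyop q T (c *s x) = c *s polyop q T x"
  "polyop q T (x - y) = polyop q T x - polyop q T y"
proof -
  show *: "polyop q T (x + y) = polyop q T x + polyop q T y" for x y
    by (simp add: polyop_def matpow_linear sum.distrib vec.scale_right_distrib)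
  show "polyop q T (c *s x) = c *s polyop q T x"
    by (simp add: polyop_def matpow_linear vec.scale_sum_right mult.commute)
  show "polyop q T (x - y) = polyop q T x - polyop q T y"
    using *[of "x - y" y] by (simp add: algebra_simps)
qed

lemma polyop_commute: "polyop q T (T *v x) = T *v polyop q T x"
proof -
  have "polyop (q * [:0, 1:]) T x = polyop ([:0, 1:] * q) T x" by (simp add: mult.commute)
  then show ?thesis unfolding polyop_mult by (simp add: polyop_pCons)
qed

lemma polyop_mem:
  assumes "csubspace M" "\<And>x. x \<in> M \<Longrightarrow> T *v x \<in> M" "x \<in> M"
  shows "polyop q T x \<in> M"
  unfolding polyop_def using assms by (intro csubspaceD funpow_mem) auto

lemma polyop_eigenvector:
  assumes "T *v x = l *s x"
  shows "polyop q T x = poly q l *s x"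
  using assms by (induction q) (simp_all add: polyop_pCons matrix_vector_mult_scale vec.scale_left_distrib mult.commute)

lemma polyop_sum: "polyop (sum q I) T x = (\<Sum>i\<in>I. polyop (q i) T x)"
  by (induction I rule: infinite_finite_induct) (simp_all add: polyop_add)

lemma polyop_monom: "polyop (monom c i) (T :: 'n::finite cmat) x = c *s ((((*v) T) ^^ i) x)"
proof (cases "c = 0")
  case False
  have "polyop (monom c i) T x = (\<Sum>j\<in>{i}. coeff (monom c i) j *s ((((*v) T) ^^ j) x))"
    unfolding polyop_def using False
    by (intro sum.mono_neutral_right) (auto simp: degree_monom_eq)
  then show ?thesis by simp
qed (simp add: polyop_def)

lemma ex_annihilating_poly_vector:
  fixes T :: "'n::finite cmat"
  shows "\<exists>q. q \<noteq> 0 \<and> polyop q T x = 0"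
proof -
  define v where "v i = (((*v) T) ^^ i) x" for i
  define n where "n = CARD('n)"
  show ?thesis
  \<comment> \<open>Linear dependence is a notion for sets of vectors, so a repetition among the
    iterates is treated apart: it gives the polynomial z^i - z^j. Otherwise n + 1 distinct vectors
    in dimension n are dependent.\<close>
  proof (cases "inj_on v {..n}")
    case False
    then obtain i j where ij: "i \<noteq> j" "v i = v j" by (auto simp: inj_on_def)
    define q where "q = monom 1 i - monom (1::complex) j"
    have "coeff q i = 1" using ij by (simp add: q_def)
    then have "q \<noteq> 0" by auto
    moreover have "polyop q T x = v i - v j"
      by (simp add: q_def polyop_diff polyop_monom v_def)
    ultimately show ?thesis using ij by auto
  next
    case True
    have "card (v ` {..n}) = Suc n" using True by (simp add: card_image)
    moreover have "vec.dim (v ` {..n}) \<le> n" using vec.dim_subset_UNIV[of "v ` {..n}"]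
      by (simp add: n_def vec.dimension_def card_cart_basis)
    ultimately have "vec.dependent (v ` {..n})"
      using vec.dim_eq_card_independent[of "v ` {..n}"] by auto
    then obtain u where u: "\<exists>y\<in>v ` {..n}. u y \<noteq> 0" "(\<Sum>y\<in>v ` {..n}. u y *s y) = 0"
      by (subst (asm) vec.dependent_finite) auto
    define q where "q = (\<Sum>i\<le>n. monom (u (v i)) i)"
    obtain i where i: "i \<le> n" "u (v i) \<noteq> 0" using u by auto
    have "coeff q i = u (v i)" using i by (simp add: q_def coeff_sum)
    then have "q \<noteq> 0" using i by auto
    moreover have "polyop q T x = (\<Sum>i\<le>n. u (v i) *s v i)"
      by (simp add: q_def polyop_sum polyop_monom v_def)
    moreover have "\<dots> = (\<Sum>y\<in>v ` {..n}. u y *s y)" using True by (simp add: sum.reindex)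
    ultimately show ?thesis using u by auto
  qed
qed

text \<open>Polynomials in \<open>T\<close> commute, so the product of annihilators of the standard
  basis vectors kills each of them, hence every vector.\<close>

lemma ex_annihilating_poly: "\<exists>q. q \<noteq> 0 \<and> (\<forall>x. polyop q (T :: 'n::finite cmat) x = 0)"
proof -
  have fin: "\<exists>q. q \<noteq> 0 \<and> (\<forall>x\<in>F. polyop q T x = 0)" if "finite F" for F
    using that
  proof (induction F rule: finite_induct)
    case empty
    show ?case by (rule exI[of _ 1]) simp
  next
    case (insert y F)
    then obtain q where q: "q \<noteq> 0" "\<forall>x\<in>F. polyop q T x = 0" by auto
    obtain r where r: "r \<noteq> 0" "polyop r T y = 0" using ex_annihilating_poly_vector by blast
    have z: "polyop s T 0 = 0" for s using polyop_linear(2)[of s T 0 0] by simp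
    have "polyop (r * q) T x = 0" if "x \<in> F" for x using q that by (simp add: polyop_mult z)
    moreover have "polyop (r * q) T y = 0" using r by (simp add: mult.commute[of r] polyop_mult z)
    ultimately show ?case using q r by (intro exI[of _ "r * q"]) auto
  qed
  have "finite (range (\<lambda>i. axis i (1::complex)) :: 'n cvec set)" by simp
  from fin[OF this] obtain q where q: "q \<noteq> 0" "\<And>i. polyop q T (axis i 1) = 0" by auto
  have "polyop q T x = 0" for x
  proof -
    have s: "polyop q T (\<Sum>i\<in>I. x $ i *s axis i 1) = 0" for I
      by (induction I rule: infinite_finite_induct)
        (use polyop_linear(2)[of q T 0 0] in \<open>simp_all add: polyop_linear q\<close>)
    show ?thesis using s[of UNIV] by (simp add: basis_expansion)
  qed
  then show ?thesis using q by blast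
qed

text \<open>Linear factors are stripped from \<open>q\<close> until the cofactor r no longer kills
  \<open>x\<close>; then r applied to \<open>x\<close> is an eigenvector for the root just
  removed.\<close>

lemma ex_eigenvector_of_poly:
  assumes M: "csubspace M" "\<And>x. x \<in> M \<Longrightarrow> T *v x \<in> M"
    and "q \<noteq> 0" "polyop q T x = 0" "x \<in> M" "x \<noteq> 0"
  shows "\<exists>l y. y \<in> M \<and> y \<noteq> 0 \<and> T *v y = l *s y \<and> poly q l = 0"
  using assms(3-)
proof (induction "degree q" arbitrary: q rule: less_induct)
  case less
  show ?case
  proof (cases "degree q = 0")
    case True
    then obtain c where c: "q = [:c:]" by (metis degree_eq_zeroE)
    then show ?thesis using less.prems by (simp add: polyop_pCons)
  next
    case False
    then obtain l where l: "poly q l = 0"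
      using fundamental_theorem_of_algebra[of q] by (auto simp: constant_degree)
    then obtain r where r: "q = [:- l, 1:] * r" by (auto simp: poly_eq_0_iff_dvd dvd_def)
    then have r0: "r \<noteq> 0" using less.prems(1) by auto
    have deg: "degree r < degree q" using r r0 by (simp add: degree_mult_eq del: mult_pCons_left)
    show ?thesis
    proof (cases "polyop r T x = 0")
      case True
      from less.hyps[OF deg r0 True less.prems(3,4)] show ?thesis by (auto simp: r)
    next
      case False
      have "T *v polyop r T x = l *s polyop r T x"
        using less.prems(2) unfolding r polyop_mult by (simp add: polyop_pCons)
      then show ?thesis using polyop_mem[OF M less.prems(3)] False l by blast
    qed
  qed
qed

lemma ex_eigenvector:
  assumes "csubspace M" "\<And>x. x \<in> M \<Longrightarrow> T *v x \<in> M" "M \<noteq> {0}"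
  shows "\<exists>l y. y \<in> M \<and> y \<noteq> 0 \<and> T *v y = l *s y"
proof -
  obtain x where "x \<in> M" "x \<noteq> 0" using assms csubspaceD(1) by fastforce
  moreover obtain q where "q \<noteq> 0" "\<forall>x. polyop q T x = 0" using ex_annihilating_poly by blast
  ultimately show ?thesis using ex_eigenvector_of_poly[OF assms(1,2)] by blast
qed

lemma finite_spec_on: "finite (spec_on M T)"
proof -
  obtain q where q: "q \<noteq> 0" "\<And>x. polyop q T x = 0" using ex_annihilating_poly by blast
  have "spec_on M T \<subseteq> {l. poly q l = 0}"
  proof
    fix l assume "l \<in> spec_on M T"
    then obtain x where "x \<noteq> 0" "T *v x = l *s x" by (auto simp: spec_on_def)
    then show "l \<in> {l. poly q l = 0}" using q(2)[of x] polyop_eigenvector[of T x l q] by simp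
  qed
  then show ?thesis using poly_roots_finite[OF q(1)] finite_subset by blast
qed

section \<open>The minimal polynomial on an invariant subspace\<close>

text \<open>The description is legitimate because two monic annihilators of least degree differ by
  an annihilator of smaller degree, which must be 0.\<close>

lemma minpoly_on_props:
  shows lead_coeff_minpoly: "lead_coeff (minpoly_on M T) = 1"
    and annihilates_minpoly: "annihilates_on M T (minpoly_on M T)"
    and minpoly_minimal: "\<lbrakk>q \<noteq> 0; annihilates_on M T q\<rbrakk> \<Longrightarrow> degree (minpoly_on M T) \<le> degree q"
proof -
  define P where "P m \<longleftrightarrow> lead_coeff m = 1 \<and> annihilates_on M T m \<and>
      (\<forall>q. q \<noteq> 0 \<and> annihilates_on M T q \<longrightarrow> degree m \<le> degree q)" for m
  obtain q0 where q0: "q0 \<noteq> 0" "annihilates_on M T q0"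
    using ex_annihilating_poly[of T] by (auto simp: annihilates_on_def)
  obtain r where r: "r \<noteq> 0" "annihilates_on M T r"
    "\<And>q. q \<noteq> 0 \<and> annihilates_on M T q \<Longrightarrow> degree r \<le> degree q"
    using ex_has_least_nat[of "\<lambda>q. q \<noteq> 0 \<and> annihilates_on M T q" q0 degree] q0 by blast
  have "P (smult (1 / lead_coeff r) r)"
    using r by (auto simp: P_def annihilates_on_def polyop_smult)
  moreover have "m = m'" if "P m" "P m'" for m m'
  proof (rule ccontr)
    assume ne: "m \<noteq> m'"
    have m0: "m \<noteq> 0" "m' \<noteq> 0" using that by (auto simp: P_def)
    then have deg: "degree m = degree m'" using that by (auto simp: P_def intro: antisym)
    define d where "d = m - m'"
    have d: "d \<noteq> 0" using ne by (simp add: d_def)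
    have "annihilates_on M T d" using that by (simp add: P_def d_def annihilates_on_def polyop_diff)
    then have le: "degree m \<le> degree d" using d that by (auto simp: P_def)
    have "degree d \<le> degree m" unfolding d_def by (rule degree_diff_le) (auto simp: deg)
    with le have "degree d = degree m" by simp
    moreover have "coeff d (degree m) = 0" using that deg by (simp add: d_def P_def)
    ultimately show False using d by (metis leading_coeff_0_iff)
  qed
  ultimately have "\<exists>!m. P m" by blast
  from theI'[OF this] have "P (minpoly_on M T)" unfolding P_def minpoly_on_def .
  then show "lead_coeff (minpoly_on M T) = 1" "annihilates_on M T (minpoly_on M T)"
    "\<lbrakk>q \<noteq> 0; annihilates_on M T q\<rbrakk> \<Longrightarrow> degree (minpoly_on M T) \<le> degree q"
    by (auto simp: P_def)
qed

text \<open>By minimality the cofactor of z - l does not annihilate \<open>M\<close>. Any vector of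
  \<open>M\<close> that it does not kill is sent by it to an eigenvector for
  \<open>l\<close>.\<close>

lemma root_minpoly_in_spec:
  assumes M: "csubspace M" "\<And>x. x \<in> M \<Longrightarrow> T *v x \<in> M" and l: "poly (minpoly_on M T) l = 0"
  shows "l \<in> spec_on M T"
proof -
  define m where "m = minpoly_on M T"
  have m0: "m \<noteq> 0" using lead_coeff_minpoly[of M T] by (auto simp: m_def)
  obtain r where r: "m = [:- l, 1:] * r" using l by (auto simp: poly_eq_0_iff_dvd dvd_def m_def)
  then have r0: "r \<noteq> 0" using m0 by auto
  have "degree r < degree m" using r r0 by (simp add: degree_mult_eq del: mult_pCons_left)
  then have "\<not> annihilates_on M T r" using minpoly_minimal[OF r0, of M T] by (auto simp: m_def)
  then obtain x where x: "x \<in> M" "polyop r T x \<noteq> 0" by (auto simp: annihilates_on_def)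
  have "polyop m T x = 0" using annihilates_minpoly[of M T] x by (auto simp: m_def annihilates_on_def)
  then have "T *v polyop r T x = l *s polyop r T x" unfolding r polyop_mult by (simp add: polyop_pCons)
  then show ?thesis using x polyop_mem[OF M x(1)] by (auto simp: spec_on_def)
qed

lemma cinner_polyop:
  "cinner (polyop q T x) y = cinner x (polyop (map_poly cnj q) (cadj T) y)"
  by (simp add: polyop_def degree_map_poly coeff_map_poly cv.ip_sum cv.ip_sum_right cinner_simps funpow_cadj)

text \<open>The adjoint of q(T) is the conjugated polynomial in the adjoint of \<open>T\<close>. As
  \<open>M\<close> reduces \<open>T\<close>, the value z lies in \<open>M\<close> again and can be
  tested against itself.\<close>

lemma polyop_cnj_annihilates:
  assumes M: "reduces M T" and q: "annihilates_on M T q" and x: "x \<in> M"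
  shows "polyop (map_poly cnj q) (cadj T) x = 0"
proof -
  define z where "z = polyop (map_poly cnj q) (cadj T) x"
  have "z \<in> M" unfolding z_def by (rule polyop_mem) (use M x reducesD[OF M] in auto)
  then have "cinner (polyop q T z) x = 0" using q by (simp add: annihilates_on_def cinner_simps)
  then have "cinner z z = 0" by (simp add: cinner_polyop z_def)
  then show ?thesis using cv.ip_definite[of z] by (simp add: z_def)
qed

section \<open>Spectrum and decay of powers of a completely non-unitary contraction\<close>

text \<open>For a contraction, an eigenvector x with unimodular eigenvalue l is also an eigenvector
  of the adjoint: the squared norm of T* x - \<open>cnj l\<close> x is that of T* x minus that of x,
  hence at most 0. The line through x then reduces \<open>T\<close> to a unitary, which complete
  non-unitarity forbids.\<close>

lemma cnu_spec_in_disc: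
  assumes T: "contraction T" and M: "reduces M T" and cnu: "cnu_on M T" and l: "l \<in> spec_on M T"
  shows "cmod l < 1"
proof (rule ccontr)
  assume "\<not> cmod l < 1"
  obtain x where x: "x \<in> M" "x \<noteq> 0" "T *v x = l *s x" using l by (auto simp: spec_on_def)
  have "cmod l * norm x \<le> norm x" using contraction_norm_le[OF T, of x] x by (simp add: norm_scale_cvec)
  then have "cmod l = 1" using x \<open>\<not> cmod l < 1\<close> by auto
  then have ll: "cnj l * l = 1" "l * cnj l = 1" using complex_norm_square[of l] by (auto simp: mult.commute)
  define y where "y = cadj T *v x - cnj l *s x"
  have "cinner y y = cinner (cadj T *v x) (cadj T *v x) - cinner x x"
    unfolding y_def by (simp add: cinner_simps cinner_cadj_left x ll)
      (simp add: cinner_cadj[symmetric] x cinner_simps ll mult.assoc[symmetric])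
  then have "(norm y)\<^sup>2 = (norm (cadj T *v x))\<^sup>2 - (norm x)\<^sup>2"
    unfolding cinner_self by (metis of_real_diff of_real_eq_iff)
  also have "\<dots> \<le> 0" using contraction_cadj_norm_le[OF T, of x] by (simp add: power_mono)
  finally have "y = 0" by simp
  then have Tx: "cadj T *v x = cnj l *s x" by (simp add: y_def)
  define N where "N = range (\<lambda>c. c *s x)"
  have N: "csubspace N"
  proof -
    have "0 *s x \<in> N" "(a + b) *s x \<in> N" "(a * b) *s x \<in> N" for a b unfolding N_def by blast+
    then show ?thesis unfolding csubspace_def by (auto simp: N_def vec.scale_left_distrib)
  qed
  have "N \<subseteq> M" using x csubspaceD[OF reducesD(1)[OF M]] by (auto simp: N_def)
  moreover have "reduces N T" unfolding reduces_def using N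
    by (auto simp: N_def matrix_vector_mult_scale x Tx)
  moreover have "unitary_on N T" unfolding unitary_on_def
    by (auto simp: N_def matrix_vector_mult_scale x Tx ll mult.assoc)
  ultimately have "N = {0}" using cnu by (auto simp: cnu_on_def)
  moreover have "x \<in> N" unfolding N_def by (rule image_eqI[of _ _ 1]) auto
  ultimately show False using x by auto
qed

lemma tendsto_zero_of_recurrence:
  fixes u :: "nat \<Rightarrow> 'n::finite cvec"
  assumes l: "cmod l < 1" and lim: "(\<lambda>k. u (Suc k) - l *s u k) \<longlonglongrightarrow> 0"
  shows "u \<longlonglongrightarrow> 0"
proof (rule LIMSEQ_I)
  fix e :: real assume e: "0 < e"
  define t where "t = cmod l"
  have t: "0 \<le> t" "t < 1" using l by (auto simp: t_def)
  \<comment> \<open>This makes e / 2 the fixed point of s |-> t s + d, so the bound e / 2 plus a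
    geometric term is reproduced by each step of the recurrence.\<close>
  define d where "d = e / 2 * (1 - t)"
  have d: "0 < d" using e t by (simp add: d_def)
  from LIMSEQ_D[OF lim d] obtain N where N: "\<And>k. k \<ge> N \<Longrightarrow> norm (u (Suc k) - l *s u k) < d" by auto
  have b: "norm (u (N + j)) \<le> t ^ j * norm (u N) + e / 2" for j
  proof (induction j)
    case (Suc j)
    have "norm (u (Suc (N + j))) \<le> norm (l *s u (N + j)) + norm (u (Suc (N + j)) - l *s u (N + j))"
      using norm_triangle_ineq[of "l *s u (N + j)" "u (Suc (N + j)) - l *s u (N + j)"] by simp
    also have "\<dots> \<le> t * norm (u (N + j)) + d" using N[of "N + j"] by (simp add: norm_scale_cvec t_def)
    also have "\<dots> \<le> t * (t ^ j * norm (u N) + e / 2) + d" using Suc t by (intro add_mono mult_left_mono) auto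
    also have "\<dots> = t ^ Suc j * norm (u N) + e / 2" by (simp add: d_def field_simps)
    finally show ?case by simp
  qed (use e in simp)
  have "(\<lambda>j. t ^ j * norm (u N)) \<longlonglongrightarrow> 0 * norm (u N)"
    using t by (intro tendsto_mult_right LIMSEQ_power_zero) auto
  then have "(\<lambda>j. t ^ j * norm (u N)) \<longlonglongrightarrow> 0" by simp
  then obtain J where J: "\<And>j. j \<ge> J \<Longrightarrow> norm (t ^ j * norm (u N)) < e / 2"
    using LIMSEQ_D[of _ 0 "e / 2"] e by fastforce
  show "\<exists>no. \<forall>n\<ge>no. norm (u n - 0) < e"
  proof (intro exI[of _ "N + J"] allI impI)
    fix n assume n: "N + J \<le> n"
    then have "norm (u (N + (n - N))) \<le> t ^ (n - N) * norm (u N) + e / 2" by (intro b)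
    moreover have "norm (t ^ (n - N) * norm (u N)) < e / 2" using n by (intro J) auto
    ultimately show "norm (u n - 0) < e" using n by auto
  qed
qed

text \<open>A root l of \<open>q\<close> can be cancelled: with q = (z - l) r, the hypothesis says
  that r(A) A^k x satisfies the recurrence of \<open>tendsto_zero_of_recurrence\<close>. After all
  roots are gone a nonzero constant remains.\<close>

lemma funpow_tendsto_zero_of_poly:
  fixes A :: "'n::finite cmat"
  assumes "q \<noteq> 0" "\<And>l. poly q l = 0 \<Longrightarrow> cmod l < 1"
    and "(\<lambda>k. polyop q A ((((*v) A) ^^ k) x)) \<longlonglongrightarrow> 0"
  shows "(\<lambda>k. (((*v) A) ^^ k) x) \<longlonglongrightarrow> 0"
  using assms
proof (induction "degree q" arbitrary: q rule: less_induct)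
  case less
  show ?case
  proof (cases "degree q = 0")
    case True
    then obtain c where c: "q = [:c:]" by (metis degree_eq_zeroE)
    then have c0: "c \<noteq> 0" using less.prems by simp
    have "(\<lambda>k. cmod c * norm ((((*v) A) ^^ k) x)) \<longlonglongrightarrow> 0"
      using tendsto_norm_zero[OF less.prems(3)] by (simp add: c polyop_pCons norm_scale_cvec)
    then have "(\<lambda>k. (1 / cmod c) * (cmod c * norm ((((*v) A) ^^ k) x))) \<longlonglongrightarrow> (1 / cmod c) * 0"
      by (rule tendsto_mult_left)
    moreover have "(\<lambda>k. (1 / cmod c) * (cmod c * norm ((((*v) A) ^^ k) x))) = (\<lambda>k. norm ((((*v) A) ^^ k) x))"
      using c0 by auto
    ultimately have "(\<lambda>k. norm ((((*v) A) ^^ k) x)) \<longlonglongrightarrow> 0" by (simp only: mult_zero_right)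
    then show ?thesis by (rule tendsto_norm_zero_cancel)
  next
    case False
    then obtain l where l: "poly q l = 0"
      using fundamental_theorem_of_algebra[of q] by (auto simp: constant_degree)
    then obtain r where r: "q = [:- l, 1:] * r" by (auto simp: poly_eq_0_iff_dvd dvd_def)
    then have r0: "r \<noteq> 0" using less.prems(1) by auto
    have deg: "degree r < degree q" using r r0 by (simp add: degree_mult_eq del: mult_pCons_left)
    have "(\<lambda>k. polyop r A ((((*v) A) ^^ k) x)) \<longlonglongrightarrow> 0"
    proof (rule tendsto_zero_of_recurrence[of l])
      have "polyop q A ((((*v) A) ^^ k) x)
          = polyop r A ((((*v) A) ^^ Suc k) x) - l *s polyop r A ((((*v) A) ^^ k) x)" for k
        unfolding r polyop_mult by (simp add: polyop_pCons polyop_commute)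
      then show "(\<lambda>k. polyop r A ((((*v) A) ^^ Suc k) x) - l *s polyop r A ((((*v) A) ^^ k) x)) \<longlonglongrightarrow> 0"
        using less.prems(3) by simp
    qed (use less.prems l in auto)
    then show ?thesis using less.hyps[OF deg r0] less.prems(2) by (auto simp: r)
  qed
qed

lemma cnu_powers_tendsto_zero:
  fixes T :: "'n::finite cmat"
  assumes T: "contraction T" and M: "reduces M T" and cnu: "cnu_on M T" and x: "x \<in> M"
  shows "(\<lambda>k. (((*v) (cadj T)) ^^ k) x) \<longlonglongrightarrow> 0"
proof (rule funpow_tendsto_zero_of_poly)
  define m where "m = minpoly_on M T"
  have m0: "m \<noteq> 0" using lead_coeff_minpoly[of M T] by (auto simp: m_def)
  show "map_poly cnj m \<noteq> 0" using m0 by (simp add: map_poly_eq_0_iff)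
  show "cmod l < 1" if l: "poly (map_poly cnj m) l = 0" for l
  proof -
    have "poly (map_poly cnj m) l = cnj (poly m (cnj l))"
      by (induction m) (simp_all add: map_poly_pCons)
    then have "poly m (cnj l) = 0" using l by simp
    then have "cnj l \<in> spec_on M T"
      unfolding m_def using reducesD[OF M] by (intro root_minpoly_in_spec) auto
    then show ?thesis using cnu_spec_in_disc[OF T M cnu] by fastforce
  qed
  have "(((*v) (cadj T)) ^^ k) x \<in> M" for k using reducesD[OF M] x by (intro funpow_mem) auto
  then show "(\<lambda>k. polyop (map_poly cnj m) (cadj T) ((((*v) (cadj T)) ^^ k) x)) \<longlonglongrightarrow> 0"
    using polyop_cnj_annihilates[OF M annihilates_minpoly] by (simp add: m_def)
qed

section \<open>Joint diagonalisation of commuting normal operators\<close>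

text \<open>Normality is assumed at the single vector \<open>x\<close>, since the operators in
  question are normal only on a subspace.\<close>

lemma normal_eigenvector:
  assumes "T *v (cadj T *v x) = cadj T *v (T *v x)" "T *v x = l *s x"
  shows "cadj T *v x = cnj l *s x"
proof -
  define y where "y = cadj T *v x - cnj l *s x"
  have a: "cinner (cadj T *v x) (cadj T *v x) = l * cnj l * cinner x x"
  proof -
    have "cinner (cadj T *v x) (cadj T *v x) = cinner x (cadj T *v (T *v x))"
      using assms(1) by (simp add: cinner_cadj_left)
    also have "\<dots> = l * cnj l * cinner x x"
      by (simp add: cinner_cadj[symmetric] assms(2) cinner_simps)
    finally show ?thesis .
  qed
  have b: "cinner (cadj T *v x) x = cnj l * cinner x x"
    by (simp add: cinner_cadj_left assms(2) cinner_simps)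
  have c: "cinner x (cadj T *v x) = l * cinner x x"
    by (simp add: cinner_cadj[symmetric] assms(2) cinner_simps)
  have "cinner y y = 0" unfolding y_def by (simp add: cinner_simps a b c)
  then show ?thesis using cv.ip_definite[of y] by (simp add: y_def)
qed

text \<open>An eigenspace of \<open>T1\<close> is invariant under \<open>T2\<close>, so it contains
  a joint eigenvector e. By normality e is also an eigenvector of both adjoints, hence its
  orthogonal complement in \<open>M\<close> reduces both operators and the dimension drops. Taking
  \<open>T1\<close> = \<open>T2\<close> gives the spectral theorem for one operator, used for the
  defect operator and for eigenspace decompositions.\<close>

lemma joint_eigenbasis:
  fixes T1 T2 :: "'n::finite cmat"
  assumes comm: "T1 ** T2 = T2 ** T1" and "reduces M T1" "reduces M T2"
    and "\<And>x. x \<in> M \<Longrightarrow> T1 *v (cadj T1 *v x) = cadj T1 *v (T1 *v x)"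
    and "\<And>x. x \<in> M \<Longrightarrow> T2 *v (cadj T2 *v x) = cadj T2 *v (T2 *v x)"
  shows "\<exists>E. finite E \<and> E \<subseteq> M \<and> (\<forall>e\<in>E. norm e = 1 \<and> (\<exists>l. T1 *v e = l *s e) \<and> (\<exists>m. T2 *v e = m *s e)) \<and>
    (\<forall>e\<in>E. \<forall>e'\<in>E. e \<noteq> e' \<longrightarrow> cinner e e' = 0) \<and> (\<forall>x\<in>M. x = (\<Sum>e\<in>E. cinner x e *s e))"
  using assms(2-)
proof (induction "vec.dim M" arbitrary: M rule: less_induct)
  case less
  note M = reducesD[OF \<open>reduces M T1\<close>] reducesD[OF \<open>reduces M T2\<close>]
  show ?case
  proof (cases "M = {0}")
    case True
    then show ?thesis by (intro exI[of _ "{}"]) auto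
  next
    case False
    obtain l x where x: "x \<in> M" "x \<noteq> 0" "T1 *v x = l *s x" using ex_eigenvector[OF M(1,2) False] by blast
    define L where "L = {x\<in>M. T1 *v x = l *s x}"
    have L: "csubspace L" using M(1) unfolding L_def csubspace_def
      by (auto simp: matrix_vector_right_distrib vec.scale_right_distrib matrix_vector_mult_scale mult.commute)
    have LT: "T2 *v x \<in> L" if "x \<in> L" for x
    proof -
      have "T1 *v (T2 *v x) = T2 *v (T1 *v x)" using comm by (simp add: matrix_vector_mul_assoc)
      then show ?thesis using that M by (auto simp: L_def matrix_vector_mult_scale)
    qed
    have "L \<noteq> {0}" using x by (auto simp: L_def)
    from ex_eigenvector[OF L LT this] obtain m y
      where y: "y \<in> M" "y \<noteq> 0" "T1 *v y = l *s y" "T2 *v y = m *s y" by (auto simp: L_def)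
    define e where "e = complex_of_real (1 / norm y) *s y"
    have e: "e \<in> M" "norm e = 1" "T1 *v e = l *s e" "T2 *v e = m *s e"
      using y csubspaceD(3)[OF M(1)]
      by (auto simp: e_def norm_scale_cvec norm_divide matrix_vector_mult_scale mult.commute)
    have e': "cadj T1 *v e = cnj l *s e" "cadj T2 *v e = cnj m *s e"
      using e less.prems(3,4) by (auto intro: normal_eigenvector)
    define M' where "M' = {x\<in>M. cinner x e = 0}"
    have M': "csubspace M'" using M(1) unfolding M'_def csubspace_def by (auto simp: cinner_simps)
    have "e \<notin> M'" using e by (simp add: M'_def cinner_self)
    then have "M' \<subset> M" using e by (auto simp: M'_def)
    then have dim: "vec.dim M' < vec.dim M"
      using M' M(1) vec.dim_psubset[of M' M] by (simp add: csubspace_iff_subspace vec.span_eq_iff[THEN iffD2])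
    have red: "reduces M' T1" "reduces M' T2"
      using M' M by (auto simp: reduces_def M'_def cinner_cadj cinner_cadj_left e e' cinner_simps)
    have "\<exists>E. finite E \<and> E \<subseteq> M' \<and> (\<forall>e\<in>E. norm e = 1 \<and> (\<exists>l. T1 *v e = l *s e) \<and> (\<exists>m. T2 *v e = m *s e)) \<and>
      (\<forall>e\<in>E. \<forall>e'\<in>E. e \<noteq> e' \<longrightarrow> cinner e e' = 0) \<and> (\<forall>x\<in>M'. x = (\<Sum>e\<in>E. cinner x e *s e))"
      by (rule less.hyps[OF dim red]) (use less.prems(3,4) in \<open>auto simp: M'_def\<close>)
    then obtain E where E: "finite E" "E \<subseteq> M'"
      "\<forall>e\<in>E. norm e = 1 \<and> (\<exists>l. T1 *v e = l *s e) \<and> (\<exists>m. T2 *v e = m *s e)"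
      "\<forall>e\<in>E. \<forall>e'\<in>E. e \<noteq> e' \<longrightarrow> cinner e e' = 0" "\<forall>x\<in>M'. x = (\<Sum>e\<in>E. cinner x e *s e)" by blast
    have eE: "e \<notin> E" using E(2) \<open>e \<notin> M'\<close> by auto
    have orth: "cinner f e = 0" "cinner e f = 0" if "f \<in> E" for f
    proof -
      show "cinner f e = 0" using E(2) that by (auto simp: M'_def)
      then show "cinner e f = 0" using cinner_cnj[of f e] by simp
    qed
    have "x = (\<Sum>f\<in>insert e E. cinner x f *s f)" if xM: "x \<in> M" for x
    proof -
      define x' where "x' = x - cinner x e *s e"
      have "x' \<in> M'" using xM e csubspaceD[OF M(1)] by (auto simp: x'_def M'_def cinner_simps cinner_self)
      then have "x' = (\<Sum>f\<in>E. cinner x' f *s f)" using E by blast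
      also have "\<dots> = (\<Sum>f\<in>E. cinner x f *s f)"
        by (intro sum.cong) (auto simp: x'_def cinner_simps orth)
      finally show ?thesis using E(1) eE by (simp add: x'_def algebra_simps)
    qed
    then show ?thesis using E e orth eE
      by (intro exI[of _ "insert e E"]) (auto simp: M'_def)
  qed
qed

lemma ip_eigenbasis_sum:
  assumes "finite E" "\<forall>e\<in>E. norm e = 1" "\<forall>e\<in>E. \<forall>e'\<in>E. e \<noteq> e' \<longrightarrow> cinner e e' = 0" "e \<in> E"
  shows "cinner (\<Sum>f\<in>E. c f *s f) e = c e"
proof -
  have "cinner (\<Sum>f\<in>E. c f *s f) e = (\<Sum>f\<in>E. c f * cinner f e)"
    by (simp add: cv.ip_sum cinner_simps)
  also have "\<dots> = (\<Sum>f\<in>E. if f = e then c e else 0)"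
    using assms by (intro sum.cong) (auto simp: cinner_self)
  finally show ?thesis using assms by simp
qed

subsection \<open>The defect operator\<close>

text \<open>Existence and uniqueness of the positive root on \<open>M\<close>: existence by taking
  roots of the eigenvalues of I - T T* on an orthonormal eigenbasis, uniqueness by showing that
  every positive root acts on this basis in the same way. The value 0 outside \<open>M\<close> is
  what makes the root unique as a function on the whole type.\<close>

lemma defect_operator_properties:
  fixes T :: "'n::finite cmat"
  assumes T: "contraction T" and M: "reduces M T"
  shows defect_mem: "x \<in> M \<Longrightarrow> defect M T x \<in> M"
    and defect_defect: "x \<in> M \<Longrightarrow> defect M T (defect M T x) = x - T *v (cadj T *v x)"
    and defect_selfadjoint: "\<lbrakk>x \<in> M; y \<in> M\<rbrakk> \<Longrightarrow> cinner (defect M T x) y = cinner x (defect M T y)"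
proof -
  note M' = reducesD[OF M] and sub = csubspaceD[OF reducesD(1)[OF M]]
  define Q where "Q = mat 1 - T ** cadj T"
  have Q: "Q *v x = x - T *v (cadj T *v x)" for x
    by (simp add: Q_def matrix_vector_mult_diff_rdistrib matrix_vector_mul_assoc)
  have Qself: "cinner (Q *v x) y = cinner x (Q *v y)" for x y
    by (simp add: Q cinner_simps cinner_cadj cinner_cadj_left)
  have "cadj Q *v x = Q *v x" for x
    by (rule cinner_eqI) (simp add: cinner_cadj_left Qself)
  then have Qadj: "cadj Q = Q" by (simp add: matrix_eq)
  have redQ: "reduces M Q" unfolding reduces_def Qadj using M' sub by (auto simp: Q)
  have "\<exists>E. finite E \<and> E \<subseteq> M \<and> (\<forall>e\<in>E. norm e = 1 \<and> (\<exists>l. Q *v e = l *s e) \<and> (\<exists>m. Q *v e = m *s e)) \<and>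
    (\<forall>e\<in>E. \<forall>e'\<in>E. e \<noteq> e' \<longrightarrow> cinner e e' = 0) \<and> (\<forall>x\<in>M. x = (\<Sum>e\<in>E. cinner x e *s e))"
    by (rule joint_eigenbasis[OF refl redQ redQ]) (simp_all add: Qadj)
  then obtain E where E': "finite E" "E \<subseteq> M"
    "\<forall>e\<in>E. norm e = 1 \<and> (\<exists>l. Q *v e = l *s e) \<and> (\<exists>m. Q *v e = m *s e)"
    "\<forall>e\<in>E. \<forall>e'\<in>E. e \<noteq> e' \<longrightarrow> cinner e e' = 0" "\<forall>x\<in>M. x = (\<Sum>e\<in>E. cinner x e *s e)" by blast
  then have En: "\<forall>e\<in>E. norm e = 1" and Eev: "\<And>e. e \<in> E \<Longrightarrow> \<exists>l. Q *v e = l *s e" by blast+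
  note E = E'(1,2) En Eev E'(4) bspec[OF E'(5)]
  \<comment> \<open>For a unit eigenvector e of \<open>Q\<close> the radicand is the eigenvalue <Q
    e, e>; it is nonnegative because the adjoint of a contraction is a contraction.\<close>
  define s where "s e = sqrt ((norm e)\<^sup>2 - (norm (cadj T *v e))\<^sup>2)" for e
  have le: "(norm (cadj T *v e))\<^sup>2 \<le> (norm e)\<^sup>2" for e
    using contraction_cadj_norm_le[OF T, of e] by (simp add: power_mono)
  have s0: "0 \<le> s e" for e using le by (simp add: s_def)
  have Qe: "Q *v e = complex_of_real (s e) *s (complex_of_real (s e) *s e)" if e: "e \<in> E" for e
  proof -
    obtain l where l: "Q *v e = l *s e" using E(4)[OF e] by auto
    have "l = cinner (Q *v e) e" using e E(3) by (simp add: l cinner_simps cinner_self)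
    also have "\<dots> = cinner e e - cinner (cadj T *v e) (cadj T *v e)"
      by (simp add: Q cinner_simps cinner_cadj)
    also have "\<dots> = complex_of_real ((s e)\<^sup>2)" using le by (simp add: cinner_self s_def)
    finally show ?thesis by (simp add: l power2_eq_square)
  qed
  define S where "S x = (\<Sum>e\<in>E. (complex_of_real (s e) * cinner x e) *s e)" for x
  define P where "P R \<longleftrightarrow> (\<forall>x. x \<notin> M \<longrightarrow> R x = 0) \<and> (\<forall>x\<in>M. R x \<in> M) \<and>
      (\<forall>x\<in>M. R (R x) = x - T *v (cadj T *v x)) \<and>
      (\<forall>x\<in>M. \<forall>y\<in>M. cinner (R x) y = cinner x (R y)) \<and>
      (\<forall>x\<in>M. 0 \<le> Re (cinner (R x) x))" for R
  have SM: "S x \<in> M" for x unfolding S_def using E(2) by (intro sub) auto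
  have Se: "cinner (S x) e = complex_of_real (s e) * cinner x e" if "e \<in> E" for x e
    unfolding S_def using ip_eigenbasis_sum[OF E(1,3,5) that] .
  have Sxy: "cinner (S x) y = (\<Sum>e\<in>E. complex_of_real (s e) * cinner x e * cnj (cinner y e))" for x y
    by (simp add: S_def cv.ip_sum cinner_simps cinner_cnj)
  have "P (\<lambda>x. if x \<in> M then S x else 0)"
    unfolding P_def
  proof (intro conjI ballI allI impI)
    fix x assume x: "x \<in> M"
    have "S (S x) = (\<Sum>e\<in>E. cinner x e *s (Q *v e))"
      unfolding S_def[of "S x"] by (intro sum.cong) (auto simp: Se Qe mult_ac)
    also have "\<dots> = Q *v (\<Sum>e\<in>E. cinner x e *s e)"
      by (simp add: vec.sum matrix_vector_mult_scale)
    also have "\<dots> = x - T *v (cadj T *v x)" using E(6)[OF x] by (simp add: Q)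
    finally show "(if (if x \<in> M then S x else 0) \<in> M then S (if x \<in> M then S x else 0) else 0) = x - T *v (cadj T *v x)"
      using x SM by simp
    have "cinner (S x) x = (\<Sum>e\<in>E. complex_of_real (s e * (cmod (cinner x e))\<^sup>2))"
      unfolding Sxy by (intro sum.cong refl) (simp add: mult.assoc complex_norm_square[symmetric])
    then have "Re (cinner (S x) x) = (\<Sum>e\<in>E. s e * (cmod (cinner x e))\<^sup>2)" by simp
    then show "0 \<le> Re (cinner (if x \<in> M then S x else 0) x)" using x s0 by (simp add: sum_nonneg)
    fix y assume y: "y \<in> M"
    have "cinner (S x) y = cinner x (S y)"
      by (subst cinner_cnj[of "S y" x, symmetric]) (simp add: Sxy mult_ac)
    then show "cinner (if x \<in> M then S x else 0) y = cinner x (if y \<in> M then S y else 0)"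
      using x y by simp
  qed (use SM in auto)
  moreover have "R = (\<lambda>x. if x \<in> M then S x else 0)" if R: "P R" for R
  proof
    fix x
    have Rs: "R e = complex_of_real (s e) *s e" if e: "e \<in> E" for e
    proof -
      have eM: "e \<in> M" using e E by auto
      have RM: "R x \<in> M" if "x \<in> M" for x using R that by (simp add: P_def)
      have Rself: "cinner (R x) y = cinner x (R y)" if "x \<in> M" "y \<in> M" for x y
        using R that by (simp add: P_def)
      have RRe: "R (R e) = complex_of_real (s e) *s (complex_of_real (s e) *s e)"
        using R eM Qe[OF e] by (simp add: P_def Q)
      define y where "y = R e - complex_of_real (s e) *s e"
      have yM: "y \<in> M" unfolding y_def using eM RM by (intro sub) auto
      have "y = 0"
      proof (cases "s e = 0")
        case True
        have "cinner (R e) (R e) = cinner (R (R e)) e" using eM RM Rself by auto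
        then have "cinner (R e) (R e) = 0" by (simp add: RRe True cinner_simps)
        then show ?thesis using cv.ip_definite[of "R e"] by (simp add: y_def True)
      next
        case False
        \<comment> \<open>Formally R y = - s y, against positivity unless y = 0. The properties
          available for \<open>R\<close> do not include linearity, so \<open>y\<close> is expanded
          only in an argument of the inner product from which self-adjointness has removed
          \<open>R\<close>.\<close>
        have "cinner (R y) y = cinner y (R y)" using yM Rself by blast
        also have "\<dots> = cinner (R e) (R y) - complex_of_real (s e) * cinner e (R y)"
          by (subst (1) y_def) (simp add: cinner_simps)
        also have "\<dots> = cinner (R (R e)) y - complex_of_real (s e) * cinner (R e) y"
          using yM eM RM Rself by simp
        also have "\<dots> = - (complex_of_real (s e) * cinner y y)"
          by (simp add: RRe y_def cinner_simps algebra_simps)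
        finally have "Re (cinner (R y) y) = - (s e * (norm y)\<^sup>2)" by (simp add: cinner_self flip: of_real_power)
        then have "s e * (norm y)\<^sup>2 \<le> 0" using R yM by (auto simp: P_def)
        then show ?thesis using s0[of e] False by (simp add: mult_le_0_iff)
      qed
      then show ?thesis by (simp add: y_def)
    qed
    show "R x = (if x \<in> M then S x else 0)"
    proof (cases "x \<in> M")
      case True
      then have "R x = (\<Sum>e\<in>E. cinner (R x) e *s e)" using R by (intro E(6)) (auto simp: P_def)
      also have "\<dots> = S x" unfolding S_def
      proof (intro sum.cong refl)
        fix e assume e: "e \<in> E"
        then have "cinner (R x) e = cinner x (R e)" using R True E(2) by (auto simp: P_def)
        then show "cinner (R x) e *s e = (complex_of_real (s e) * cinner x e) *s e"
          by (simp add: Rs[OF e] cinner_simps)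
      qed
      finally show ?thesis using True by simp
    qed (use R in \<open>auto simp: P_def\<close>)
  qed
  ultimately have "\<exists>!R. P R" by blast
  from theI'[OF this] have "P (defect M T)" unfolding P_def defect_def .
  then show "x \<in> M \<Longrightarrow> defect M T x \<in> M" "x \<in> M \<Longrightarrow> defect M T (defect M T x) = x - T *v (cadj T *v x)"
    "\<lbrakk>x \<in> M; y \<in> M\<rbrakk> \<Longrightarrow> cinner (defect M T x) y = cinner x (defect M T y)"
    unfolding P_def by blast+
qed

lemma cinner_eqI_on:
  assumes "csubspace M" "x \<in> M" "y \<in> M" "\<And>z. z \<in> M \<Longrightarrow> cinner x z = cinner y z"
  shows "x = y"
proof -
  have "cinner (x - y) (x - y) = 0"
    using assms(4)[OF csubspaceD(4)[OF assms(1-3)]] cv.ip_diff[of x y "x - y"] by simp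
  then show ?thesis using cv.ip_definite[of "x - y"] by simp
qed

text \<open>Linearity is a consequence of self-adjointness: both sides lie in \<open>M\<close> and
  have the same inner products with all of \<open>M\<close>.\<close>

lemma defect_linear:
  fixes T :: "'n::finite cmat"
  assumes T: "contraction T" and M: "reduces M T"
  shows defect_add: "\<lbrakk>x \<in> M; y \<in> M\<rbrakk> \<Longrightarrow> defect M T (x + y) = defect M T x + defect M T y"
    and defect_scale: "x \<in> M \<Longrightarrow> defect M T (c *s x) = c *s defect M T x"
proof -
  note d = defect_mem[OF T M] defect_selfadjoint[OF T M]
  note sub = csubspaceD[OF reducesD(1)[OF M]]
  show "defect M T (x + y) = defect M T x + defect M T y" if "x \<in> M" "y \<in> M"
    by (rule cinner_eqI_on[OF reducesD(1)[OF M]]) (use that in \<open>auto simp: d sub cinner_simps\<close>)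
  show "defect M T (c *s x) = c *s defect M T x" if "x \<in> M"
    by (rule cinner_eqI_on[OF reducesD(1)[OF M]]) (use that in \<open>auto simp: d sub cinner_simps\<close>)
qed

lemma cinner_defect:
  assumes T: "contraction T" and M: "reduces M T" and x: "x \<in> M" and y: "y \<in> M"
  shows "cinner (defect M T x) (defect M T y) = cinner x y - cinner (cadj T *v x) (cadj T *v y)"
proof -
  have "cinner (defect M T x) (defect M T y) = cinner (defect M T (defect M T x)) y"
    using defect_selfadjoint[OF T M defect_mem[OF T M x] y] by simp
  also have "\<dots> = cinner x y - cinner (cadj T *v x) (cadj T *v y)"
    by (simp add: defect_defect[OF T M x] cinner_simps cinner_cadj)
  finally show ?thesis .
qed

lemma norm_defect:
  assumes T: "contraction T" and M: "reduces M T" and x: "x \<in> M"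
  shows "(norm (defect M T x))\<^sup>2 = (norm x)\<^sup>2 - (norm (cadj T *v x))\<^sup>2"
  using cinner_defect[OF T M x x] unfolding cinner_self by (metis of_real_diff of_real_eq_iff)

lemma csubspace_defect_space:
  assumes T: "contraction T" and M: "reduces M T"
  shows "csubspace (defect_space M T)"
proof -
  note d = defect_add[OF T M] defect_scale[OF T M]
  note sub = csubspaceD[OF reducesD(1)[OF M]]
  have "defect M T 0 = 0" using d(2)[of 0 0] sub(1) by simp
  then have "0 \<in> defect_space M T" unfolding defect_space_def using sub(1) by (metis image_eqI)
  moreover have "x + y \<in> defect_space M T" if "x \<in> defect_space M T" "y \<in> defect_space M T" for x y
  proof -
    obtain a b where "x = defect M T a" "a \<in> M" "y = defect M T b" "b \<in> M"
      using \<open>x \<in> _\<close> \<open>y \<in> _\<close> unfolding defect_space_def by blast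
    then show ?thesis unfolding defect_space_def by (intro image_eqI[of _ _ "a + b"]) (auto simp: d(1) sub(2))
  qed
  moreover have "c *s x \<in> defect_space M T" if "x \<in> defect_space M T" for x c
  proof -
    obtain a where "x = defect M T a" "a \<in> M" using \<open>x \<in> _\<close> unfolding defect_space_def by blast
    then show ?thesis unfolding defect_space_def by (intro image_eqI[of _ _ "c *s a"]) (auto simp: d(2) sub(3))
  qed
  ultimately show ?thesis by (simp add: csubspace_def)
qed

definition psc :: "complex \<Rightarrow> 'n::finite cvec \<times> 'n cvec \<Rightarrow> 'n cvec \<times> 'n cvec" where
  "psc c a = (c *s fst a, c *s snd a)"

lemma vector_space_psc: "vector_space (psc :: complex \<Rightarrow> 'n::finite cvec \<times> 'n cvec \<Rightarrow> _)"
  by unfold_locales (auto simp: psc_def vec.scale_left_distrib vec.scale_right_distrib)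

interpretation pv: cips psc UNIV "pinner :: 'n::finite cvec \<times> 'n cvec \<Rightarrow> 'n cvec \<times> 'n cvec \<Rightarrow> complex"
proof (intro cips.intro vector_space_psc cips_axioms.intro)
  interpret vector_space "psc :: complex \<Rightarrow> 'n cvec \<times> 'n cvec \<Rightarrow> _" by (rule vector_space_psc)
  show "subspace (UNIV :: ('n cvec \<times> 'n cvec) set)" by simp
  show "x = 0" if "pinner x x = 0" for x :: "'n cvec \<times> 'n cvec"
  proof -
    have "complex_of_real ((norm (fst x))\<^sup>2 + (norm (snd x))\<^sup>2) = 0"
      using that by (simp add: pinner_def cinner_self)
    then have "(norm (fst x))\<^sup>2 + (norm (snd x))\<^sup>2 = 0" by (simp only: of_real_eq_0_iff)
    then show ?thesis by (simp add: add_nonneg_eq_0_iff prod_eq_iff)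
  qed
qed (auto simp: psc_def pinner_def cinner_simps cinner_cnj cinner_self vec.scale_left_distrib
    vec.scale_right_distrib algebra_simps)

subsection \<open>Extending an isometry to a unitary\<close>

lemma pv_projectable:
  assumes "pv.subspace (K :: ('n::finite cvec \<times> 'n cvec) set)"
  shows "pv.projectable K"
proof (rule pv.projectable_if_separated)
  let ?\<Phi> = "range (\<lambda>i (a :: 'n cvec \<times> 'n cvec). fst a $ i) \<union> range (\<lambda>i a. snd a $ i)"
  show "finite ?\<Phi>" by simp
  show "f = 0" if "\<And>\<phi>. \<phi> \<in> ?\<Phi> \<Longrightarrow> \<phi> f = 0" for f
  proof -
    have "fst f $ i = 0" "snd f $ i = 0" for i
      using that[of "\<lambda>a. fst a $ i"] that[of "\<lambda>a. snd a $ i"] by blast+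
    then show ?thesis by (simp add: prod_eq_iff vec_eq_iff)
  qed
qed (use assms in \<open>auto simp: psc_def\<close>)

lemma ex_unit_orthogonal:
  assumes K: "pv.subspace K" and S: "pv.subspace S" and KS: "K \<subset> S"
  shows "\<exists>e\<in>S. pinner e e = 1 \<and> (\<forall>k\<in>K. pinner e k = 0) \<and> (\<forall>k\<in>K. pinner k e = 0)"
proof -
  obtain x where x: "x \<in> S" "x \<notin> K" using KS by auto
  define u where "u = x - pv.proj K x"
  note P = pv_projectable[OF K]
  have pK: "pv.proj K x \<in> K" by (rule pv.proj_mem[OF P]) simp
  then have u0: "u \<noteq> 0" using x by (auto simp: u_def)
  have uS: "u \<in> S" unfolding u_def using x pK KS by (intro pv.subspace_diff[OF S]) auto
  have uK: "pinner u k = 0" if "k \<in> K" for k unfolding u_def by (rule pv.proj_orth[OF P _ that]) simp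
  define e where "e = psc (complex_of_real (1 / pv.nrm u)) u"
  have n0: "pv.nrm u \<noteq> 0" using pv.nrm_eq_0[of u] u0 by auto
  have "pv.nrm e = 1" using n0 pv.nrm_nonneg[of u] by (simp add: e_def pv.nrm_sc norm_divide)
  then have "pinner e e = 1" using pv.ip_self[of e] by simp
  moreover have "e \<in> S" unfolding e_def by (rule pv.subspace_scale[OF S uS])
  moreover have ek: "pinner e k = 0" if "k \<in> K" for k using uK[OF that] by (simp add: e_def pv.ip_sc)
  moreover have "pinner k e = 0" if "k \<in> K" for k using ek[OF that] pv.ip_cnj[of e k] by simp
  ultimately show ?thesis by blast
qed

definition psc2 :: "complex \<Rightarrow> ('n::finite cvec \<times> 'n cvec) \<times> ('n cvec \<times> 'n cvec) \<Rightarrow> ('n cvec \<times> 'n cvec) \<times> ('n cvec \<times> 'n cvec)" where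
  "psc2 c a = (psc c (fst a), psc c (snd a))"

text \<open>A partial isometry is represented by its graph, whose real dimension equals that of its domain and
  that of its range; a graph of maximal dimension is therefore that of a unitary.\<close>

definition isograph :: "('n::finite cvec \<times> 'n cvec) set \<Rightarrow> (('n cvec \<times> 'n cvec) \<times> ('n cvec \<times> 'n cvec)) set \<Rightarrow> bool" where
  "isograph S G \<longleftrightarrow> G \<subseteq> S \<times> S \<and> 0 \<in> G \<and> (\<forall>a\<in>G. \<forall>b\<in>G. a + b \<in> G) \<and> (\<forall>c. \<forall>a\<in>G. psc2 c a \<in> G) \<and>
     (\<forall>a\<in>G. \<forall>b\<in>G. pinner (fst a) (fst b) = pinner (snd a) (snd b))"

lemma isographD:
  assumes "isograph S G"
  shows "0 \<in> G" "\<And>a b. \<lbrakk>a \<in> G; b \<in> G\<rbrakk> \<Longrightarrow> a + b \<in> G" "\<And>a c. a \<in> G \<Longrightarrow> psc2 c a \<in> G"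
    "\<And>a b. \<lbrakk>a \<in> G; b \<in> G\<rbrakk> \<Longrightarrow> pinner (fst a) (fst b) = pinner (snd a) (snd b)"
  using assms by (simp_all add: isograph_def)

lemma psc_of_real: "psc (complex_of_real r) a = r *\<^sub>R a"
  by (simp add: psc_def prod_eq_iff scaleR_cvec_eq)

lemma pv_subspace_imp_real: "pv.subspace S \<Longrightarrow> subspace S"
  unfolding subspace_def pv.subspace_def by (metis psc_of_real)

lemma isograph_subspaces:
  assumes "isograph S G"
  shows "subspace G" "pv.subspace (fst ` G)" "pv.subspace (snd ` G)"
proof -
  have r: "psc2 (complex_of_real r) a = r *\<^sub>R a" for r and a :: "('n::finite cvec \<times> 'n cvec) \<times> ('n cvec \<times> 'n cvec)"
    by (simp add: psc2_def prod_eq_iff psc_of_real)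
  show "subspace G" unfolding subspace_def using assms r unfolding isograph_def by metis
  have *: "a + b \<in> G" "psc2 c a \<in> G" if "a \<in> G" "b \<in> G" for a b c using assms that by (auto simp: isograph_def)
  have 0: "0 \<in> G" using assms by (simp add: isograph_def)
  show "pv.subspace (fst ` G)" unfolding pv.subspace_def
  proof (intro conjI ballI allI)
    show "0 \<in> fst ` G" using 0 by (intro image_eqI[of _ _ 0]) auto
    fix x c assume "x \<in> fst ` G"
    then obtain a where a: "a \<in> G" "x = fst a" by auto
    show "psc c x \<in> fst ` G" using *(2)[OF a(1) a(1)] a by (intro image_eqI[of _ _ "psc2 c a"]) (auto simp: psc2_def)
    fix y assume "y \<in> fst ` G"
    then obtain b where b: "b \<in> G" "y = fst b" by auto
    show "x + y \<in> fst ` G" using *(1)[OF a(1) b(1)] a b by (intro image_eqI[of _ _ "a + b"]) auto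
  qed
  show "pv.subspace (snd ` G)" unfolding pv.subspace_def
  proof (intro conjI ballI allI)
    show "0 \<in> snd ` G" using 0 by (intro image_eqI[of _ _ 0]) auto
    fix x c assume "x \<in> snd ` G"
    then obtain a where a: "a \<in> G" "x = snd a" by auto
    show "psc c x \<in> snd ` G" using *(2)[OF a(1) a(1)] a by (intro image_eqI[of _ _ "psc2 c a"]) (auto simp: psc2_def)
    fix y assume "y \<in> snd ` G"
    then obtain b where b: "b \<in> G" "y = snd b" by auto
    show "x + y \<in> snd ` G" using *(1)[OF a(1) b(1)] a b by (intro image_eqI[of _ _ "a + b"]) auto
  qed
qed

text \<open>A difference of two elements lies in the graph, and its components have equal norm, so
  they vanish together.\<close>

lemma isograph_inj:
  fixes S :: "('a::finite cvec \<times> 'a cvec) set"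
  assumes "isograph S G"
  shows "inj_on fst G" "inj_on snd G"
proof -
  have d: "fst a - fst b = 0 \<longleftrightarrow> snd a - snd b = 0" if "a \<in> G" "b \<in> G" for a b
  proof -
    have "a - b \<in> G" using isograph_subspaces(1)[OF assms] that by (rule subspace_diff)
    then have "pinner (fst a - fst b) (fst a - fst b) = pinner (snd a - snd b) (snd a - snd b)"
      using assms unfolding isograph_def by fastforce
    moreover have "pinner x x = 0 \<longleftrightarrow> x = 0" for x :: "'a cvec \<times> 'a cvec"
      using pv.ip_definite[of x] pv.ip_zero(1)[of 0] by auto
    ultimately show ?thesis by metis
  qed
  show "inj_on fst G" "inj_on snd G"
    by (rule inj_onI, use d in \<open>fastforce simp: prod_eq_iff\<close>)+
qed

lemma isograph_dim:
  assumes "isograph S G"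
  shows "dim (fst ` G) = dim G" "dim (snd ` G) = dim G"
  using isograph_inj[OF assms] isograph_subspaces(1)[OF assms]
  by (auto intro!: dim_image_eq simp: linear_fst linear_snd span_eq_iff[THEN iffD2])

text \<open>Domain and range have the same real dimension, so if one is proper in \<open>S\<close>
  then so is the other. A unit vector e orthogonal to the domain can then be sent to a unit vector
  e' orthogonal to the range.\<close>

lemma isograph_extend:
  assumes S: "pv.subspace S" and G: "isograph S G" and ne: "fst ` G \<noteq> S"
  shows "\<exists>G'. isograph S G' \<and> G \<subset> G'"
proof -
  note sub = isograph_subspaces[OF G]
  have GS: "fst ` G \<subseteq> S" "snd ` G \<subseteq> S" using G by (auto simp: isograph_def)
  have "snd ` G \<noteq> S"
  proof
    assume "snd ` G = S"
    then have "dim (fst ` G) = dim S" using isograph_dim[OF G] by simp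
    then have "fst ` G = S"
      using subspace_dim_equal[of "fst ` G" S] sub S GS by (auto simp: pv_subspace_imp_real)
    then show False using ne by simp
  qed
  with GS ne have ps: "fst ` G \<subset> S" "snd ` G \<subset> S" by auto
  obtain e where e: "e \<in> S" "pinner e e = 1" "\<forall>k\<in>fst ` G. pinner e k = 0" "\<forall>k\<in>fst ` G. pinner k e = 0"
    using ex_unit_orthogonal[OF sub(2) S ps(1)] by blast
  obtain e' where e': "e' \<in> S" "pinner e' e' = 1" "\<forall>k\<in>snd ` G. pinner e' k = 0" "\<forall>k\<in>snd ` G. pinner k e' = 0"
    using ex_unit_orthogonal[OF sub(3) S ps(2)] by blast
  define G' where "G' = {a + psc2 c (e, e') | a c. a \<in> G}"
  have "isograph S G'" unfolding isograph_def
  proof (intro conjI ballI allI)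
    show "G' \<subseteq> S \<times> S"
      using GS e(1) e'(1) by (auto simp: G'_def psc2_def intro!: pv.subspace_add[OF S] pv.subspace_scale[OF S])
    have "0 + psc2 0 (e, e') \<in> G'" using isographD(1)[OF G] unfolding G'_def by blast
    then show "0 \<in> G'" by (simp add: psc2_def psc_def zero_prod_def)
    fix x assume "x \<in> G'"
    then obtain a c where x: "x = a + psc2 c (e, e')" "a \<in> G" by (auto simp: G'_def)
    show "psc2 d x \<in> G'" for d
    proof -
      have "psc2 d x = psc2 d a + psc2 (d * c) (e, e')" by (simp add: x psc2_def pv.scale_right_distrib)
      then show ?thesis using isographD(3)[OF G] x unfolding G'_def by blast
    qed
    fix y assume "y \<in> G'"
    then obtain b d where y: "y = b + psc2 d (e, e')" "b \<in> G" by (auto simp: G'_def)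
    have "x + y = (a + b) + psc2 (c + d) (e, e')"
      by (simp add: x y psc2_def pv.scale_left_distrib prod_eq_iff)
    then show "x + y \<in> G'" using isographD(2)[OF G] x y unfolding G'_def by blast
    have "pinner (fst a) (fst b) = pinner (snd a) (snd b)" using isographD(4)[OF G] x y by blast
    then show "pinner (fst x) (fst y) = pinner (snd x) (snd y)"
      using x(2) y(2) e e' by (simp add: x(1) y(1) psc2_def pv.ip_add pv.ip_add_right pv.ip_sc pv.ip_sc_right)
  qed
  moreover have "G \<subseteq> G'"
  proof
    fix a assume "a \<in> G"
    then have "a + psc2 0 (e, e') \<in> G'" unfolding G'_def by blast
    then show "a \<in> G'" by (simp add: psc2_def psc_def zero_prod_def[symmetric])
  qed
  moreover have "(e, e') \<in> G'"
  proof -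
    have "0 + psc2 1 (e, e') \<in> G'" using isographD(1)[OF G] unfolding G'_def by blast
    then show ?thesis by (simp add: psc2_def psc_def)
  qed
  moreover have "(e, e') \<notin> G" using e by force
  ultimately show ?thesis by blast
qed

lemma isograph_total:
  fixes S :: "('a::finite cvec \<times> 'a cvec) set"
  assumes S: "pv.subspace S" and G0: "isograph S G0"
  shows "\<exists>G. isograph S G \<and> G0 \<subseteq> G \<and> fst ` G = S \<and> snd ` G = S"
proof -
  \<comment> \<open>Real dimensions of graphs are bounded by that of the ambient space, so an
    isometric graph of greatest dimension above \<open>G0\<close> exists; by
    \<open>isograph_extend\<close> its domain is all of \<open>S\<close>.\<close>
  have "dim G < Suc DIM(('a cvec \<times> 'a cvec) \<times> ('a cvec \<times> 'a cvec))"
    for G :: "(('a cvec \<times> 'a cvec) \<times> ('a cvec \<times> 'a cvec)) set"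
    using dim_subset_UNIV[of G] by simp
  then have "\<exists>G. (isograph S G \<and> G0 \<subseteq> G) \<and> (\<forall>G'. isograph S G' \<and> G0 \<subseteq> G' \<longrightarrow> dim G' \<le> dim G)"
    by (intro ex_has_greatest_nat[where k = G0]) (use G0 in auto)
  then obtain G where G: "isograph S G" "G0 \<subseteq> G" "\<And>G'. isograph S G' \<Longrightarrow> G0 \<subseteq> G' \<Longrightarrow> dim G' \<le> dim G" by blast
  have fst: "fst ` G = S"
  proof (rule ccontr)
    assume "fst ` G \<noteq> S"
    from isograph_extend[OF S G(1) this] obtain G' where G': "isograph S G'" "G \<subset> G'" by blast
    then have "dim G < dim G'"
      using dim_psubset[of G G'] isograph_subspaces(1)[OF G(1)] isograph_subspaces(1)[OF G'(1)]
      by (simp add: span_eq_iff[THEN iffD2])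
    then show False using G(2,3) G' by fastforce
  qed
  have "snd ` G \<subseteq> S" using G(1) by (auto simp: isograph_def)
  then have "snd ` G = S"
    using isograph_subspaces[OF G(1)] S isograph_dim[OF G(1)] fst
    by (intro subspace_dim_equal) (simp_all add: pv_subspace_imp_real)
  with fst G show ?thesis by blast
qed

lemma ex_unitary_extension:
  assumes S: "pv.subspace S" and G0: "isograph S G0"
  shows "\<exists>U. unitary_pair S U \<and> (\<forall>(a, b)\<in>G0. U a = b)"
proof -
  obtain G where G: "isograph S G" "G0 \<subseteq> G" "fst ` G = S" "snd ` G = S"
    using isograph_total[OF assms] by blast
  define U where "U a = (SOME b. (a, b) \<in> G)" for a
  have UG: "(a, U a) \<in> G" if "a \<in> S" for a
  proof -
    have "\<exists>b. (a, b) \<in> G" using that G(3) by (metis imageE prod.collapse)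
    then show ?thesis unfolding U_def by (rule someI_ex)
  qed
  have Uuniq: "U a = b" if "(a, b) \<in> G" for a b
  proof -
    have "a \<in> S" using that G(3) by force
    from inj_onD[OF isograph_inj(1)[OF G(1)] _ UG[OF this] that] show ?thesis by simp
  qed
  have add: "(a + b, U a + U b) \<in> G" if "a \<in> S" "b \<in> S" for a b
    using isographD(2)[OF G(1) UG[OF that(1)] UG[OF that(2)]] by simp
  have scl: "(psc c a, psc c (U a)) \<in> G" if "a \<in> S" for a c
    using isographD(3)[OF G(1) UG[OF that]] by (simp add: psc2_def)
  have "unitary_pair S U" unfolding unitary_pair_def
  proof (intro conjI ballI allI)
    show mem: "U a \<in> S" if "a \<in> S" for a using UG[OF that] G(4) by force
    show "U ` S = S"
    proof
      show "U ` S \<subseteq> S" using mem by auto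
      show "S \<subseteq> U ` S"
      proof
        fix b assume "b \<in> S"
        then obtain a where "(a, b) \<in> G" using G(4) by (metis imageE prod.collapse)
        then show "b \<in> U ` S" using Uuniq G(3) by (metis fst_conv image_eqI)
      qed
    qed
    show "U (fst a + fst b, snd a + snd b) = (fst (U a) + fst (U b), snd (U a) + snd (U b))"
      if "a \<in> S" "b \<in> S" for a b
      using Uuniq[OF add[OF that]] by (simp add: plus_prod_def)
    show "U (c *s fst a, c *s snd a) = (c *s fst (U a), c *s snd (U a))" if "a \<in> S" for a c
      using Uuniq[OF scl[OF that]] by (simp add: psc_def)
    show "pinner (U a) (U b) = pinner a b" if "a \<in> S" "b \<in> S" for a b
      using isographD(4)[OF G(1) UG[OF that(1)] UG[OF that(2)]] by simp
  qed
  moreover have "U a = b" if "(a, b) \<in> G0" for a b using Uuniq G(2) that by blast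
  ultimately show ?thesis by blast
qed

lemma pv_subspace_Times:
  assumes "csubspace D" "csubspace D'"
  shows "pv.subspace (D \<times> D')"
  unfolding pv.subspace_def using csubspaceD[OF assms(1)] csubspaceD[OF assms(2)]
  by (auto simp: psc_def zero_prod_def)

text \<open>The prescribed map is isometric by commutation: for both pairs the squared norm is that
  of h minus that of the product of the two adjoints applied to h. It therefore extends to a
  unitary, and the infimum over such unitaries is taken over a nonempty set.\<close>

lemma unitaries_U_nonempty:
  fixes T T' :: "'n::finite cmat"
  assumes T: "contraction T" "contraction T'" and comm: "T ** T' = T' ** T"
    and M: "reduces M T" "reduces M T'"
  shows "unitaries_U M T T' \<noteq> {}"
proof -
  note d = defect_add[OF T(1) M(1)] defect_add[OF T(2) M(2)] defect_scale[OF T(1) M(1)] defect_scale[OF T(2) M(2)]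
  note red = reducesD[OF M(1)] reducesD(2,3)[OF M(2)] csubspaceD(1-3)[OF reducesD(1)[OF M(1)]]
  define S where "S = defect_space M T \<times> defect_space M T'"
  have S: "pv.subspace S" unfolding S_def
    by (intro pv_subspace_Times csubspace_defect_space T M)
  define g where "g h = ((defect M T h, defect M T' (cadj T *v h)), (defect M T (cadj T' *v h), defect M T' h))" for h
  have cc: "cadj T *v (cadj T' *v h) = cadj T' *v (cadj T *v h)" for h
    using arg_cong[OF comm, of cadj] by (simp add: cadj_mult matrix_vector_mul_assoc)
  have gadd: "g (x + y) = g x + g y" if "x \<in> M" "y \<in> M" for x y
    using that by (simp add: g_def d red matrix_vector_right_distrib)
  have gsc: "g (c *s x) = psc2 c (g x)" if "x \<in> M" for x c
    using that by (simp add: g_def d red psc2_def psc_def matrix_vector_mult_scale)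
  have "isograph S (g ` M)" unfolding isograph_def
  proof (intro conjI ballI allI)
    show "g ` M \<subseteq> S \<times> S" by (auto simp: g_def S_def defect_space_def red)
    have "g (0 *s 0) = 0" using gsc[of 0 0] red by (simp add: psc2_def psc_def zero_prod_def)
    then show "0 \<in> g ` M" using red by (intro image_eqI[of _ _ 0]) auto
    fix a assume "a \<in> g ` M"
    then obtain x where x: "x \<in> M" "a = g x" by auto
    show "psc2 c a \<in> g ` M" for c using x red by (intro image_eqI[of _ _ "c *s x"]) (auto simp: gsc)
    fix b assume "b \<in> g ` M"
    then obtain y where y: "y \<in> M" "b = g y" by auto
    show "a + b \<in> g ` M" using x y red by (intro image_eqI[of _ _ "x + y"]) (auto simp: gadd)
    show "pinner (fst a) (fst b) = pinner (snd a) (snd b)"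
      using x y red by (simp add: g_def pinner_def cinner_defect T M cc)
  qed
  from ex_unitary_extension[OF S this] obtain U where "unitary_pair S U" "\<forall>(a, b)\<in>g ` M. U a = b" by blast
  then have "U \<in> unitaries_U M T T'" by (auto simp: unitaries_U_def S_def g_def)
  then show ?thesis by blast
qed

subsection \<open>Unitary colligations\<close>

lemma pinner_eqI_on:
  assumes "pv.subspace S" "x \<in> S" "y \<in> S" "\<And>z. z \<in> S \<Longrightarrow> pinner z x = pinner z y"
  shows "x = y"
proof -
  have "pinner (x - y) (x - y) = 0"
    using assms(4)[OF pv.subspace_diff[OF assms(1-3)]] by (simp add: pv.ip_diff_right)
  then show ?thesis using pv.ip_definite[of "x - y"] by simp
qed

text \<open>The adjoint of a unitary is its inverse, obtained here by choosing preimages. It is the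
  only function with the required pairings because it is fixed to be 0 outside
  \<open>S\<close>.\<close>

lemma adj_pair_unitary:
  assumes S: "pv.subspace S" and U: "unitary_pair S U"
  shows adj_pair_mem: "b \<in> S \<Longrightarrow> adj_pair S U b \<in> S"
    and pinner_adj_pair: "\<lbrakk>a \<in> S; b \<in> S\<rbrakk> \<Longrightarrow> pinner (U a) b = pinner a (adj_pair S U b)"
proof -
  define P where "P V \<longleftrightarrow> (\<forall>a. a \<notin> S \<longrightarrow> V a = (0, 0)) \<and> (\<forall>b\<in>S. V b \<in> S) \<and>
      (\<forall>a\<in>S. \<forall>b\<in>S. pinner (U a) b = pinner a (V b))" for V
  have surj: "\<exists>a. a \<in> S \<and> U a = b" if "b \<in> S" for b
  proof -
    have "U ` S = S" using U by (simp add: unitary_pair_def)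
    with that show ?thesis by (metis imageE)
  qed
  define V where "V b = (if b \<in> S then SOME a. a \<in> S \<and> U a = b else (0, 0))" for b
  have V: "V b \<in> S \<and> U (V b) = b" if "b \<in> S" for b
    using someI_ex[OF surj[OF that]] that by (simp add: V_def)
  have iso: "pinner (U a) (U b) = pinner a b" if "a \<in> S" "b \<in> S" for a b
    using U that by (simp add: unitary_pair_def)
  have "pinner (U a) b = pinner a (V b)" if "a \<in> S" "b \<in> S" for a b
    using iso[of a "V b"] V[OF that(2)] that by simp
  then have "P V" using V by (auto simp: P_def V_def)
  moreover have "V' = V" if "P V'" for V'
  proof
    fix b
    show "V' b = V b"
    proof (cases "b \<in> S")
      case True
      then show ?thesis using that \<open>P V\<close> unfolding P_def by (intro pinner_eqI_on[OF S]) auto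
    next
      case False
      then have "V' b = (0, 0)" "V b = (0, 0)" using that \<open>P V\<close> unfolding P_def by blast+
      then show ?thesis by simp
    qed
  qed
  ultimately have "\<exists>!V. P V" by blast
  from theI'[OF this] have "P (adj_pair S U)" unfolding P_def adj_pair_def .
  then show "b \<in> S \<Longrightarrow> adj_pair S U b \<in> S" "\<lbrakk>a \<in> S; b \<in> S\<rbrakk> \<Longrightarrow> pinner (U a) b = pinner a (adj_pair S U b)"
    by (auto simp: P_def)
qed

lemma adj_pair_add:
  assumes S: "pv.subspace S" and U: "unitary_pair S U" and a: "a \<in> S" and b: "b \<in> S"
  shows "adj_pair S U (a + b) = adj_pair S U a + adj_pair S U b"
proof (rule pinner_eqI_on[OF S])
  note adj = pinner_adj_pair[OF S U] and mem = adj_pair_mem[OF S U]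
  have ab: "a + b \<in> S" using pv.subspace_add[OF S a b] .
  show "adj_pair S U (a + b) \<in> S" "adj_pair S U a + adj_pair S U b \<in> S"
    using mem ab a b pv.subspace_add[OF S] by auto
  show "pinner z (adj_pair S U (a + b)) = pinner z (adj_pair S U a + adj_pair S U b)" if "z \<in> S" for z
    using that ab a b by (simp add: adj[symmetric] pv.ip_add_right)
qed

lemma adj_pair_isometric:
  assumes S: "pv.subspace S" and U: "unitary_pair S U" and b: "b \<in> S"
  shows "pinner (adj_pair S U b) (adj_pair S U b) = pinner b b"
proof -
  have "U ` S = S" using U by (simp add: unitary_pair_def)
  with b obtain a where a: "a \<in> S" "b = U a" by (metis imageE)
  have iso: "pinner (U a) (U b) = pinner a b" if "a \<in> S" "b \<in> S" for a b
    using U that by (simp add: unitary_pair_def)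
  have "adj_pair S U b = a"
  proof (rule pinner_eqI_on[OF S adj_pair_mem[OF S U b] a(1)])
    fix z assume z: "z \<in> S"
    show "pinner z (adj_pair S U b) = pinner z a"
      using pinner_adj_pair[OF S U z b] iso[OF z a(1)] a by simp
  qed
  then show ?thesis using iso[OF a(1) a(1)] a by simp
qed

text \<open>The state sequence of the unitary colligation \<open>V = U\<^sup>*\<close> driven by the input \<open>f\<close>; the
  multiplication operator by the transfer function is its input-output map.\<close>

primrec state :: "('n::finite cvec \<times> 'n cvec \<Rightarrow> 'n cvec \<times> 'n cvec) \<Rightarrow> (nat \<Rightarrow> 'n cvec) \<Rightarrow> nat \<Rightarrow> 'n cvec" where
  "state V f 0 = 0"
| "state V f (Suc k) = snd (V (f k, state V f k))"

locale colligation =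
  fixes D D' :: "'n::finite cvec set" and U
  assumes D: "csubspace D" "csubspace D'" and U: "unitary_pair (D \<times> D') U"
begin

abbreviation "V \<equiv> adj_pair (D \<times> D') U"

lemmas S = pv_subspace_Times[OF D]

lemma V_mem: "\<lbrakk>x \<in> D; y \<in> D'\<rbrakk> \<Longrightarrow> fst (V (x, y)) \<in> D" "\<lbrakk>x \<in> D; y \<in> D'\<rbrakk> \<Longrightarrow> snd (V (x, y)) \<in> D'"
  using adj_pair_mem[OF S U, of "(x, y)"] by (auto simp: mem_Times_iff)

lemma V_split: "\<lbrakk>x \<in> D; y \<in> D'\<rbrakk> \<Longrightarrow> V (x, y) = V (x, 0) + V (0, y)"
  using adj_pair_add[OF S U, of "(x, 0)" "(0, y)"] csubspaceD(1)[OF D(1)] csubspaceD(1)[OF D(2)] by simp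

lemma V_add_snd: "\<lbrakk>x \<in> D'; y \<in> D'\<rbrakk> \<Longrightarrow> V (0, x + y) = V (0, x) + V (0, y)"
  using adj_pair_add[OF S U, of "(0, x)" "(0, y)"] csubspaceD(1)[OF D(1)] by simp

lemma V_zero: "V (0, 0) = 0"
  using V_add_snd[of 0 0] csubspaceD(1)[OF D(2)] by (simp add: zero_prod_def[symmetric])

lemma V_sum_snd:
  assumes "\<And>i. i \<in> I \<Longrightarrow> g i \<in> D'"
  shows "V (0, sum g I) = (\<Sum>i\<in>I. V (0, g i))"
  using assms
proof (induction I rule: infinite_finite_induct)
  case (insert i I)
  then have "sum g I \<in> D'" by (intro csubspaceD(5)[OF D(2)]) auto
  with insert show ?case by (simp add: V_add_snd)
qed (simp_all add: V_zero)

lemma state_mem: "(\<And>k. f k \<in> D) \<Longrightarrow> state V f k \<in> D'"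
  by (induction k) (auto simp: csubspaceD(1)[OF D(2)] V_mem)

text \<open>Unrolled recurrence: the input at time k - 1 - j enters the state through B* and then
  passes j times through D*, in the block notation for U*.\<close>

lemma state_eq_sum:
  assumes f: "\<And>k. f k \<in> D"
  shows "state V f k = (\<Sum>j<k. ((\<lambda>y. snd (V (0, y))) ^^ j) (snd (V (f (k - 1 - j), 0))))"
proof (induction k)
  case (Suc k)
  define d where "d = (\<lambda>y. snd (V (0, y)))"
  have d: "(d ^^ j) (snd (V (f i, 0))) \<in> D'" for i j
    using f csubspaceD(1)[OF D(1)] csubspaceD(1)[OF D(2)]
    by (intro funpow_mem) (auto simp: d_def V_mem)
  have "state V f (Suc k) = snd (V (f k, 0)) + snd (V (0, state V f k))"
    using V_split[OF f state_mem, of f] f by simp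
  also have "snd (V (0, state V f k)) = (\<Sum>j<k. (d ^^ Suc j) (snd (V (f (k - 1 - j), 0))))"
    using d by (subst Suc, subst V_sum_snd) (auto simp: d_def snd_sum)
  also have "snd (V (f k, 0)) + \<dots> = (\<Sum>j<Suc k. (d ^^ j) (snd (V (f (k - j), 0))))"
    by (subst sum.lessThan_Suc_shift) simp
  finally show ?case by (simp add: d_def)
qed simp

text \<open>Since V (x, y) = (A* x + C* y, B* x + D* y), the zeroth Taylor coefficient A* acts on
  the present input, and the coefficients of index j + 1 collect what C* reads off from the state.
  The convolution thus becomes one application of the unitary V at each time.\<close>

lemma phi_S_eq_output:
  assumes f: "\<And>k. f k \<in> D"
  shows "phi_S (D \<times> D') U f k = fst (V (f k, state V f k))"
proof -
  define d where "d = (\<lambda>y. snd (V (0, y)))"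
  have d: "(d ^^ j) (snd (V (f i, 0))) \<in> D'" for i j
    using f csubspaceD(1)[OF D(1)] csubspaceD(1)[OF D(2)]
    by (intro funpow_mem) (auto simp: d_def V_mem)
  have "phi_S (D \<times> D') U f k = (\<Sum>j<Suc k. transfer_coeff (D \<times> D') U j (f (k - j)))"
    by (simp add: phi_S_def lessThan_Suc_atMost)
  also have "\<dots> = fst (V (f k, 0)) + (\<Sum>j<k. fst (V (0, (d ^^ j) (snd (V (f (k - 1 - j), 0))))))"
    by (subst sum.lessThan_Suc_shift) (simp add: transfer_coeff_def d_def Let_def)
  also have "(\<Sum>j<k. fst (V (0, (d ^^ j) (snd (V (f (k - 1 - j), 0)))))) = fst (V (0, state V f k))"
    using d by (subst state_eq_sum[OF f], subst V_sum_snd) (auto simp: d_def fst_sum)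
  finally show ?thesis using V_split[OF f state_mem, of f] f by simp
qed

text \<open>V preserves the norm of (input, state) when passing to (output, next state). Summation
  over time telescopes, starting from the state 0.\<close>

lemma energy_balance:
  assumes f: "\<And>k. f k \<in> D"
  shows "(\<Sum>k<n. (norm (phi_S (D \<times> D') U f k))\<^sup>2) + (norm (state V f n))\<^sup>2 = (\<Sum>k<n. (norm (f k))\<^sup>2)"
proof (induction n)
  case (Suc n)
  have "pinner (V (f n, state V f n)) (V (f n, state V f n)) = pinner (f n, state V f n) (f n, state V f n)"
    using f state_mem[of f] by (intro adj_pair_isometric[OF S U]) auto
  then have "(norm (phi_S (D \<times> D') U f n))\<^sup>2 + (norm (state V f (Suc n)))\<^sup>2
      = (norm (f n))\<^sup>2 + (norm (state V f n))\<^sup>2"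
    by (simp only: pinner_def cinner_self fst_conv snd_conv phi_S_eq_output[OF f] state.simps
        of_real_add[symmetric] of_real_eq_iff)
  then show ?case using Suc by simp
qed simp

end

text \<open>The identity <V b, a> = <b, U a> for b = (input, state) and for the vector a on which
  the action of \<open>U\<close> is prescribed. The state terms on the two sides belong to
  consecutive times and to T* h and h, so they telescope when h runs through the powers of T*
  applied to a fixed vector.\<close>

lemma transfer_adjoint_step:
  fixes T T' :: "'n::finite cmat"
  assumes T: "contraction T" "contraction T'" and M: "reduces M T" "reduces M T'"
    and U: "U \<in> unitaries_U M T T'" and h: "h \<in> M"
    and f: "\<And>k. f k \<in> defect_space M T"
  defines "S \<equiv> defect_space M T \<times> defect_space M T'"
  shows "cinner (phi_S S U f k) (defect M T h) + cinner (state (adj_pair S U) f (Suc k)) (defect M T' (cadj T *v h))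
    = cinner (f k) (defect M T (cadj T' *v h)) + cinner (state (adj_pair S U) f k) (defect M T' h)"
proof -
  interpret colligation "defect_space M T" "defect_space M T'" U
    by unfold_locales (use U in \<open>auto intro!: csubspace_defect_space T M simp: unitaries_U_def\<close>)
  define a where "a = (defect M T h, defect M T' (cadj T *v h))"
  define b where "b = (f k, state V f k)"
  have a: "a \<in> S" using h reducesD(3)[OF M(1)] by (auto simp: a_def S_def defect_space_def)
  have b: "b \<in> S" using f state_mem[of f] by (auto simp: b_def S_def)
  have "pinner (U a) b = pinner a (V b)"
    using pinner_adj_pair[OF local.S U] a b by (simp add: S_def)
  then have "pinner (V b) a = pinner b (U a)"
    using pv.ip_cnj[of a "V b"] pv.ip_cnj[of "U a" b] by simp
  moreover have "U a = (defect M T (cadj T' *v h), defect M T' h)"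
    using assms(5) h by (auto simp: unitaries_U_def a_def)
  ultimately show ?thesis
    using phi_S_eq_output[OF f] by (simp add: a_def b_def pinner_def S_def)
qed

subsection \<open>Square-summable sequences\<close>

text \<open>One development for both kinds of sequences: the fibre C yields \<open>H2\<close>, the
  fibre C^n yields \<open>H2V UNIV\<close>.\<close>

locale fibre = cips sc UNIV ip for sc :: "complex \<Rightarrow> 'a::real_normed_vector \<Rightarrow> 'a" and ip +
  assumes ip_norm: "ip x x = complex_of_real ((norm x)\<^sup>2)"
begin

lemma cmod_ip_le: "cmod (ip x y) \<le> norm x * norm y"
  using cauchy_schwarz[of x y] by (simp add: nrm_def ip_norm)

lemma norm_sc: "norm (sc c x) = cmod c * norm x"
  using nrm_sc[of x c] by (simp add: nrm_def ip_norm)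

lemma summable_ip:
  assumes f: "summable (\<lambda>k. (norm (f k))\<^sup>2)" and g: "summable (\<lambda>k. (norm (g k))\<^sup>2)"
  shows "summable (\<lambda>k. ip (f k) (g k))"
proof (rule summable_comparison_test'[OF summable_add[OF f g], of 0])
  fix k
  have "norm (ip (f k) (g k)) \<le> norm (f k) * norm (g k)" by (rule cmod_ip_le)
  also have "\<dots> \<le> (norm (f k))\<^sup>2 + (norm (g k))\<^sup>2"
    using sum_squares_bound[of "norm (f k)" "norm (g k)"] mult_nonneg_nonneg[OF norm_ge_zero norm_ge_zero, of "f k" "g k"]
    unfolding mult.assoc by linarith
  finally show "norm (ip (f k) (g k)) \<le> (norm (f k))\<^sup>2 + (norm (g k))\<^sup>2" .
qed

lemma cips_sequences:
  "cips (\<lambda>c f k. sc c (f k)) {f. summable (\<lambda>k. (norm (f k))\<^sup>2)} (\<lambda>f g. \<Sum>k. ip (f k) (g k))"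
proof (intro cips.intro cips_axioms.intro)
  show vs: "vector_space (\<lambda>c (f :: nat \<Rightarrow> 'a) k. sc c (f k))"
    by unfold_locales (auto simp: fun_eq_iff scale_left_distrib scale_right_distrib)
  interpret S: vector_space "\<lambda>c (f :: nat \<Rightarrow> 'a) k. sc c (f k)" by (rule vs)
  show "S.subspace {f. summable (\<lambda>k. (norm (f k))\<^sup>2)}"
    unfolding S.subspace_def
  proof (intro conjI ballI allI)
    fix f :: "nat \<Rightarrow> 'a" assume f: "f \<in> {f. summable (\<lambda>k. (norm (f k))\<^sup>2)}"
    show "(\<lambda>k. sc c (f k)) \<in> {f. summable (\<lambda>k. (norm (f k))\<^sup>2)}" for c
      using f by (simp add: norm_sc power_mult_distrib summable_mult)
    fix g :: "nat \<Rightarrow> 'a" assume g: "g \<in> {f. summable (\<lambda>k. (norm (f k))\<^sup>2)}"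
    show "f + g \<in> {f. summable (\<lambda>k. (norm (f k))\<^sup>2)}"
    proof (rule CollectI, rule summable_comparison_test')
      show "summable (\<lambda>k. 2 * ((norm (f k))\<^sup>2 + (norm (g k))\<^sup>2))"
        using f g by (intro summable_mult summable_add) auto
      fix k :: nat
      have "(norm (f k + g k))\<^sup>2 \<le> (norm (f k) + norm (g k))\<^sup>2"
        by (intro power_mono norm_triangle_ineq) auto
      also have "\<dots> \<le> 2 * ((norm (f k))\<^sup>2 + (norm (g k))\<^sup>2)"
        using sum_squares_bound[of "norm (f k)" "norm (g k)"] by (simp add: power2_sum)
      finally show "norm ((norm ((f + g) k))\<^sup>2) \<le> 2 * ((norm (f k))\<^sup>2 + (norm (g k))\<^sup>2)" by simp
    qed
  qed simp
next
  fix f :: "nat \<Rightarrow> 'a" assume f: "f \<in> {f. summable (\<lambda>k. (norm (f k))\<^sup>2)}"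
  then have f': "summable (\<lambda>k. complex_of_real ((norm (f k))\<^sup>2))" by (simp only: mem_Collect_eq summable_of_real)
  have ff: "(\<Sum>k. ip (f k) (f k)) = complex_of_real (\<Sum>k. (norm (f k))\<^sup>2)"
    using f by (simp only: ip_norm mem_Collect_eq suminf_of_real[symmetric])
  show "0 \<le> Re (\<Sum>k. ip (f k) (f k))" using f by (simp only: ff Re_complex_of_real) (simp add: suminf_nonneg)
  show "f = 0" if "(\<Sum>k. ip (f k) (f k)) = 0"
  proof -
    have "(\<Sum>k. (norm (f k))\<^sup>2) = 0" using that by (simp only: ff of_real_eq_0_iff)
    then have "\<forall>k. (norm (f k))\<^sup>2 = 0" using f by (subst (asm) suminf_eq_zero_iff) auto
    then show ?thesis by (simp add: fun_eq_iff)
  qed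
  fix g :: "nat \<Rightarrow> 'a" assume g: "g \<in> {f. summable (\<lambda>k. (norm (f k))\<^sup>2)}"
  have fg: "summable (\<lambda>k. ip (f k) (g k))" using f g summable_ip by blast
  show "(\<Sum>k. ip (sc c (f k)) (g k)) = c * (\<Sum>k. ip (f k) (g k))" for c
    using suminf_mult[OF fg, of c] by (simp add: ip_sc)
  show "cnj (\<Sum>k. ip (f k) (g k)) = (\<Sum>k. ip (g k) (f k))"
    using bounded_linear.suminf[OF bounded_linear_cnj fg] by (simp add: ip_cnj)
  fix h :: "nat \<Rightarrow> 'a" assume h: "h \<in> {f. summable (\<lambda>k. (norm (f k))\<^sup>2)}"
  have "summable (\<lambda>k. ip (f k) (h k))" "summable (\<lambda>k. ip (g k) (h k))" using f g h summable_ip by blast+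
  then show "(\<Sum>k. ip ((f + g) k) (h k)) = (\<Sum>k. ip (f k) (h k)) + (\<Sum>k. ip (g k) (h k))"
    by (simp add: ip_add suminf_add)
qed

lemma suminf_ip_shift:
  assumes f: "summable (\<lambda>k. (norm (f k))\<^sup>2)" and g: "summable (\<lambda>k. (norm (g k))\<^sup>2)"
  shows "(\<Sum>k. ip (shift f k) (g k)) = (\<Sum>k. ip (f k) (g (Suc k)))"
proof -
  have s: "shift f (Suc k) = f k" "shift f 0 = 0" for k by (simp_all add: shift_def)
  have "summable (\<lambda>k. (norm (g (Suc k)))\<^sup>2)" using g by (subst summable_Suc_iff)
  then have "summable (\<lambda>k. ip (f k) (g (Suc k)))" by (rule summable_ip[OF f])
  then have "summable (\<lambda>k. ip (shift f (Suc k)) (g (Suc k)))" by (simp add: s)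
  then have "summable (\<lambda>k. ip (shift f k) (g k))" by (subst (asm) summable_Suc_iff)
  from suminf_split_head[OF this] show ?thesis by (simp add: s ip_zero)
qed

end

lemma shift_sums:
  fixes f :: "nat \<Rightarrow> 'a::real_normed_vector"
  assumes f: "summable (\<lambda>k. (norm (f k))\<^sup>2)"
  shows "summable (\<lambda>k. (norm (shift f k))\<^sup>2)" "(\<Sum>k. (norm (shift f k))\<^sup>2) = (\<Sum>k. (norm (f k))\<^sup>2)"
proof -
  have s: "shift f (Suc k) = f k" "shift f 0 = 0" for k by (simp_all add: shift_def)
  have "summable (\<lambda>k. (norm (shift f (Suc k)))\<^sup>2)" using f by (simp add: s)
  then show *: "summable (\<lambda>k. (norm (shift f k))\<^sup>2)" by (subst (asm) summable_Suc_iff)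
  from suminf_split_head[OF this] show "(\<Sum>k. (norm (shift f k))\<^sup>2) = (\<Sum>k. (norm (f k))\<^sup>2)" by (simp add: s)
qed

interpretation fs: fibre "(*)" "\<lambda>x y. x * cnj y"
  by unfold_locales (auto simp: algebra_simps complex_norm_square[symmetric])

interpretation fv: fibre "(*s)" "cinner :: 'n::finite cvec \<Rightarrow> 'n cvec \<Rightarrow> complex"
  by unfold_locales (simp add: cinner_self)

interpretation s2: cips "\<lambda>c f k. c * f k" H2 l2inner
  using fs.cips_sequences unfolding H2_def l2inner_def[abs_def] .

interpretation v2: cips "\<lambda>c (f :: nat \<Rightarrow> 'n::finite cvec) k. c *s f k" "H2V UNIV" vinner
  using fv.cips_sequences unfolding H2V_def vinner_def[abs_def] by simp

lemma s2_nrm: "f \<in> H2 \<Longrightarrow> s2.nrm f = l2norm f"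
  unfolding s2.nrm_def l2norm_def l2inner_def H2_def complex_norm_square[symmetric]
  by (simp only: mem_Collect_eq suminf_of_real[symmetric] Re_complex_of_real)

lemma v2_nrm: "f \<in> H2V UNIV \<Longrightarrow> v2.nrm f = vnorm f"
  unfolding v2.nrm_def vnorm_def vinner_def H2V_def cinner_self
  by (simp only: mem_Collect_eq suminf_of_real[symmetric] Re_complex_of_real)

lemma s2_proj: "s2.proj = l2proj"
  by (simp add: fun_eq_iff s2.proj_def l2proj_def fun_diff_def)

lemma v2_proj: "v2.proj = vproj"
  by (simp add: fun_eq_iff v2.proj_def vproj_def fun_diff_def)

lemma shift_H2: "f \<in> H2 \<Longrightarrow> shift f \<in> H2" "f \<in> H2 \<Longrightarrow> s2.nrm (shift f) = s2.nrm f"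
  using shift_sums[of f] by (simp_all add: s2_nrm l2norm_def) (simp_all add: H2_def s2_nrm l2norm_def)

lemma shift_H2V: "f \<in> H2V D \<Longrightarrow> shift f \<in> H2V UNIV" "f \<in> H2V UNIV \<Longrightarrow> v2.nrm (shift f) = v2.nrm f"
proof -
  show *: "shift f \<in> H2V UNIV" if "f \<in> H2V D" for D using shift_sums[of f] that by (simp add: H2V_def)
  show "v2.nrm (shift f) = v2.nrm f" if "f \<in> H2V UNIV"
    using *[OF that] shift_sums[of f] that by (simp add: v2_nrm vnorm_def) (simp add: H2V_def)
qed

lemma l2inner_shift: "\<lbrakk>f \<in> H2; g \<in> H2\<rbrakk> \<Longrightarrow> l2inner (shift f) g = l2inner f (\<lambda>k. g (Suc k))"
  using fs.suminf_ip_shift by (simp add: l2inner_def H2_def)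

lemma vinner_shift: "\<lbrakk>f \<in> H2V UNIV; g \<in> H2V UNIV\<rbrakk> \<Longrightarrow> vinner (shift f) g = vinner f (\<lambda>k. g (Suc k))"
  using fv.suminf_ip_shift by (simp add: vinner_def H2V_def)

lemma H2_Suc: "f \<in> H2 \<Longrightarrow> (\<lambda>k. f (Suc k)) \<in> H2"
  unfolding H2_def mem_Collect_eq by (subst summable_Suc_iff)

text \<open>The adjoint of the multiplication by the polynomial \<open>q\<close> on \<open>H\<^sup>2\<close>.\<close>

definition bshift :: "complex poly \<Rightarrow> (nat \<Rightarrow> complex) \<Rightarrow> nat \<Rightarrow> complex" where
  "bshift q f k = (\<Sum>i\<le>degree q. cnj (coeff q i) * f (k + i))"

lemma bshift_pCons: "bshift (pCons a q) f = (\<lambda>k. cnj a * f k) + bshift q (\<lambda>k. f (Suc k))"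
proof
  fix k
  have "bshift (pCons a q) f k = (\<Sum>i\<le>Suc (degree q). cnj (coeff (pCons a q) i) * f (k + i))"
    unfolding bshift_def by (rule sum.mono_neutral_left) (auto simp: degree_pCons_le coeff_eq_0 intro: order_trans)
  also have "\<dots> = cnj a * f k + bshift q (\<lambda>k. f (Suc k)) k"
    unfolding bshift_def by (subst sum.atMost_Suc_shift) simp
  finally show "bshift (pCons a q) f k = ((\<lambda>k. cnj a * f k) + bshift q (\<lambda>k. f (Suc k))) k" by simp
qed

lemma bshift_0: "bshift 0 f = 0"
  by (simp add: bshift_def fun_eq_iff)

lemma bshift_H2: "f \<in> H2 \<Longrightarrow> bshift q f \<in> H2"
proof (induction q arbitrary: f)
  case 0
  show ?case unfolding bshift_0 by (rule s2.H_closed(1))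
next
  case (pCons a q)
  show ?case unfolding bshift_pCons
    by (rule s2.H_closed(2)[OF s2.H_closed(4)[OF pCons.prems] pCons.IH[OF H2_Suc[OF pCons.prems]]])
qed

section \<open>Multiplication by polynomials and by inverses of linear factors on H^2\<close>

lemma fps_nth_pCons_mult:
  fixes u :: "complex fps"
  shows
  "fps_nth (fps_of_poly (pCons a q) * u) = (\<lambda>k. a * fps_nth u k) + shift (fps_nth (fps_of_poly q * u))"
proof
  fix k
  have "fps_of_poly (pCons a q) * u = fps_const a * u + fps_X * (fps_of_poly q * u)"
    by (simp only: fps_of_poly_pCons algebra_simps)
  then show "fps_nth (fps_of_poly (pCons a q) * u) k = ((\<lambda>k. a * fps_nth u k) + shift (fps_nth (fps_of_poly q * u))) k"
    by (simp add: shift_def split: nat.split)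
qed

lemma H2_poly_mult: "fps_nth u \<in> H2 \<Longrightarrow> fps_nth (fps_of_poly q * u) \<in> H2"
proof (induction q)
  case 0
  have "fps_nth (fps_of_poly 0 * u) = 0" by (simp add: fun_eq_iff)
  then show ?case using s2.H_closed(1) by (simp only:)
next
  case (pCons a q)
  show ?case unfolding fps_nth_pCons_mult
    by (rule s2.H_closed(2)[OF s2.H_closed(4)[OF pCons.prems] shift_H2(1)[OF pCons.IH[OF pCons.prems]]])
qed

lemma l2inner_poly_mult:
  assumes u: "fps_nth u \<in> H2"
  shows "f \<in> H2 \<Longrightarrow> l2inner f (fps_nth (fps_of_poly q * u)) = l2inner (bshift q f) (fps_nth u)"
proof (induction q arbitrary: f)
  case 0
  have "fps_nth (fps_of_poly 0 * u) = 0" by (simp add: fun_eq_iff)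
  then show ?case using u 0 by (simp only: s2.ip_zero bshift_0)
next
  case (pCons a q)
  note f = pCons.prems
  have qu: "fps_nth (fps_of_poly q * u) \<in> H2" by (rule H2_poly_mult[OF u])
  have sh: "l2inner f (shift (fps_nth (fps_of_poly q * u))) = l2inner (\<lambda>k. f (Suc k)) (fps_nth (fps_of_poly q * u))"
  proof -
    have "l2inner f (shift (fps_nth (fps_of_poly q * u))) = cnj (l2inner (shift (fps_nth (fps_of_poly q * u))) f)"
      using f qu by (simp add: s2.ip_cnj shift_H2)
    also have "\<dots> = l2inner (\<lambda>k. f (Suc k)) (fps_nth (fps_of_poly q * u))"
      using f qu by (simp add: l2inner_shift s2.ip_cnj H2_Suc)
    finally show ?thesis .
  qed
  have "l2inner f (fps_nth (fps_of_poly (pCons a q) * u))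
      = cnj a * l2inner f (fps_nth u) + l2inner f (shift (fps_nth (fps_of_poly q * u)))"
    unfolding fps_nth_pCons_mult using f u qu
    by (simp add: s2.ip_add_right s2.H_closed(4) s2.ip_sc_right shift_H2)
  also have "\<dots> = cnj a * l2inner f (fps_nth u) + l2inner (bshift q (\<lambda>k. f (Suc k))) (fps_nth u)"
    unfolding sh by (subst pCons.IH) (auto simp: H2_Suc f)
  also have "\<dots> = l2inner (bshift (pCons a q) f) (fps_nth u)"
    unfolding bshift_pCons using f u by (simp add: s2.ip_add s2.H_closed(4) s2.ip_sc bshift_H2 H2_Suc)
  finally show ?case .
qed

text \<open>The coefficients of w = u / (1 - a z) satisfy w_(k+1) = a w_k + u_(k+1). Convexity turns
  this into an inequality for squares in which w_k carries the factor |a| < 1.\<close>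

lemma H2_geometric_mult:
  assumes a: "cmod a < 1" and u: "fps_nth u \<in> H2"
  shows "fps_nth (inverse (fps_of_poly [:1, - a:]) * u) \<in> H2"
proof -
  define w where "w = inverse (fps_of_poly [:1, - a:]) * u"
  define t where "t = cmod a"
  have t: "0 \<le> t" "t < 1" using a by (auto simp: t_def)
  have "fps_of_poly [:1, - a:] * w = u" unfolding w_def mult.assoc[symmetric]
    by (subst inverse_mult_eq_1') (auto simp: fps_of_poly_pCons)
  then have "u = w - fps_const a * fps_X * w" by (auto simp: fps_of_poly_pCons algebra_simps simp flip: fps_const_neg)
  then have u_eq: "fps_nth u k = fps_nth w k - a * fps_nth (fps_X * w) k" for k by (simp add: mult.assoc)
  have w0: "fps_nth w 0 = fps_nth u 0" using u_eq[of 0] by simp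
  have wS: "fps_nth w (Suc k) = a * fps_nth w k + fps_nth u (Suc k)" for k using u_eq[of "Suc k"] by simp
  define W where "W n = (\<Sum>k<n. (cmod (fps_nth w k))\<^sup>2)" for n
  define Y where "Y = (\<Sum>k. (cmod (fps_nth u k))\<^sup>2)"
  have su: "summable (\<lambda>k. (cmod (fps_nth u k))\<^sup>2)" using u by (simp add: H2_def)
  \<comment> \<open>convexity of the square: \<open>(t x + y)\<^sup>2 \<le> t x\<^sup>2 + y\<^sup>2 / (1 - t)\<close>\<close>
  have conv: "(t * x + y)\<^sup>2 \<le> t * x\<^sup>2 + y\<^sup>2 / (1 - t)" for x y :: real
  proof -
    have "t * x\<^sup>2 + y\<^sup>2 / (1 - t) - (t * x + y)\<^sup>2 = t / (1 - t) * ((1 - t) * x - y)\<^sup>2"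
      using t by (simp add: field_simps power2_eq_square)
    moreover have "0 \<le> t / (1 - t) * ((1 - t) * x - y)\<^sup>2" using t by simp
    ultimately show ?thesis by linarith
  qed
  have step: "(cmod (fps_nth w (Suc k)))\<^sup>2 \<le> t * (cmod (fps_nth w k))\<^sup>2 + (cmod (fps_nth u (Suc k)))\<^sup>2 / (1 - t)" for k
  proof -
    have "cmod (fps_nth w (Suc k)) \<le> t * cmod (fps_nth w k) + cmod (fps_nth u (Suc k))"
      unfolding wS t_def by (metis norm_mult norm_triangle_ineq)
    then have "(cmod (fps_nth w (Suc k)))\<^sup>2 \<le> (t * cmod (fps_nth w k) + cmod (fps_nth u (Suc k)))\<^sup>2"
      by (intro power_mono) auto
    also note conv
    finally show ?thesis .
  qed
  \<comment> \<open>The partial sum occurs on both sides, on the right with the factor t < 1.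
    Solving for it gives a bound independent of n.\<close>
  have bound: "W n \<le> Y / (1 - t) + t * W n" for n
  proof (cases n)
    case 0
    then show ?thesis using t suminf_nonneg[OF su] by (simp add: W_def Y_def)
  next
    case (Suc m)
    have "W n = (cmod (fps_nth u 0))\<^sup>2 + (\<Sum>k<m. (cmod (fps_nth w (Suc k)))\<^sup>2)"
      unfolding W_def Suc by (subst sum.lessThan_Suc_shift) (simp add: w0)
    also have "\<dots> \<le> (cmod (fps_nth u 0))\<^sup>2 / (1 - t) + (\<Sum>k<m. t * (cmod (fps_nth w k))\<^sup>2 + (cmod (fps_nth u (Suc k)))\<^sup>2 / (1 - t))"
      using t by (intro add_mono sum_mono step) (simp add: field_simps)
    also have "\<dots> = (\<Sum>k<Suc m. (cmod (fps_nth u k))\<^sup>2) / (1 - t) + t * W m"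
      by (subst sum.lessThan_Suc_shift)
        (simp add: W_def sum.distrib sum_distrib_left sum_divide_distrib add_divide_distrib)
    also have "\<dots> \<le> Y / (1 - t) + t * W n"
    proof (intro add_mono divide_right_mono mult_left_mono)
      show "(\<Sum>k<Suc m. (cmod (fps_nth u k))\<^sup>2) \<le> Y" unfolding Y_def by (rule sum_le_suminf[OF su]) auto
      show "W m \<le> W n" unfolding W_def Suc by (rule sum_mono2) auto
    qed (use t in auto)
    finally show ?thesis .
  qed
  have "W n \<le> Y / (1 - t) / (1 - t)" for n
  proof -
    have "W n * (1 - t) \<le> Y / (1 - t)" using bound[of n] by (simp add: algebra_simps)
    then show ?thesis using t by (simp add: pos_le_divide_eq)
  qed
  then have "summable (\<lambda>k. (cmod (fps_nth w k))\<^sup>2)"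
    unfolding W_def by (intro summableI_nonneg_bounded) auto
  then show ?thesis by (simp add: H2_def w_def)
qed

lemma H2_geometric_power_mult:
  assumes a: "cmod a < 1" and u: "fps_nth u \<in> H2"
  shows "fps_nth (inverse (fps_of_poly [:1, - a:]) ^ n * u) \<in> H2"
  by (induction n) (auto simp: u mult.assoc intro!: H2_geometric_mult[OF a])

lemma H2_fps_X_power: "fps_nth (fps_X ^ k) \<in> H2"
proof -
  have "summable (\<lambda>n. (cmod (fps_nth (fps_X ^ k) n))\<^sup>2)"
    by (rule summable_finite[of "{k}"]) (auto simp: fps_X_power_nth)
  then show ?thesis by (simp add: H2_def)
qed

lemma l2inner_fps_X_power: "l2inner f (fps_nth (fps_X ^ k)) = f k"
proof -
  have "l2inner f (fps_nth (fps_X ^ k)) = (\<Sum>n\<in>{k}. f n * cnj (fps_nth (fps_X ^ k) n))"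
    unfolding l2inner_def by (rule suminf_finite) (auto simp: fps_X_power_nth)
  then show ?thesis by (simp add: fps_X_power_nth)
qed

subsection \<open>Model spaces and the isometric dilation\<close>

text \<open>Numerators and denominators of the Blaschke factors are separated: r is the inverse of
  the polynomial W. When the zeros lie in the disc both r and W preserve H^2, so b_T may be replaced
  by the minimal polynomial in the description of the model space.\<close>

lemma blaschke_fps_factorization:
  obtains r W where "blaschke_fps M T = fps_of_poly (minpoly_on M T) * r" "r * fps_of_poly W = 1"
    "\<And>u. \<lbrakk>\<And>l. poly (minpoly_on M T) l = 0 \<Longrightarrow> cmod l < 1; fps_nth u \<in> H2\<rbrakk> \<Longrightarrow> fps_nth (r * u) \<in> H2"
proof -
  define m where "m = minpoly_on M T"
  define Z where "Z = {z. poly m z = 0}"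
  define r where "r = (\<Prod>l\<in>Z. inverse (fps_of_poly [:1, - cnj l:]) ^ order l m)"
  define W where "W = (\<Prod>l\<in>Z. [:1, - cnj l:] ^ order l m)"
  have lc: "lead_coeff m = 1" unfolding m_def by (rule lead_coeff_minpoly)
  then have Z: "finite Z" unfolding Z_def by (intro poly_roots_finite) auto
  have m: "(\<Prod>l\<in>Z. [:- l, 1:] ^ order l m) = m"
    using complex_poly_decompose[of m] unfolding lc Z_def by simp
  have "blaschke_fps M T = (\<Prod>l\<in>Z. fps_of_poly [:- l, 1:] ^ order l m) * r"
    by (simp only: blaschke_fps_def Let_def m_def[symmetric] Z_def[symmetric] power_mult_distrib prod.distrib r_def)
  also have "(\<Prod>l\<in>Z. fps_of_poly [:- l, 1:] ^ order l m) = fps_of_poly m"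
    by (subst (2) m[symmetric]) (simp only: fps_of_poly_prod fps_of_poly_power)
  finally have 1: "blaschke_fps M T = fps_of_poly (minpoly_on M T) * r" by (simp add: m_def)
  have "r * fps_of_poly W = (\<Prod>l\<in>Z. (inverse (fps_of_poly [:1, - cnj l:]) * fps_of_poly [:1, - cnj l:]) ^ order l m)"
    by (simp only: r_def W_def fps_of_poly_prod fps_of_poly_power prod.distrib power_mult_distrib)
  also have "\<dots> = 1"
    by (intro prod.neutral ballI) (subst inverse_mult_eq_1, auto simp: fps_of_poly_pCons)
  finally have 2: "r * fps_of_poly W = 1" .
  have 3: "fps_nth (r * u) \<in> H2"
    if d: "\<And>l. poly (minpoly_on M T) l = 0 \<Longrightarrow> cmod l < 1" and u: "fps_nth u \<in> H2" for u
  proof -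
    have "fps_nth ((\<Prod>l\<in>F. inverse (fps_of_poly [:1, - cnj l:]) ^ order l m) * u) \<in> H2" if "F \<subseteq> Z" for F
      using finite_subset[OF that Z] that
    proof (induction F rule: finite_induct)
      case (insert l F)
      then have "cmod (cnj l) < 1" using d by (simp add: Z_def m_def)
      from H2_geometric_power_mult[OF this] insert show ?case by (simp add: mult.assoc)
    qed (simp add: u)
    then show ?thesis unfolding r_def by blast
  qed
  show thesis by (rule that[OF 1 2 3])
qed

lemma model_space_recurrence:
  assumes f: "f \<in> model_space M T"
  shows "bshift (minpoly_on M T) f k = 0"
proof -
  obtain r W where rW: "blaschke_fps M T = fps_of_poly (minpoly_on M T) * r" "r * fps_of_poly W = 1"
    using blaschke_fps_factorization by metis
  \<comment> \<open>The factor W cancels the denominators of b, so that b g is the minimal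
    polynomial times z^k. Orthogonality to it says that coefficient k of the adjoint multiplication
    applied to f is 0.\<close>
  define g where "g = fps_of_poly W * fps_X ^ k"
  have g: "fps_nth g \<in> H2" unfolding g_def by (rule H2_poly_mult[OF H2_fps_X_power])
  have "blaschke_fps M T * g = fps_of_poly (minpoly_on M T) * (r * fps_of_poly W) * fps_X ^ k"
    by (simp only: rW(1) g_def mult_ac)
  then have bg: "blaschke_fps M T * g = fps_of_poly (minpoly_on M T) * fps_X ^ k" by (simp only: rW(2) mult_1_right)
  have "fps_nth (blaschke_fps M T * Abs_fps (fps_nth g)) \<in> bH2 M T" using g unfolding bH2_def by blast
  then have "fps_nth (blaschke_fps M T * g) \<in> bH2 M T" by (simp only: fps_nth_inverse)
  then have "l2inner f (fps_nth (blaschke_fps M T * g)) = 0" using f by (simp add: model_space_def)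
  then have "l2inner (bshift (minpoly_on M T) f) (fps_nth (fps_X ^ k)) = 0"
    using f unfolding bg by (subst (asm) l2inner_poly_mult[OF H2_fps_X_power]) (simp_all add: model_space_def)
  then show ?thesis by (simp add: l2inner_fps_X_power)
qed

text \<open>Every b u equals m (r u) with r u in H^2, and by the recurrence the adjoint of
  multiplication by m kills f.\<close>

lemma model_space_if_recurrence:
  assumes f: "f \<in> H2" and rec: "\<And>k. bshift (minpoly_on M T) f k = 0"
    and d: "\<And>l. poly (minpoly_on M T) l = 0 \<Longrightarrow> cmod l < 1"
  shows "f \<in> model_space M T"
proof -
  have z: "bshift (minpoly_on M T) f = 0" using rec by (simp add: fun_eq_iff)
  obtain r W where rW: "blaschke_fps M T = fps_of_poly (minpoly_on M T) * r"
    "\<And>u. \<lbrakk>\<And>l. poly (minpoly_on M T) l = 0 \<Longrightarrow> cmod l < 1; fps_nth u \<in> H2\<rbrakk> \<Longrightarrow> fps_nth (r * u) \<in> H2"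
    using blaschke_fps_factorization by metis
  have "l2inner f (fps_nth (blaschke_fps M T * Abs_fps g)) = 0" if "g \<in> H2" for g
  proof -
    have "fps_nth (Abs_fps g) = g" by (simp add: fun_eq_iff)
    then have rg: "fps_nth (r * Abs_fps g) \<in> H2" using that d by (intro rW(2)) auto
    have "l2inner f (fps_nth (blaschke_fps M T * Abs_fps g)) = l2inner 0 (fps_nth (r * Abs_fps g))"
      by (simp only: rW(1) mult.assoc l2inner_poly_mult[OF rg f] z)
    then show ?thesis using rg by (simp only: s2.ip_zero)
  qed
  then show ?thesis using f by (auto simp: model_space_def bH2_def)
qed

lemma bH2_subset_H2:
  assumes d: "\<And>l. poly (minpoly_on M T) l = 0 \<Longrightarrow> cmod l < 1"
  shows "bH2 M T \<subseteq> H2"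
proof
  fix h assume "h \<in> bH2 M T"
  then obtain g where g: "g \<in> H2" "h = fps_nth (blaschke_fps M T * Abs_fps g)" by (auto simp: bH2_def)
  obtain r W where rW: "blaschke_fps M T = fps_of_poly (minpoly_on M T) * r"
    "\<And>u. \<lbrakk>\<And>l. poly (minpoly_on M T) l = 0 \<Longrightarrow> cmod l < 1; fps_nth u \<in> H2\<rbrakk> \<Longrightarrow> fps_nth (r * u) \<in> H2"
    using blaschke_fps_factorization by metis
  have "fps_nth (Abs_fps g) = g" by (simp add: fun_eq_iff)
  then have "fps_nth (r * Abs_fps g) \<in> H2" using g d by (intro rW(2)) auto
  then show "h \<in> H2" unfolding g(2) rW(1) mult.assoc by (rule H2_poly_mult)
qed

text \<open>The recurrence is monic up to conjugation and has order deg m, so it determines each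
  later coefficient from the deg m preceding ones. Finite dimensionality of the model space, hence
  the existence of its projection, rests on this.\<close>

lemma model_space_eq_0:
  assumes f: "f \<in> model_space M T" and z: "\<And>j. j < degree (minpoly_on M T) \<Longrightarrow> f j = 0"
  shows "f k = 0"
proof (induction k rule: less_induct)
  case (less k)
  define d where "d = degree (minpoly_on M T)"
  show ?case
  proof (cases "k < d")
    case False
    have "0 = (\<Sum>i\<le>d. cnj (coeff (minpoly_on M T) i) * f (k - d + i))"
      using model_space_recurrence[OF f, of "k - d"] by (simp add: bshift_def d_def)
    also have "\<dots> = (\<Sum>i\<in>{d}. cnj (coeff (minpoly_on M T) i) * f (k - d + i))"
      using less False by (intro sum.mono_neutral_right) auto
    also have "\<dots> = f k" using False lead_coeff_minpoly[of M T] by (simp add: d_def)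
    finally show ?thesis by simp
  qed (use z in \<open>simp add: d_def\<close>)
qed

locale cnu_contraction =
  fixes T :: "'n::finite cmat" and M :: "'n cvec set"
  assumes contr: "contraction T" and red: "reduces M T" and cnu: "cnu_on M T"
begin

abbreviation "\<Delta> \<equiv> defect M T"
abbreviation "D \<equiv> defect_space M T"
abbreviation "N \<equiv> model_space M T"
abbreviation "pow k \<equiv> ((*v) (cadj T)) ^^ k"

lemmas Msub = reducesD[OF red] and Mclosed = csubspaceD[OF reducesD(1)[OF red]]
lemmas \<Delta>_add = defect_add[OF contr red] and \<Delta>_scale = defect_scale[OF contr red]

lemma roots_in_disc: "poly (minpoly_on M T) l = 0 \<Longrightarrow> cmod l < 1"
  by (rule cnu_spec_in_disc[OF contr red cnu root_minpoly_in_spec]) (use Msub in auto)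

lemma N_subset: "N \<subseteq> H2"
  by (auto simp: model_space_def)

lemma N_subspace: "s2.subspace N"
  unfolding s2.subspace_def
proof (intro conjI ballI allI)
  have "bH2 M T \<subseteq> H2" by (rule bH2_subset_H2) (rule roots_in_disc)
  then have b: "h \<in> H2" if "h \<in> bH2 M T" for h using that by blast
  show "0 \<in> N" using s2.H_closed(1) b by (simp only: model_space_def mem_Collect_eq) (blast intro: s2.ip_zero)
  fix f assume f: "f \<in> N"
  then have fH: "f \<in> H2" using N_subset by auto
  show "(\<lambda>k. c * f k) \<in> N" for c
    using f b s2.H_closed(4)[OF fH, of c] by (auto simp: model_space_def s2.ip_sc)
  fix g assume g: "g \<in> N"
  then have gH: "g \<in> H2" using N_subset by auto
  show "f + g \<in> N"
    using f g b s2.H_closed(2)[OF fH gH] by (auto simp: model_space_def s2.ip_add)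
qed

lemma N_projectable: "s2.projectable N"
proof (rule s2.projectable_if_separated[OF _ N_subspace N_subset])
  let ?\<Phi> = "(\<lambda>j (f :: nat \<Rightarrow> complex). f j) ` {..<degree (minpoly_on M T)}"
  show "f = 0" if "f \<in> N" "\<And>\<phi>. \<phi> \<in> ?\<Phi> \<Longrightarrow> \<phi> f = 0" for f
  proof
    fix k
    have "f j = 0" if "j < degree (minpoly_on M T)" for j
      using \<open>\<And>\<phi>. \<phi> \<in> ?\<Phi> \<Longrightarrow> \<phi> f = 0\<close>[of "\<lambda>f. f j"] that by blast
    from model_space_eq_0[OF \<open>f \<in> N\<close> this] show "f k = 0 k" by simp
  qed
qed auto

abbreviation "K \<equiv> model_tensor M T D"

lemma K_subset: "K \<subseteq> H2V UNIV"
  by (auto simp: model_tensor_def H2V_def)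

lemma K_subspace: "v2.subspace K"
proof -
  note D = csubspaceD[OF csubspace_defect_space[OF contr red]]
  have mem: "f \<in> K \<longleftrightarrow> f \<in> H2V UNIV \<and> (\<forall>k. f k \<in> D) \<and> (\<forall>v. (\<lambda>k. cinner (f k) v) \<in> N)" for f
    by (auto simp: model_tensor_def H2V_def)
  show ?thesis unfolding v2.subspace_def
  proof (intro conjI ballI allI)
    have "(\<lambda>k. cinner ((0 :: nat \<Rightarrow> 'n cvec) k) v) = 0" for v by (simp add: fun_eq_iff cinner_simps)
    then show "0 \<in> K" using D s2.subspace_0[OF N_subspace] v2.H_closed(1)
      by (simp only: mem) (simp add: cinner_simps)
    fix f assume f: "f \<in> K"
    show "(\<lambda>k. c *s f k) \<in> K" for c
      using f D v2.H_closed(4)[of f c] s2.subspace_scale[OF N_subspace, of _ c] by (simp add: mem cinner_simps)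
    fix g assume g: "g \<in> K"
    have "(\<lambda>k. cinner ((f + g) k) v) = (\<lambda>k. cinner (f k) v) + (\<lambda>k. cinner (g k) v)" for v
      by (simp add: fun_eq_iff cinner_simps)
    then show "f + g \<in> K"
      using f g D(2) v2.H_closed(2)[of f g] s2.subspace_add[OF N_subspace] by (simp only: mem) (simp add: D)
  qed
qed

lemma K_projectable: "v2.projectable K"
proof (rule v2.projectable_if_separated[OF _ K_subspace K_subset])
  let ?\<Phi> = "(\<lambda>(j, i) (f :: nat \<Rightarrow> 'n cvec). f j $ i) ` ({..<degree (minpoly_on M T)} \<times> UNIV)"
  show "f = 0" if "f \<in> K" "\<And>\<phi>. \<phi> \<in> ?\<Phi> \<Longrightarrow> \<phi> f = 0" for f
  proof -
    have "f k $ i = 0" for k i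
    proof -
      have "(\<lambda>k. cinner (f k) (axis i 1)) \<in> N" using \<open>f \<in> K\<close> by (simp add: model_tensor_def)
      moreover have "cinner x (axis i 1) = x $ i" for x :: "'n cvec"
        by (simp add: cinner_def axis_def if_distrib cong: if_cong)
      ultimately have "(\<lambda>k. f k $ i) \<in> N" by simp
      moreover have "f j $ i = 0" if "j < degree (minpoly_on M T)" for j
        using \<open>\<And>\<phi>. \<phi> \<in> ?\<Phi> \<Longrightarrow> \<phi> f = 0\<close>[of "\<lambda>f. f j $ i"] that by force
      ultimately show ?thesis by (rule model_space_eq_0)
    qed
    then show ?thesis by (simp add: fun_eq_iff vec_eq_iff)
  qed
qed auto

text \<open>The isometry V of the overview, the observability map of the adjoint of \<open>T\<close>
  with output operator \<Delta>.\<close>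

definition dil :: "'n cvec \<Rightarrow> nat \<Rightarrow> 'n cvec" where
  "dil h k = \<Delta> (pow k h)"

lemma pow_mem: "h \<in> M \<Longrightarrow> pow k h \<in> M"
  using Msub by (intro funpow_mem) auto

lemma dil_linear:
  "\<lbrakk>g \<in> M; h \<in> M\<rbrakk> \<Longrightarrow> dil (g + h) = dil g + dil h"
  "h \<in> M \<Longrightarrow> dil (c *s h) = (\<lambda>k. c *s dil h k)"
  by (simp_all add: fun_eq_iff dil_def matpow_linear \<Delta>_add \<Delta>_scale pow_mem)

lemma dil_Suc: "dil h (Suc k) = dil (cadj T *v h) k"
  by (simp add: dil_def funpow_swap1)

text \<open>Each term is the drop of the squared norm from one power of the adjoint to the next. The
  sum telescopes, and the remainder vanishes because the powers tend to 0.\<close>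

lemma dil_sums:
  assumes h: "h \<in> M"
  shows "(\<lambda>k. (norm (dil h k))\<^sup>2) sums (norm h)\<^sup>2"
proof -
  have "(\<Sum>k<n. (norm (dil h k))\<^sup>2) = (norm h)\<^sup>2 - (norm (pow n h))\<^sup>2" for n
    by (induction n) (simp_all add: dil_def norm_defect[OF contr red pow_mem[OF h]])
  moreover have "(\<lambda>n. (norm h)\<^sup>2 - (norm (pow n h))\<^sup>2) \<longlonglongrightarrow> (norm h)\<^sup>2 - 0\<^sup>2"
    by (intro tendsto_intros tendsto_norm_zero cnu_powers_tendsto_zero[OF contr red cnu h])
  ultimately show ?thesis by (simp add: sums_def)
qed

lemma dil_H2V: "h \<in> M \<Longrightarrow> dil h \<in> H2V D"
  using sums_summable[OF dil_sums] by (auto simp: H2V_def dil_def defect_space_def pow_mem)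

text \<open>The recurrence applied to the components produces \<Delta> of the conjugated minimal
  polynomial in the adjoint of \<open>T\<close>, evaluated at \<open>pow k h\<close>. That
  polynomial annihilates \<open>M\<close>.\<close>

lemma dil_component:
  assumes h: "h \<in> M"
  shows "(\<lambda>k. cinner (dil h k) v) \<in> N"
proof (rule model_space_if_recurrence[OF _ _ roots_in_disc])
  have "summable (\<lambda>k. (cmod (cinner (dil h k) v))\<^sup>2)"
  proof (rule summable_comparison_test')
    show "summable (\<lambda>k. (norm (dil h k))\<^sup>2 * (norm v)\<^sup>2)"
      by (rule summable_mult2[OF sums_summable[OF dil_sums[OF h]]])
    show "norm ((cmod (cinner (dil h k) v))\<^sup>2) \<le> (norm (dil h k))\<^sup>2 * (norm v)\<^sup>2" for k
      using cv.cauchy_schwarz[of "dil h k" v] by (simp add: power_mult_distrib[symmetric] power_mono)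
  qed
  then show "(\<lambda>k. cinner (dil h k) v) \<in> H2" by (simp add: H2_def)
  fix k
  define m where "m = minpoly_on M T"
  have \<Delta>0: "\<Delta> 0 = 0" using \<Delta>_scale[of 0 0] Mclosed(1) by simp
  have \<Delta>sum: "\<Delta> (sum g I) = (\<Sum>i\<in>I. \<Delta> (g i))" if "\<And>i. i \<in> I \<Longrightarrow> g i \<in> M" for g and I :: "nat set"
    using that
  proof (induction I rule: infinite_finite_induct)
    case (insert i I)
    then have "sum g I \<in> M" by (intro Mclosed) auto
    with insert show ?case by (simp add: \<Delta>_add)
  qed (simp_all add: \<Delta>0)
  have "bshift m (\<lambda>k. cinner (dil h k) v) k = (\<Sum>i\<le>degree m. cinner (cnj (coeff m i) *s \<Delta> (pow i (pow k h))) v)"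
    by (simp add: bshift_def dil_def cinner_simps funpow_add add.commute)
  also have "\<dots> = cinner (\<Delta> (\<Sum>i\<le>degree m. cnj (coeff m i) *s pow i (pow k h))) v"
    using h by (subst \<Delta>sum) (auto simp: cv.ip_sum \<Delta>_scale pow_mem Mclosed)
  also have "(\<Sum>i\<le>degree m. cnj (coeff m i) *s pow i (pow k h)) = polyop (map_poly cnj m) (cadj T) (pow k h)"
    by (simp add: polyop_def degree_map_poly coeff_map_poly)
  also have "\<dots> = 0"
    unfolding m_def by (rule polyop_cnj_annihilates[OF red annihilates_minpoly pow_mem[OF h]])
  finally show "bshift (minpoly_on M T) (\<lambda>k. cinner (dil h k) v) k = 0" by (simp add: m_def \<Delta>0 cinner_simps)
qed

lemma dil_K: "h \<in> M \<Longrightarrow> dil h \<in> K"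
  by (simp add: model_tensor_def dil_H2V dil_component)

lemma nrm_dil:
  assumes h: "h \<in> M" shows "v2.nrm (dil h) = norm h"
proof -
  have "dil h \<in> H2V UNIV" using dil_K[OF h] K_subset by auto
  then show ?thesis using sums_unique[OF dil_sums[OF h], symmetric] by (simp add: v2_nrm vnorm_def)
qed

end

subsection \<open>Norm bounds by the models\<close>

lemma (in cnu_contraction) model_op_props:
  assumes f: "f \<in> N"
  shows "model_op M T f \<in> N" "s2.nrm (model_op M T f) \<le> s2.nrm f"
    "g \<in> N \<Longrightarrow> l2inner (model_op M T f) g = l2inner f (\<lambda>k. g (Suc k))"
proof -
  have fH: "f \<in> H2" "shift f \<in> H2" using f N_subset shift_H2(1) by auto
  have op: "model_op M T f = s2.proj N (shift f)" by (simp add: model_op_def s2_proj)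
  show "model_op M T f \<in> N" unfolding op by (rule s2.proj_mem[OF N_projectable fH(2)])
  show "s2.nrm (model_op M T f) \<le> s2.nrm f"
    unfolding op using s2.nrm_proj_le[OF N_projectable fH(2)] shift_H2(2)[OF fH(1)] by simp
  show "l2inner (model_op M T f) g = l2inner f (\<lambda>k. g (Suc k))" if "g \<in> N"
    unfolding op using that N_subset fH by (simp add: s2.ip_proj[OF N_projectable] l2inner_shift subset_iff)
qed

text \<open>Pairing with \<open>dil h\<close>, an element of \<open>K\<close>, removes the
  projection; the adjoint of the shift is the backward shift, which sends \<open>dil h\<close> to
  \<open>dil\<close> of the adjoint applied to h.\<close>

lemma (in cnu_contraction) model_op_tensor_props:
  assumes f: "f \<in> K"
  shows "model_op_tensor M T D f \<in> K" "v2.nrm (model_op_tensor M T D f) \<le> v2.nrm f"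
    "h \<in> M \<Longrightarrow> vinner (model_op_tensor M T D f) (dil h) = vinner f (dil (cadj T *v h))"
proof -
  have fH: "f \<in> H2V UNIV" using f K_subset by auto
  then have sH: "shift f \<in> H2V UNIV" by (rule shift_H2V(1))
  have op: "model_op_tensor M T D f = v2.proj K (shift f)" by (simp add: model_op_tensor_def v2_proj)
  show "model_op_tensor M T D f \<in> K" unfolding op by (rule v2.proj_mem[OF K_projectable sH])
  show "v2.nrm (model_op_tensor M T D f) \<le> v2.nrm f"
    unfolding op using v2.nrm_proj_le[OF K_projectable sH] shift_H2V(2)[OF fH] by simp
  show "vinner (model_op_tensor M T D f) (dil h) = vinner f (dil (cadj T *v h))" if h: "h \<in> M"
  proof -
    have "dil h \<in> H2V UNIV" using dil_K[OF h] K_subset by auto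
    then show ?thesis unfolding op
      using fH by (simp add: v2.ip_proj[OF K_projectable sH dil_K[OF h]] vinner_shift dil_Suc)
  qed
qed

text \<open>The isometry \<open>dil\<close> read coordinatewise; it reassembles scalar estimates on
  \<open>N\<close> into an estimate on \<open>M\<close>.\<close>

lemma (in cnu_contraction) nrm_components:
  assumes h: "h \<in> M"
  shows "(norm h)\<^sup>2 = (\<Sum>i\<in>UNIV. (s2.nrm (\<lambda>k. cinner (dil h k) (axis i 1)))\<^sup>2)"
proof -
  have c: "cinner x (axis i 1) = x $ i" for x :: "'n cvec" and i
    by (simp add: cinner_def axis_def if_distrib cong: if_cong)
  have H: "(\<lambda>k. cinner (dil h k) (axis i 1)) \<in> H2" for i using dil_component[OF h] N_subset by auto
  then have H': "(\<lambda>k. dil h k $ i) \<in> H2" for i unfolding c .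
  have sm: "summable (\<lambda>k. (cmod (dil h k $ i))\<^sup>2)" for i using H[of i] by (simp add: H2_def c)
  have "(norm h)\<^sup>2 = (\<Sum>k. \<Sum>i\<in>UNIV. (cmod (dil h k $ i))\<^sup>2)"
    unfolding sums_unique[OF dil_sums[OF h]] by (simp add: norm_vec_def L2_set_def sum_nonneg)
  also have "\<dots> = (\<Sum>i\<in>UNIV. \<Sum>k. (cmod (dil h k $ i))\<^sup>2)" by (rule suminf_sum) (rule sm)
  also have "\<dots> = (\<Sum>i\<in>UNIV. (s2.nrm (\<lambda>k. cinner (dil h k) (axis i 1)))\<^sup>2)"
  proof (intro sum.cong refl)
    fix i
    show "(\<Sum>k. (cmod (dil h k $ i))\<^sup>2) = (s2.nrm (\<lambda>k. cinner (dil h k) (axis i 1)))\<^sup>2"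
      using suminf_nonneg[OF sm[of i]] by (simp only: c s2_nrm[OF H'] l2norm_def) simp
  qed
  finally show ?thesis .
qed

text \<open>Applying the compression bound coordinatewise avoids the tensor product \<open>B\<^sub>T \<otimes> I\<close>.\<close>

lemma (in cnu_contraction) norm_padj_le_l2opnorm:
  assumes A: "\<And>f. f \<in> N \<Longrightarrow> A f \<in> N" "\<And>f. f \<in> N \<Longrightarrow> s2.nrm (A f) \<le> s2.nrm f"
    and B: "\<And>f. f \<in> N \<Longrightarrow> B f \<in> N" "\<And>f. f \<in> N \<Longrightarrow> s2.nrm (B f) \<le> s2.nrm f"
    and R: "\<And>h. h \<in> M \<Longrightarrow> R1 h \<in> M" "\<And>h. h \<in> M \<Longrightarrow> R2 h \<in> M"
    and adjA: "\<And>f h v. \<lbrakk>f \<in> N; h \<in> M\<rbrakk> \<Longrightarrow> l2inner (A f) (\<lambda>k. cinner (dil h k) v) = l2inner f (\<lambda>k. cinner (dil (R1 h) k) v)"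
    and adjB: "\<And>f h v. \<lbrakk>f \<in> N; h \<in> M\<rbrakk> \<Longrightarrow> l2inner (B f) (\<lambda>k. cinner (dil h k) v) = l2inner f (\<lambda>k. cinner (dil (R2 h) k) v)"
    and h: "h \<in> M"
  shows "norm (padj p R1 R2 h) \<le> l2opnorm_on N (pseq p A B) * norm h" "0 \<le> l2opnorm_on N (pseq p A B)"
proof -
  define c where "c = Sup {s2.nrm (peval2 p (\<lambda>c f k. c * f k) A B f) | f. f \<in> N \<and> s2.nrm f \<le> 1}"
  have "s2.nrm (peval2 p (\<lambda>c f k. c * f k) A B f) = l2norm (pseq p A B f)" if "f \<in> N" for f
    unfolding pseq_def by (rule s2_nrm[OF subsetD[OF N_subset s2.peval2_mem[OF N_subspace N_subset A B that]]])
  moreover have "s2.nrm f = l2norm f" if "f \<in> N" for f using that N_subset s2_nrm by auto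
  ultimately have "{s2.nrm (peval2 p (\<lambda>c f k. c * f k) A B f) | f. f \<in> N \<and> s2.nrm f \<le> 1}
      = {l2norm (pseq p A B f) | f. f \<in> N \<and> l2norm f \<le> 1}" by (intro Collect_cong) metis
  then have c: "c = l2opnorm_on N (pseq p A B)" by (simp add: c_def l2opnorm_on_def)
  have c0: "0 \<le> c" unfolding c_def by (rule s2.peval2_Sup_nonneg[OF N_subspace N_subset A B])
  show "0 \<le> l2opnorm_on N (pseq p A B)" using c0 c by simp
  define V where "V v h = (\<lambda>k. cinner (dil h k) v)" for v h
  have le: "s2.nrm (V v (padj p R1 R2 h)) \<le> c * s2.nrm (V v h)" for v
    unfolding c_def
  proof (rule s2.compression_bound[OF N_subspace N_subset Msub(1) A B])
    show "V v h \<in> N" if "h \<in> M" for h unfolding V_def by (rule dil_component[OF that])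
    show "V v (g + h) = V v g + V v h" if "g \<in> M" "h \<in> M" for g h
      using that by (simp add: V_def dil_linear fun_eq_iff cinner_simps)
    show "V v (a *s h) = (\<lambda>k. a * V v h k)" if "h \<in> M" for a h
      using that by (simp add: V_def dil_linear fun_eq_iff cinner_simps)
  qed (use R adjA adjB h in \<open>auto simp: V_def\<close>)
  have pM: "padj p R1 R2 h \<in> M" unfolding padj_def
    by (intro Mclosed funpow_mem[of M R2] funpow_mem[of M R1]) (use R h in auto)
  have V0: "0 \<le> s2.nrm (V v h)" if "h \<in> M" for v h
    using dil_component[OF that] N_subset s2.nrm_nonneg unfolding V_def by blast
  \<comment> \<open>A single component map is not isometric, but all of them satisfy the estimate
    with the same constant c, and their squared norms add up to the squared norm in
    \<open>M\<close>.\<close>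
  have "(norm (padj p R1 R2 h))\<^sup>2 = (\<Sum>i\<in>UNIV. (s2.nrm (V (axis i 1) (padj p R1 R2 h)))\<^sup>2)"
    unfolding V_def by (rule nrm_components[OF pM])
  also have "\<dots> \<le> (\<Sum>i\<in>UNIV. (c * s2.nrm (V (axis i 1) h))\<^sup>2)"
    by (intro sum_mono power_mono le V0 pM)
  also have "\<dots> = c\<^sup>2 * (norm h)\<^sup>2"
    unfolding nrm_components[OF h] V_def by (simp add: power_mult_distrib sum_distrib_left)
  finally have "(norm (padj p R1 R2 h))\<^sup>2 \<le> (c * norm h)\<^sup>2" by (simp add: power_mult_distrib)
  then show "norm (padj p R1 R2 h) \<le> l2opnorm_on N (pseq p A B) * norm h"
    using c0 unfolding c[symmetric] by - (rule power2_le_imp_le, auto)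
qed

lemma (in cnu_contraction) norm_padj_le_vopnorm:
  assumes A: "\<And>f. f \<in> K \<Longrightarrow> A f \<in> K" "\<And>f. f \<in> K \<Longrightarrow> v2.nrm (A f) \<le> v2.nrm f"
    and B: "\<And>f. f \<in> K \<Longrightarrow> B f \<in> K" "\<And>f. f \<in> K \<Longrightarrow> v2.nrm (B f) \<le> v2.nrm f"
    and R: "\<And>h. h \<in> M \<Longrightarrow> R1 h \<in> M" "\<And>h. h \<in> M \<Longrightarrow> R2 h \<in> M"
    and adjA: "\<And>f h. \<lbrakk>f \<in> K; h \<in> M\<rbrakk> \<Longrightarrow> vinner (A f) (dil h) = vinner f (dil (R1 h))"
    and adjB: "\<And>f h. \<lbrakk>f \<in> K; h \<in> M\<rbrakk> \<Longrightarrow> vinner (B f) (dil h) = vinner f (dil (R2 h))"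
    and h: "h \<in> M"
  shows "norm (padj p R1 R2 h) \<le> vopnorm_on K (pvseq p A B) * norm h" "0 \<le> vopnorm_on K (pvseq p A B)"
proof -
  define c where "c = Sup {v2.nrm (peval2 p (\<lambda>c f k. c *s f k) A B f) | f. f \<in> K \<and> v2.nrm f \<le> 1}"
  have "v2.nrm (peval2 p (\<lambda>c f k. c *s f k) A B f) = vnorm (pvseq p A B f)" if "f \<in> K" for f
    unfolding pvseq_def by (rule v2_nrm[OF subsetD[OF K_subset v2.peval2_mem[OF K_subspace K_subset A B that]]])
  moreover have "v2.nrm f = vnorm f" if "f \<in> K" for f using that K_subset v2_nrm by auto
  ultimately have "{v2.nrm (peval2 p (\<lambda>c f k. c *s f k) A B f) | f. f \<in> K \<and> v2.nrm f \<le> 1}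
      = {vnorm (pvseq p A B f) | f. f \<in> K \<and> vnorm f \<le> 1}" by (intro Collect_cong) metis
  then have c: "c = vopnorm_on K (pvseq p A B)" by (simp add: c_def vopnorm_on_def)
  show "0 \<le> vopnorm_on K (pvseq p A B)"
    unfolding c[symmetric] c_def by (rule v2.peval2_Sup_nonneg[OF K_subspace K_subset A B])
  have pM: "padj p R1 R2 h \<in> M" unfolding padj_def
    by (intro Mclosed funpow_mem[of M R2] funpow_mem[of M R1]) (use R h in auto)
  have "v2.nrm (dil (padj p R1 R2 h)) \<le> c * v2.nrm (dil h)" unfolding c_def
    by (rule v2.compression_bound[OF K_subspace K_subset Msub(1) A B])
      (use R adjA adjB h dil_K dil_linear in auto)
  then show "norm (padj p R1 R2 h) \<le> vopnorm_on K (pvseq p A B) * norm h"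
    using h pM by (simp add: nrm_dil c)
qed

text \<open>Energy balance makes multiplication by the transfer function contractive, and
  compression keeps it so. The intertwining relation comes from summing
  \<open>transfer_adjoint_step\<close> along \<open>pow k h\<close>: only a boundary term survives,
  and it tends to 0.\<close>

lemma (in cnu_contraction) phi_B_props:
  fixes T' :: "'n cmat"
  assumes T': "contraction T'" and M': "reduces M T'" and comm: "T ** T' = T' ** T"
    and U: "U \<in> unitaries_U M T T'" and f: "f \<in> K"
  shows "phi_B M T T' U f \<in> K" "v2.nrm (phi_B M T T' U f) \<le> v2.nrm f"
    "h \<in> M \<Longrightarrow> vinner (phi_B M T T' U f) (dil h) = vinner f (dil (cadj T' *v h))"
proof -
  define S where "S = D \<times> defect_space M T'"
  interpret col: colligation D "defect_space M T'" U
    by unfold_locales (use U in \<open>auto intro!: csubspace_defect_space contr red T' M' simp: unitaries_U_def\<close>)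
  define st where "st = state (adj_pair S U) f"
  define y where "y = phi_S S U f"
  have fH: "f \<in> H2V UNIV" and fD: "f k \<in> D" for k using f K_subset by (auto simp: model_tensor_def H2V_def)
  define Y where "Y = (\<Sum>k. (norm (f k))\<^sup>2)"
  have sf: "summable (\<lambda>k. (norm (f k))\<^sup>2)" using fH by (simp add: H2V_def)
  \<comment> \<open>Used twice: without the state term it bounds the output, and without the output
    terms it bounds every state by the square root of Y.\<close>
  have energy: "(\<Sum>k<n. (norm (y k))\<^sup>2) + (norm (st n))\<^sup>2 \<le> Y" for n
    using col.energy_balance[of f n] fD sum_le_suminf[OF sf, of "{..<n}"]
    by (simp add: y_def st_def S_def Y_def)
  have ys: "(\<Sum>k<n. (norm (y k))\<^sup>2) \<le> Y" for n using energy[of n] zero_le_power2[of "norm (st n)"] by linarith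
  have sy: "summable (\<lambda>k. (norm (y k))\<^sup>2)" by (rule summableI_nonneg_bounded[OF _ ys]) simp
  then have yH: "y \<in> H2V UNIV" by (simp add: H2V_def)
  have "(\<Sum>k. (norm (y k))\<^sup>2) \<le> Y" by (rule suminf_le_const[OF sy ys])
  then have nrm_y: "v2.nrm y \<le> v2.nrm f" using fH yH by (simp add: v2_nrm vnorm_def Y_def)
  have op: "phi_B M T T' U f = v2.proj K y" by (simp add: phi_B_def v2_proj y_def S_def)
  show "phi_B M T T' U f \<in> K" unfolding op by (rule v2.proj_mem[OF K_projectable yH])
  show "v2.nrm (phi_B M T T' U f) \<le> v2.nrm f"
    unfolding op using v2.nrm_proj_le[OF K_projectable yH] nrm_y by simp
  show "vinner (phi_B M T T' U f) (dil h) = vinner f (dil (cadj T' *v h))" if h: "h \<in> M"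
  proof -
    \<comment> \<open>The boundary term of the telescoping sum. It vanishes at 0 with the initial
      state and tends to 0 because bounded states are paired with images of \<open>pow k h\<close>
      under a contraction.\<close>
    define s where "s k = cinner (st k) (defect M T' (pow k h))" for k
    have h': "cadj T' *v h \<in> M" using reducesD(3)[OF M'] h .
    have dH: "dil g \<in> H2V UNIV" if "g \<in> M" for g using dil_K[OF that] K_subset by auto
    have cc: "cadj T *v (cadj T' *v x) = cadj T' *v (cadj T *v x)" for x
      using arg_cong[OF comm, of cadj] by (simp add: cadj_mult matrix_vector_mul_assoc)
    have pc: "pow k (cadj T' *v h) = cadj T' *v pow k h" for k by (induction k) (simp_all add: cc)
    have step: "cinner (y k) (dil h k) - cinner (f k) (dil (cadj T' *v h) k) = s k - s (Suc k)" for k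
      using transfer_adjoint_step[OF contr T' red M' U pow_mem[OF h], of f k] fD
      unfolding y_def st_def s_def dil_def pc S_def by (simp add: algebra_simps)
    have s0: "s 0 = 0" by (simp add: s_def st_def cinner_simps)
    have "(\<Sum>k<n. cinner (y k) (dil h k) - cinner (f k) (dil (cadj T' *v h) k)) = - s n" for n
      unfolding step by (induction n) (simp_all add: s0)
    moreover have "s \<longlonglongrightarrow> 0"
    proof (rule Lim_null_comparison)
      show "(\<lambda>k. sqrt Y * norm (pow k h)) \<longlonglongrightarrow> 0"
        by (intro tendsto_mult_right_zero tendsto_norm_zero cnu_powers_tendsto_zero[OF contr red cnu h])
      have "norm (s k) \<le> sqrt Y * norm (pow k h)" for k
      proof -
        have "(norm (st k))\<^sup>2 \<le> Y" using energy[of k] sum_nonneg[of "{..<k}" "\<lambda>k. (norm (y k))\<^sup>2"] by simp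
        then have "norm (st k) \<le> sqrt Y" by (rule real_le_rsqrt)
        moreover have "norm (defect M T' (pow k h)) \<le> norm (pow k h)"
          using norm_defect[OF T' M' pow_mem[OF h, of k]] by - (rule power2_le_imp_le, auto)
        moreover have "norm (s k) \<le> norm (st k) * norm (defect M T' (pow k h))"
          unfolding s_def using cv.cauchy_schwarz[of "st k"] by simp
        ultimately show ?thesis by (meson mult_mono norm_ge_zero order_trans)
      qed
      then show "\<forall>\<^sub>F k in sequentially. norm (s k) \<le> sqrt Y * norm (pow k h)" by simp
    qed
    ultimately have "(\<lambda>k. cinner (y k) (dil h k) - cinner (f k) (dil (cadj T' *v h) k)) sums 0"
      using tendsto_minus[of s 0] by (simp add: sums_def)
    then have z: "(\<Sum>k. cinner (y k) (dil h k) - cinner (f k) (dil (cadj T' *v h) k)) = 0"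
      by (rule sums_unique[symmetric])
    have "summable (\<lambda>k. cinner (y k) (dil h k))" "summable (\<lambda>k. cinner (f k) (dil (cadj T' *v h) k))"
      using sy sf dH[OF h] dH[OF h'] by (auto intro!: fv.summable_ip simp: H2V_def)
    from suminf_diff[OF this] have "vinner y (dil h) = vinner f (dil (cadj T' *v h))"
      unfolding z vinner_def by simp
    then show ?thesis unfolding op by (simp add: v2.ip_proj[OF K_projectable yH dil_K[OF h]])
  qed
qed

text \<open>The operator that is modelled by the shift may stand in either variable of the
  polynomial. The first form serves (T1, T2) with U, the second serves (T2, T1) with W.\<close>

lemma cnu_pair_bound:
  fixes T T' :: "'n::finite cmat"
  assumes T: "contraction T" "contraction T'" and M: "reduces M T" "reduces M T'" and comm: "T ** T' = T' ** T"
    and cnu: "cnu_on M T" and U: "U \<in> unitaries_U M T T'"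
  defines "D \<equiv> defect_space M T"
  shows "opnorm_on M (pmat p T T') \<le> vopnorm_on (model_tensor M T D) (pvseq p (model_op_tensor M T D) (phi_B M T T' U))"
    and "opnorm_on M (pmat p T' T) \<le> vopnorm_on (model_tensor M T D) (pvseq p (phi_B M T T' U) (model_op_tensor M T D))"
proof -
  interpret cnu_contraction T M by unfold_locales (use assms in auto)
  note phi = phi_B_props[OF T(2) M(2) comm U] and mod = model_op_tensor_props
  note red = reducesD(3)[OF M(1)] reducesD(3)[OF M(2)]
  have 0: "0 \<in> M" by (rule Mclosed)
  let ?A = "model_op_tensor M T (defect_space M T)" and ?B = "phi_B M T T' U"
  let ?K = "model_tensor M T (defect_space M T)"
  have b1: "norm (padj p ((*v) (cadj T)) ((*v) (cadj T')) h) \<le> vopnorm_on ?K (pvseq p ?A ?B) * norm h"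
    "0 \<le> vopnorm_on ?K (pvseq p ?A ?B)" if "h \<in> M" for h
    by (rule norm_padj_le_vopnorm; (fact mod phi red that | use mod phi red that in blast))+
  have b2: "norm (padj p ((*v) (cadj T')) ((*v) (cadj T)) h) \<le> vopnorm_on ?K (pvseq p ?B ?A) * norm h"
    "0 \<le> vopnorm_on ?K (pvseq p ?B ?A)" if "h \<in> M" for h
    by (rule norm_padj_le_vopnorm; (fact mod phi red that | use mod phi red that in blast))+
  show "opnorm_on M (pmat p T T') \<le> vopnorm_on (model_tensor M T D) (pvseq p (model_op_tensor M T D) (phi_B M T T' U))"
    unfolding D_def by (intro opnorm_on_le Msub(1) norm_le_if_adjoint[OF M] b1(1) b1(2)[OF 0])
  show "opnorm_on M (pmat p T' T) \<le> vopnorm_on (model_tensor M T D) (pvseq p (phi_B M T T' U) (model_op_tensor M T D))"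
    unfolding D_def by (intro opnorm_on_le Msub(1) norm_le_if_adjoint[OF M(2,1)] b2(1) b2(2)[OF 0])
qed

subsection \<open>Decomposition into reducing subspaces\<close>

lemma norm_sum_le_if_orthogonal:
  fixes f g :: "'i \<Rightarrow> 'n::finite cvec"
  assumes I: "finite I" and c: "0 \<le> c"
    and f: "\<And>i j. \<lbrakk>i \<in> I; j \<in> I; i \<noteq> j\<rbrakk> \<Longrightarrow> cinner (f i) (f j) = 0"
    and g: "\<And>i j. \<lbrakk>i \<in> I; j \<in> I; i \<noteq> j\<rbrakk> \<Longrightarrow> cinner (g i) (g j) = 0"
    and le: "\<And>i. i \<in> I \<Longrightarrow> norm (g i) \<le> c * norm (f i)"
  shows "norm (sum g I) \<le> c * norm (sum f I)"
proof -
  have "(norm (sum g I))\<^sup>2 = (\<Sum>i\<in>I. (norm (g i))\<^sup>2)"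
    using cv.pythagoras_sum[OF I, of g] g by simp
  also have "\<dots> \<le> (\<Sum>i\<in>I. (c * norm (f i))\<^sup>2)" by (intro sum_mono power_mono le) auto
  also have "\<dots> = c\<^sup>2 * (\<Sum>i\<in>I. (norm (f i))\<^sup>2)" by (simp add: power_mult_distrib sum_distrib_left)
  also have "\<dots> = (c * norm (sum f I))\<^sup>2"
    using cv.pythagoras_sum[OF I, of f] f by (simp add: power_mult_distrib)
  finally show ?thesis using c by - (rule power2_le_imp_le, auto)
qed

lemma pmat_eigenvector:
  assumes "T1 *v x = l *s x" "T2 *v x = m *s x"
  shows "pmat p T1 T2 x = peval2_scalar p l m *s x"
proof -
  have 1: "(((*v) T1) ^^ i) x = l ^ i *s x" for i
    by (induction i) (simp_all add: assms matrix_vector_mult_scale mult.commute)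
  have 2: "(((*v) T2) ^^ i) x = m ^ i *s x" for i
    by (induction i) (simp_all add: assms matrix_vector_mult_scale mult.commute)
  show ?thesis
    by (simp add: pmat_def peval2_def peval2_scalar_def 1 2 matpow_scale vec.scale_sum_left mult_ac)
qed

lemma unitary_pair_bound:
  assumes comm: "T1 ** T2 = T2 ** T1" and M: "reduces M T1" "reduces M T2"
    and u: "unitary_on M T1" "unitary_on M T2" and ne: "M \<noteq> {0}"
  shows "opnorm_on M (pmat p T1 T2) \<le> Max ((\<lambda>(l, m). cmod (peval2_scalar p l m)) ` Omega_on M T1 T2)"
proof -
  define c where "c = Max ((\<lambda>(l, m). cmod (peval2_scalar p l m)) ` Omega_on M T1 T2)"
  have "\<exists>E. finite E \<and> E \<subseteq> M \<and> (\<forall>e\<in>E. norm e = 1 \<and> (\<exists>l. T1 *v e = l *s e) \<and> (\<exists>m. T2 *v e = m *s e)) \<and>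
    (\<forall>e\<in>E. \<forall>e'\<in>E. e \<noteq> e' \<longrightarrow> cinner e e' = 0) \<and> (\<forall>x\<in>M. x = (\<Sum>e\<in>E. cinner x e *s e))"
    by (rule joint_eigenbasis[OF comm M]) (use u in \<open>auto simp: unitary_on_def\<close>)
  then obtain E where E: "finite E" "E \<subseteq> M"
    "\<forall>e\<in>E. norm e = 1 \<and> (\<exists>l. T1 *v e = l *s e) \<and> (\<exists>m. T2 *v e = m *s e)"
    "\<forall>e\<in>E. \<forall>e'\<in>E. e \<noteq> e' \<longrightarrow> cinner e e' = 0" "\<forall>x\<in>M. x = (\<Sum>e\<in>E. cinner x e *s e)" by blast
  have "Omega_on M T1 T2 \<subseteq> spec_on M T1 \<times> spec_on M T2" by (auto simp: Omega_on_def)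
  then have fin: "finite (Omega_on M T1 T2)" by (rule finite_subset) (intro finite_cartesian_product finite_spec_on)
  have ev: "\<exists>a. pmat p T1 T2 e = a *s e \<and> cmod a \<le> c" if e: "e \<in> E" for e
  proof -
    obtain l m where lm: "T1 *v e = l *s e" "T2 *v e = m *s e" using E(3) e by blast
    have "e \<in> M" "e \<noteq> 0" using E(2,3) e by auto
    then have "(l, m) \<in> Omega_on M T1 T2" using lm by (auto simp: Omega_on_def spec_on_def)
    then have "cmod (peval2_scalar p l m) \<le> c" unfolding c_def by (intro Max_ge) (use fin in force)+
    then show ?thesis using pmat_eigenvector[OF lm] by blast
  qed
  \<comment> \<open>A basis vector shows that \<open>Omega_on\<close> is nonempty and that the
    maximum is nonnegative; this is where \<open>M\<close> being nonzero enters.\<close>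
  have "E \<noteq> {}"
  proof
    assume "E = {}"
    then have "x = 0" if "x \<in> M" for x using E(5) that by simp
    then show False using ne csubspaceD(1)[OF reducesD(1)[OF M(1)]] by blast
  qed
  then obtain e0 where "e0 \<in> E" by blast
  then have c0: "0 \<le> c" using ev[of e0] norm_ge_zero order_trans by blast
  have "norm (pmat p T1 T2 x) \<le> c * norm x" if x: "x \<in> M" for x
  proof -
    have orth: "cinner (a *s e) (b *s e') = 0" if "e \<in> E" "e' \<in> E" "e \<noteq> e'" for e e' a b
      using E(4) that by (simp add: cinner_simps)
    have ev': "\<exists>b. pmat p T1 T2 (cinner x e *s e) = b *s e \<and> norm (b *s e) \<le> c * norm (cinner x e *s e)" if e: "e \<in> E" for e
    proof -
      obtain a where a: "pmat p T1 T2 e = a *s e" "cmod a \<le> c" using ev[OF e] by blast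
      have "norm (a *s (cinner x e *s e)) \<le> c * norm (cinner x e *s e)"
        unfolding norm_scale_cvec[of a] by (intro mult_right_mono a) auto
      then show ?thesis using a(1) by (intro exI[of _ "a * cinner x e"]) (simp add: pmat_linear mult.commute)
    qed
    have "norm (\<Sum>e\<in>E. pmat p T1 T2 (cinner x e *s e)) \<le> c * norm (\<Sum>e\<in>E. cinner x e *s e)"
    proof (rule norm_sum_le_if_orthogonal[OF E(1) c0])
      fix e e' assume e: "e \<in> E" "e' \<in> E" "e \<noteq> e'"
      show "cinner (cinner x e *s e) (cinner x e' *s e') = 0" by (rule orth[OF e])
      obtain b b' where "pmat p T1 T2 (cinner x e *s e) = b *s e" "pmat p T1 T2 (cinner x e' *s e') = b' *s e'"
        using ev'[OF e(1)] ev'[OF e(2)] by blast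
      then show "cinner (pmat p T1 T2 (cinner x e *s e)) (pmat p T1 T2 (cinner x e' *s e')) = 0"
        using orth[OF e] by simp
    next
      fix e assume "e \<in> E"
      then show "norm (pmat p T1 T2 (cinner x e *s e)) \<le> c * norm (cinner x e *s e)" using ev'[of e] by auto
    qed
    moreover have "(\<Sum>e\<in>E. cinner x e *s e) = x" using bspec[OF E(5) x] by simp
    moreover have "(\<Sum>e\<in>E. pmat p T1 T2 (cinner x e *s e)) = pmat p T1 T2 (\<Sum>e\<in>E. cinner x e *s e)"
      by (rule pmat_sum[symmetric])
    ultimately show ?thesis by simp
  qed
  then show ?thesis unfolding c_def[symmetric] by (intro opnorm_on_le reducesD(1)[OF M(1)] c0)
qed

lemma unitary_eigenvector:
  assumes "unitary_on M T" "x \<in> M" "T *v x = l *s x"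
  shows "cadj T *v x = cnj l *s x"
  by (rule normal_eigenvector) (use assms in \<open>auto simp: unitary_on_def\<close>)

lemma csubspace_eigenspace: "csubspace M \<Longrightarrow> csubspace (eigenspace_on M T l)"
  by (auto simp: csubspace_def eigenspace_on_def matrix_vector_right_distrib vec.scale_right_distrib
      matrix_vector_mult_scale mult.commute)

text \<open>Invariance under T' is commutation. For the adjoint of T', commutation with the adjoint
  of T is combined with two facts: T inverts its adjoint on \<open>M\<close>, and an eigenvalue of a
  unitary has modulus 1.\<close>

lemma reduces_eigenspace:
  assumes M: "reduces M T" "reduces M T'" and u: "unitary_on M T" and comm: "T ** T' = T' ** T"
  shows "reduces (eigenspace_on M T l) T" "reduces (eigenspace_on M T l) T'"
proof -
  let ?E = "eigenspace_on M T l"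
  have E: "csubspace ?E" by (rule csubspace_eigenspace[OF reducesD(1)[OF M(1)]])
  have cc: "cadj T *v (cadj T' *v x) = cadj T' *v (cadj T *v x)" for x
    using arg_cong[OF comm, of cadj] by (simp add: cadj_mult matrix_vector_mul_assoc)
  have c: "T *v (T' *v x) = T' *v (T *v x)" for x using comm by (simp add: matrix_vector_mul_assoc)
  have adj: "cadj T *v x = cnj l *s x" if "x \<in> ?E" for x
    using that by (intro unitary_eigenvector[OF u]) (auto simp: eigenspace_on_def)
  show "reduces ?E T" unfolding reduces_def using E adj csubspaceD(3)[OF E]
    by (auto simp: eigenspace_on_def)
  have "cadj T' *v x \<in> ?E" if x: "x \<in> ?E" for x
  proof -
    have xM: "x \<in> M" "T *v x = l *s x" and T'x: "cadj T' *v x \<in> M" using x reducesD(3)[OF M(2)] by (auto simp: eigenspace_on_def)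
    \<comment> \<open>T T* is the identity on \<open>M\<close>, so the right side is also T'* x;
      multiplication by l then frees T T'* x on the left.\<close>
    have "cnj l *s (T *v (cadj T' *v x)) = T *v (cadj T *v (cadj T' *v x))"
      by (simp add: cc adj[OF x] matrix_vector_mult_scale)
    then have *: "cnj l *s (T *v (cadj T' *v x)) = cadj T' *v x" using u T'x by (simp add: unitary_on_def)
    show ?thesis
    proof (cases "x = 0")
      case False
      have "x = cadj T *v (T *v x)" using u xM(1) by (simp add: unitary_on_def)
      also have "\<dots> = (l * cnj l) *s x" by (simp add: xM matrix_vector_mult_scale adj[OF x])
      finally have "(1 - l * cnj l) *s x = 0" by (simp add: vec.scale_left_diff_distrib)
      then have "1 - l * cnj l = 0" using False unfolding vec.scale_eq_0_iff by blast
      then have "l * cnj l = 1" by simp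
      then have "T *v (cadj T' *v x) = l *s (cnj l *s (T *v (cadj T' *v x)))" by simp
      then show ?thesis using T'x by (simp add: eigenspace_on_def *)
    qed (use csubspaceD(1)[OF E] in simp)
  qed
  then show "reduces ?E T'" unfolding reduces_def using E reducesD(2)[OF M(2)]
    by (auto simp: eigenspace_on_def c matrix_vector_mult_scale)
qed

text \<open>The polynomial need not be diagonal in an eigenbasis of \<open>T\<close>, only block
  diagonal with respect to its eigenspaces. Basis vectors are therefore grouped by eigenvalue, and
  the orthogonal blocks are estimated separately.\<close>

lemma eigenspace_decomposition_bound:
  fixes T :: "'n::finite cmat"
  assumes M: "reduces M T" and u: "unitary_on M T" and c: "0 \<le> c"
    and inv: "\<And>l y. y \<in> eigenspace_on M T l \<Longrightarrow> pmat p T1 T2 y \<in> eigenspace_on M T l"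
    and le: "\<And>l y. \<lbrakk>l \<in> spec_on M T; y \<in> eigenspace_on M T l\<rbrakk> \<Longrightarrow> norm (pmat p T1 T2 y) \<le> c * norm y"
    and x: "x \<in> M"
  shows "norm (pmat p T1 T2 x) \<le> c * norm x"
proof -
  have "\<exists>E. finite E \<and> E \<subseteq> M \<and> (\<forall>e\<in>E. norm e = 1 \<and> (\<exists>l. T *v e = l *s e) \<and> (\<exists>m. T *v e = m *s e)) \<and>
    (\<forall>e\<in>E. \<forall>e'\<in>E. e \<noteq> e' \<longrightarrow> cinner e e' = 0) \<and> (\<forall>x\<in>M. x = (\<Sum>e\<in>E. cinner x e *s e))"
    by (rule joint_eigenbasis[OF refl M M]) (use u in \<open>auto simp: unitary_on_def\<close>)
  then obtain E where E: "finite E" "E \<subseteq> M"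
    "\<forall>e\<in>E. norm e = 1 \<and> (\<exists>l. T *v e = l *s e) \<and> (\<exists>m. T *v e = m *s e)"
    "\<forall>x\<in>M. x = (\<Sum>e\<in>E. cinner x e *s e)" by blast
  from E(3) have "\<forall>e\<in>E. \<exists>l. T *v e = l *s e" by blast
  then obtain ev where ev: "\<forall>e\<in>E. T *v e = ev e *s e" by (rule bchoice[THEN exE])
  have evspec: "ev ` E \<subseteq> spec_on M T"
  proof
    fix l assume "l \<in> ev ` E"
    then obtain e where e: "e \<in> E" "l = ev e" by auto
    then have "e \<in> M" "e \<noteq> 0" using E(2,3) by auto
    then show "l \<in> spec_on M T" using ev e by (auto simp: spec_on_def)
  qed
  define y where "y l = (\<Sum>e\<in>{e\<in>E. ev e = l}. cinner x e *s e)" for l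
  have yE: "y l \<in> eigenspace_on M T l" for l unfolding y_def
    by (intro csubspaceD(5,3)[OF csubspace_eigenspace[OF reducesD(1)[OF M]]])
      (use E(2) ev in \<open>auto simp: eigenspace_on_def\<close>)
  have x_eq: "x = (\<Sum>l\<in>spec_on M T. y l)"
  proof -
    have "x = (\<Sum>e\<in>E. cinner x e *s e)" using bspec[OF E(4) x] .
    also have "\<dots> = (\<Sum>l\<in>spec_on M T. y l)"
      unfolding y_def by (rule sum.group[OF E(1) finite_spec_on evspec, symmetric])
    finally show ?thesis .
  qed
  have orth: "cinner a b = 0" if "a \<in> eigenspace_on M T l" "b \<in> eigenspace_on M T l'" "l \<noteq> l'" for a b l l'
  proof -
    have ab: "T *v a = l *s a" "b \<in> M" "T *v b = l' *s b" using that by (auto simp: eigenspace_on_def)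
    have "l * cinner a b = cinner (T *v a) b" by (simp add: ab cinner_simps)
    also have "\<dots> = l' * cinner a b"
      by (simp add: cinner_cadj unitary_eigenvector[OF u ab(2,3)] cinner_simps)
    finally show ?thesis using that(3) by simp
  qed
  have "norm (\<Sum>l\<in>spec_on M T. pmat p T1 T2 (y l)) \<le> c * norm (\<Sum>l\<in>spec_on M T. y l)"
    by (rule norm_sum_le_if_orthogonal[OF finite_spec_on c]) (use orth yE inv le in blast)+
  then show ?thesis by (simp only: x_eq[symmetric] pmat_sum[symmetric])
qed

text \<open>On \<open>L\<close> the operator T is the scalar l, its adjoint is \<open>cnj l\<close>,
  and T' stays completely non-unitary because reducing subspaces inside \<open>L\<close> lie in
  \<open>M\<close>. Multiplication by l on the model space of T' on \<open>L\<close> thus plays the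
  role of the model of T, and the scalar form of the bound applies. The nonnegativity claims are
  needed when passing to a maximum over l.\<close>

lemma model_eigenspace_bound:
  fixes T T' :: "'n::finite cmat"
  assumes T: "contraction T" "contraction T'" and M: "reduces M T" "reduces M T'" and u: "unitary_on M T"
    and cnu: "cnu_on M T'" and comm: "T ** T' = T' ** T" and l: "l \<in> spec_on M T" and y: "y \<in> eigenspace_on M T l"
  defines "L \<equiv> eigenspace_on M T l"
  shows "norm (pmat p T T' y) \<le> l2opnorm_on (model_space L T') (pseq p (\<lambda>f k. l * f k) (model_op L T')) * norm y"
    and "norm (pmat p T' T y) \<le> l2opnorm_on (model_space L T') (pseq p (model_op L T') (\<lambda>f k. l * f k)) * norm y"
    and "0 \<le> l2opnorm_on (model_space L T') (pseq p (\<lambda>f k. l * f k) (model_op L T'))"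
    and "0 \<le> l2opnorm_on (model_space L T') (pseq p (model_op L T') (\<lambda>f k. l * f k))"
proof -
  have redL: "reduces L T" "reduces L T'" unfolding L_def by (rule reduces_eigenspace[OF M u comm])+
  have LM: "L \<subseteq> M" by (auto simp: L_def eigenspace_on_def)
  interpret cnu_contraction T' L
    by unfold_locales (use T(2) redL cnu LM in \<open>auto simp: cnu_on_def\<close>)
  have adj: "cadj T *v h = cnj l *s h" if "h \<in> L" for h
    using that by (intro unitary_eigenvector[OF u]) (auto simp: L_def eigenspace_on_def)
  obtain z where z: "z \<noteq> 0" "T *v z = l *s z" using l by (auto simp: spec_on_def)
  \<comment> \<open>The compression bound asks for contractions, so multiplication by l must not
    increase norms.\<close>
  have "cmod l * norm z \<le> norm z" using contraction_norm_le[OF T(1), of z] z by (simp add: norm_scale_cvec)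
  then have l1: "cmod l \<le> 1" using z by simp
  have N: "f \<in> H2" if "f \<in> N" for f using that N_subset by auto
  have A: "(\<lambda>k. l * f k) \<in> N" "s2.nrm (\<lambda>k. l * f k) \<le> s2.nrm f" if "f \<in> N" for f
    using s2.subspace_scale[OF N_subspace that] s2.nrm_sc[OF N[OF that], of l] l1 s2.nrm_nonneg[OF N[OF that]]
    by (auto simp: mult_left_le_one_le)
  have adjA: "l2inner (\<lambda>k. l * f k) (\<lambda>k. cinner (dil h k) v) = l2inner f (\<lambda>k. cinner (dil (cadj T *v h) k) v)"
    if f: "f \<in> N" and h: "h \<in> L" for f h v
  proof -
    have c: "(\<lambda>k. cinner (dil h k) v) \<in> H2" by (rule N[OF dil_component[OF h]])
    have "l2inner (\<lambda>k. l * f k) (\<lambda>k. cinner (dil h k) v) = l * l2inner f (\<lambda>k. cinner (dil h k) v)"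
      by (rule s2.ip_sc[OF N[OF f] c])
    also have "\<dots> = l2inner f (\<lambda>k. cnj l * cinner (dil h k) v)"
      using s2.ip_sc_right[OF N[OF f] c, of "cnj l"] by simp
    finally show ?thesis by (simp add: adj[OF h] dil_linear(2)[OF h] cinner_simps)
  qed
  have adjB: "l2inner (model_op L T' f) (\<lambda>k. cinner (dil h k) v) = l2inner f (\<lambda>k. cinner (dil (cadj T' *v h) k) v)"
    if f: "f \<in> N" and h: "h \<in> L" for f h v
    using model_op_props(3)[OF f dil_component[OF h]] by (simp add: dil_Suc)
  note R = reducesD(3)[OF redL(1)] reducesD(3)[OF redL(2)]
  have b1: "norm (padj p ((*v) (cadj T)) ((*v) (cadj T')) h) \<le> l2opnorm_on N (pseq p (\<lambda>f k. l * f k) (model_op L T')) * norm h"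
    "0 \<le> l2opnorm_on N (pseq p (\<lambda>f k. l * f k) (model_op L T'))" if "h \<in> L" for h
    by (rule norm_padj_le_l2opnorm; fact A model_op_props R adjA adjB that)+
  have b2: "norm (padj p ((*v) (cadj T')) ((*v) (cadj T)) h) \<le> l2opnorm_on N (pseq p (model_op L T') (\<lambda>f k. l * f k)) * norm h"
    "0 \<le> l2opnorm_on N (pseq p (model_op L T') (\<lambda>f k. l * f k))" if "h \<in> L" for h
    by (rule norm_padj_le_l2opnorm; fact A model_op_props R adjA adjB that)+
  have yL: "y \<in> L" using y by (simp add: L_def)
  show "0 \<le> l2opnorm_on N (pseq p (\<lambda>f k. l * f k) (model_op L T'))" by (rule b1(2)[OF yL])
  show "0 \<le> l2opnorm_on N (pseq p (model_op L T') (\<lambda>f k. l * f k))" by (rule b2(2)[OF yL])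
  show "norm (pmat p T T' y) \<le> l2opnorm_on N (pseq p (\<lambda>f k. l * f k) (model_op L T')) * norm y"
    by (rule norm_le_if_adjoint[OF redL b1(2)[OF yL] b1(1) yL])
  show "norm (pmat p T' T y) \<le> l2opnorm_on N (pseq p (model_op L T') (\<lambda>f k. l * f k)) * norm y"
    by (rule norm_le_if_adjoint[OF redL(2,1) b2(2)[OF yL] b2(1) yL])
qed

text \<open>The eigenspaces of T split \<open>M\<close> orthogonally, and on each the model bound is
  dominated by the maximum. A nonzero \<open>M\<close> has an eigenvector of T, so the maximum is
  over a nonempty set and nonnegative.\<close>

lemma unitary_cnu_bound:
  fixes T T' :: "'n::finite cmat"
  assumes T: "contraction T" "contraction T'" and M: "reduces M T" "reduces M T'" and u: "unitary_on M T"
    and cnu: "cnu_on M T'" and comm: "T ** T' = T' ** T" and ne: "M \<noteq> {0}"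
  shows "opnorm_on M (pmat p T T') \<le> Max ((\<lambda>l. l2opnorm_on (model_space (eigenspace_on M T l) T')
      (pseq p (\<lambda>f k. l * f k) (model_op (eigenspace_on M T l) T'))) ` spec_on M T)" (is "_ \<le> Max (?f ` _)")
    and "opnorm_on M (pmat p T' T) \<le> Max ((\<lambda>l. l2opnorm_on (model_space (eigenspace_on M T l) T')
      (pseq p (model_op (eigenspace_on M T l) T') (\<lambda>f k. l * f k))) ` spec_on M T)" (is "_ \<le> Max (?g ` _)")
proof -
  note M' = reducesD[OF M(1)]
  obtain l0 z where z: "z \<in> M" "z \<noteq> 0" "T *v z = l0 *s z" using ex_eigenvector[OF M'(1,2) ne] by blast
  then have l0: "l0 \<in> spec_on M T" and zE: "z \<in> eigenspace_on M T l0" by (auto simp: spec_on_def eigenspace_on_def)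
  note b = model_eigenspace_bound[OF T M u cnu comm, where p = p]
  have fin: "finite (?f ` spec_on M T)" "finite (?g ` spec_on M T)" using finite_spec_on by blast+
  have f: "?f l \<le> Max (?f ` spec_on M T)" and g: "?g l \<le> Max (?g ` spec_on M T)" if "l \<in> spec_on M T" for l
    using that fin by (auto intro: Max_ge)
  have f0: "0 \<le> Max (?f ` spec_on M T)" by (rule order_trans[OF b(3)[OF l0 zE] f[OF l0]])
  have g0: "0 \<le> Max (?g ` spec_on M T)" by (rule order_trans[OF b(4)[OF l0 zE] g[OF l0]])
  have red: "reduces (eigenspace_on M T l) T" "reduces (eigenspace_on M T l) T'" for l
    by (rule reduces_eigenspace[OF M u comm])+
  have inv: "pmat p T T' y \<in> eigenspace_on M T l" "pmat p T' T y \<in> eigenspace_on M T l"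
    if "y \<in> eigenspace_on M T l" for y l
    using that reducesD[OF red(1)[of l]] reducesD(2)[OF red(2)[of l]] by (auto intro!: pmat_mem)
  show "opnorm_on M (pmat p T T') \<le> Max (?f ` spec_on M T)"
  proof (rule opnorm_on_le[OF M'(1) _ f0], rule eigenspace_decomposition_bound[OF M(1) u f0 inv(1)])
    fix l y assume ly: "l \<in> spec_on M T" "y \<in> eigenspace_on M T l"
    show "norm (pmat p T T' y) \<le> Max (?f ` spec_on M T) * norm y"
      by (rule order_trans[OF b(1)[OF ly] mult_right_mono[OF f[OF ly(1)]]]) simp
  qed
  show "opnorm_on M (pmat p T' T) \<le> Max (?g ` spec_on M T)"
  proof (rule opnorm_on_le[OF M'(1) _ g0], rule eigenspace_decomposition_bound[OF M(1) u g0 inv(2)])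
    fix l y assume ly: "l \<in> spec_on M T" "y \<in> eigenspace_on M T l"
    show "norm (pmat p T' T y) \<le> Max (?g ` spec_on M T) * norm y"
      by (rule order_trans[OF b(2)[OF ly] mult_right_mono[OF g[OF ly(1)]]]) simp
  qed
qed

section \<open>Assembly of the four parts\<close>

lemma orthogonal_sum_bound:
  fixes T1 T2 :: "'n::finite cmat" and Hs :: "nat \<Rightarrow> 'n cvec set"
  assumes red1: "\<forall>i\<in>{1..4}. reduces (Hs i) T1" and red2: "\<forall>i\<in>{1..4}. reduces (Hs i) T2"
    and orth: "\<forall>i\<in>{1..4}. \<forall>j\<in>{1..4}. i \<noteq> j \<longrightarrow> (\<forall>x\<in>Hs i. \<forall>y\<in>Hs j. cinner x y = 0)"
    and span: "\<forall>x. \<exists>x1\<in>Hs 1. \<exists>x2\<in>Hs 2. \<exists>x3\<in>Hs 3. \<exists>x4\<in>Hs 4. x = x1 + x2 + x3 + x4"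
  shows "opnorm_on UNIV (pmat p T1 T2)
       \<le> Max {opnorm_on (Hs i) (pmat p T1 T2) | i. i \<in> {1..4} \<and> Hs i \<noteq> {0}}" (is "_ \<le> Max ?X")
proof -
  have I: "{1..4::nat} = {1, 2, 3, 4}" by auto
  have sub: "csubspace (Hs i)" if "i \<in> {1..4}" for i using red1 that reducesD(1) by blast
  have dec: "\<exists>xs. (\<forall>i\<in>{1..4}. xs i \<in> Hs i) \<and> x = (\<Sum>i\<in>{1..4}. xs i)" for x
  proof -
    obtain x1 x2 x3 x4 where xs: "x1 \<in> Hs 1" "x2 \<in> Hs 2" "x3 \<in> Hs 3" "x4 \<in> Hs 4" "x = x1 + x2 + x3 + x4"
      using span by blast
    show ?thesis unfolding I
      by (rule exI[of _ "\<lambda>i. if i = 1 then x1 else if i = 2 then x2 else if i = 3 then x3 else x4"])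
        (use xs in \<open>auto simp: add.assoc\<close>)
  qed
  have X: "finite ?X" by simp
  have le: "norm (pmat p T1 T2 x) \<le> opnorm_on (Hs i) (pmat p T1 T2) * norm x" "0 \<le> opnorm_on (Hs i) (pmat p T1 T2)"
    if "i \<in> {1..4}" "x \<in> Hs i" for x i
    by (rule le_opnorm_on[OF sub[OF that(1)] bounded_linear_pmat that(2)])+
  have "\<exists>i\<in>{1..4}. Hs i \<noteq> {0}"
  proof (rule ccontr)
    assume "\<not> (\<exists>i\<in>{1..4}. Hs i \<noteq> {0})"
    then have z: "Hs i = {0}" if "i \<in> {1..4}" for i using that by blast
    have "x = 0" for x :: "'n cvec"
    proof -
      obtain xs where xs: "\<forall>i\<in>{1..4}. xs i \<in> Hs i" "x = (\<Sum>i\<in>{1..4}. xs i)" using dec by blast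
      then show ?thesis using z by (simp add: sum.neutral)
    qed
    \<comment> \<open>Index types are nonempty, so C^n contains a nonzero vector. Hence some summand
      is nonzero and the maximum is over a nonempty set.\<close>
    from this[of "axis undefined 1"] show False by (simp add: axis_eq_0_iff)
  qed
  then obtain i0 where i0: "i0 \<in> {1..4}" "Hs i0 \<noteq> {0}" by blast
  have Max: "opnorm_on (Hs i) (pmat p T1 T2) \<le> Max ?X" if "i \<in> {1..4}" "Hs i \<noteq> {0}" for i
    by (rule Max_ge[OF X]) (use that in blast)
  have c0: "0 \<le> Max ?X"
    by (rule order_trans[OF le(2)[OF i0(1) csubspaceD(1)[OF sub[OF i0(1)]]] Max[OF i0]])
  have "norm (pmat p T1 T2 x) \<le> Max ?X * norm x" for x
  proof -
    obtain xs where xs: "\<forall>i\<in>{1..4}. xs i \<in> Hs i" "x = (\<Sum>i\<in>{1..4}. xs i)" using dec by blast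
    have pm: "pmat p T1 T2 (xs i) \<in> Hs i" if "i \<in> {1..4}" for i
      using that xs(1) red1 red2 sub by (intro pmat_mem) (auto simp: reduces_def)
    have "norm (\<Sum>i\<in>{1..4}. pmat p T1 T2 (xs i)) \<le> Max ?X * norm (\<Sum>i\<in>{1..4}. xs i)"
    proof (rule norm_sum_le_if_orthogonal[OF _ c0])
      fix i :: nat assume i: "i \<in> {1..4}"
      show "norm (pmat p T1 T2 (xs i)) \<le> Max ?X * norm (xs i)"
      proof (cases "Hs i = {0}")
        case True
        then have "xs i = 0" using xs(1) i by blast
        then show ?thesis by (simp add: pmat_0)
      next
        case False
        have xi: "xs i \<in> Hs i" using xs(1) i by blast
        show ?thesis by (rule order_trans[OF le(1)[OF i xi] mult_right_mono[OF Max[OF i False]]]) simp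
      qed
    qed (use orth xs(1) pm in blast)+
    then show ?thesis by (simp only: xs(2)[symmetric] pmat_sum[symmetric])
  qed
  then show ?thesis by (intro opnorm_on_le csubspace_UNIV c0)
qed

theorem mainTheorem18:
  fixes T1 T2 :: "complex ^ 'n::finite ^ 'n"
    and Hs :: "nat \<Rightarrow> (complex ^ 'n) set"
    and p :: "nat \<times> nat \<Rightarrow> complex"
  assumes contr1: "contraction T1" and contr2: "contraction T2"
    and comm: "T1 ** T2 = T2 ** T1"
    and red1: "\<forall>i\<in>{1..4}. reduces (Hs i) T1"
    and red2: "\<forall>i\<in>{1..4}. reduces (Hs i) T2"
    and orth: "\<forall>i\<in>{1..4}. \<forall>j\<in>{1..4}. i \<noteq> j \<longrightarrow> (\<forall>x\<in>Hs i. \<forall>y\<in>Hs j. cinner x y = 0)"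
    and span: "\<forall>x. \<exists>x1\<in>Hs 1. \<exists>x2\<in>Hs 2. \<exists>x3\<in>Hs 3. \<exists>x4\<in>Hs 4. x = x1 + x2 + x3 + x4"
    and u11: "unitary_on (Hs 1) T1" and u12: "unitary_on (Hs 2) T1"
    and u21: "unitary_on (Hs 1) T2" and u23: "unitary_on (Hs 3) T2"
    and c13: "cnu_on (Hs 3) T1" and c14: "cnu_on (Hs 4) T1"
    and c22: "cnu_on (Hs 2) T2" and c24: "cnu_on (Hs 4) T2"
    and p: "poly2 p"
  shows
    "opnorm_on UNIV (pmat p T1 T2)
       \<le> Max {opnorm_on (Hs i) (pmat p T1 T2) | i. i \<in> {1..4} \<and> Hs i \<noteq> {0}}
     \<and> (Hs 1 \<noteq> {0} \<longrightarrow> opnorm_on (Hs 1) (pmat p T1 T2)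
          \<le> Max ((\<lambda>(l, m). cmod (peval2_scalar p l m)) ` Omega_on (Hs 1) T1 T2))
     \<and> (Hs 2 \<noteq> {0} \<longrightarrow> opnorm_on (Hs 2) (pmat p T1 T2)
          \<le> Max ((\<lambda>l. l2opnorm_on (model_space (eigenspace_on (Hs 2) T1 l) T2)
                   (pseq p (\<lambda>f k. l * f k) (model_op (eigenspace_on (Hs 2) T1 l) T2)))
                 ` spec_on (Hs 2) T1))
     \<and> (Hs 3 \<noteq> {0} \<longrightarrow> opnorm_on (Hs 3) (pmat p T1 T2)
          \<le> Max ((\<lambda>m. l2opnorm_on (model_space (eigenspace_on (Hs 3) T2 m) T1)
                   (pseq p (model_op (eigenspace_on (Hs 3) T2 m) T1) (\<lambda>f k. m * f k)))
                 ` spec_on (Hs 3) T2))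
     \<and> (Hs 4 \<noteq> {0} \<longrightarrow> opnorm_on (Hs 4) (pmat p T1 T2)
          \<le> (INF UW \<in> unitaries_U (Hs 4) T1 T2 \<times> unitaries_U (Hs 4) T2 T1.
               min (vopnorm_on (model_tensor (Hs 4) T1 (defect_space (Hs 4) T1))
                      (pvseq p (model_op_tensor (Hs 4) T1 (defect_space (Hs 4) T1))
                               (phi_B (Hs 4) T1 T2 (fst UW))))
                   (vopnorm_on (model_tensor (Hs 4) T2 (defect_space (Hs 4) T2))
                      (pvseq p (phi_B (Hs 4) T2 T1 (snd UW))
                               (model_op_tensor (Hs 4) T2 (defect_space (Hs 4) T2))))))"
proof (intro conjI impI)
  have R: "reduces (Hs i) T1" "reduces (Hs i) T2" if "i \<in> {1..4}" for i using red1 red2 that by blast+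
  note comm' = comm[symmetric]
  show "opnorm_on UNIV (pmat p T1 T2)
      \<le> Max {opnorm_on (Hs i) (pmat p T1 T2) | i. i \<in> {1..4} \<and> Hs i \<noteq> {0}}"
    by (rule orthogonal_sum_bound[OF red1 red2 orth span])
  show "opnorm_on (Hs 1) (pmat p T1 T2)
      \<le> Max ((\<lambda>(l, m). cmod (peval2_scalar p l m)) ` Omega_on (Hs 1) T1 T2)" if "Hs 1 \<noteq> {0}"
    by (rule unitary_pair_bound[OF comm _ _ u11 u21 that]) (auto intro: R)
  show "opnorm_on (Hs 2) (pmat p T1 T2)
      \<le> Max ((\<lambda>l. l2opnorm_on (model_space (eigenspace_on (Hs 2) T1 l) T2)
               (pseq p (\<lambda>f k. l * f k) (model_op (eigenspace_on (Hs 2) T1 l) T2))) ` spec_on (Hs 2) T1)"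
    if "Hs 2 \<noteq> {0}"
    by (rule unitary_cnu_bound(1)[OF contr1 contr2 _ _ u12 c22 comm that]) (auto intro: R)
  show "opnorm_on (Hs 3) (pmat p T1 T2)
      \<le> Max ((\<lambda>m. l2opnorm_on (model_space (eigenspace_on (Hs 3) T2 m) T1)
               (pseq p (model_op (eigenspace_on (Hs 3) T2 m) T1) (\<lambda>f k. m * f k))) ` spec_on (Hs 3) T2)"
    if "Hs 3 \<noteq> {0}"
    by (rule unitary_cnu_bound(2)[OF contr2 contr1 _ _ u23 c13 comm' that]) (auto intro: R)
  have R4: "reduces (Hs 4) T1" "reduces (Hs 4) T2" by (auto intro: R)
  show "opnorm_on (Hs 4) (pmat p T1 T2)
      \<le> (INF UW \<in> unitaries_U (Hs 4) T1 T2 \<times> unitaries_U (Hs 4) T2 T1.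
           min (vopnorm_on (model_tensor (Hs 4) T1 (defect_space (Hs 4) T1))
                  (pvseq p (model_op_tensor (Hs 4) T1 (defect_space (Hs 4) T1))
                           (phi_B (Hs 4) T1 T2 (fst UW))))
               (vopnorm_on (model_tensor (Hs 4) T2 (defect_space (Hs 4) T2))
                  (pvseq p (phi_B (Hs 4) T2 T1 (snd UW))
                           (model_op_tensor (Hs 4) T2 (defect_space (Hs 4) T2)))))"
  \<comment> \<open>An infimum of reals is bounded below termwise only over a nonempty index set,
    which requires both a U and a W. For W the two operators exchange roles.\<close>
  proof (rule cINF_greatest)
    show "unitaries_U (Hs 4) T1 T2 \<times> unitaries_U (Hs 4) T2 T1 \<noteq> {}"
      using unitaries_U_nonempty[OF contr1 contr2 comm R4] unitaries_U_nonempty[OF contr2 contr1 comm' R4(2,1)]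
      by blast
    fix UW assume "UW \<in> unitaries_U (Hs 4) T1 T2 \<times> unitaries_U (Hs 4) T2 T1"
    then have UW: "fst UW \<in> unitaries_U (Hs 4) T1 T2" "snd UW \<in> unitaries_U (Hs 4) T2 T1" by auto
    show "opnorm_on (Hs 4) (pmat p T1 T2)
      \<le> min (vopnorm_on (model_tensor (Hs 4) T1 (defect_space (Hs 4) T1))
                  (pvseq p (model_op_tensor (Hs 4) T1 (defect_space (Hs 4) T1))
                           (phi_B (Hs 4) T1 T2 (fst UW))))
               (vopnorm_on (model_tensor (Hs 4) T2 (defect_space (Hs 4) T2))
                  (pvseq p (phi_B (Hs 4) T2 T1 (snd UW))
                           (model_op_tensor (Hs 4) T2 (defect_space (Hs 4) T2))))"
      by (intro min.boundedI cnu_pair_bound(1)[OF contr1 contr2 R4 comm c14 UW(1)]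
          cnu_pair_bound(2)[OF contr2 contr1 R4(2,1) comm' c24 UW(2)])
  qed
qed

end
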